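(* The functional $E:\mathcal{A}_m\to\mathbb{R}$, $$E(\boldsymbol{u})=\int_\Omega\Big[\sum_{i=0}^n(u_i\ln u_i-u_i+1)+\frac{\varepsilon}{2}|\nabla u_0|^2+\beta u_0(1-u_0)\Big]dx,$$ has at least one minimizer (over $\mathcal{A}_m$).
   Context: Let $n\ge1$, let $\Omega\subset\mathbb{R}^d$, $d\in\{1,2,3\}$, be an open, smooth and bounded domain, and let $\varepsilon,\beta>0$. Fix masses $m_0,\dots,m_n>0$ with $\sum_{j=0}^n m_j=|\Omega|$. The admissible set is $$\mathcal{A}_m=\Big\{\boldsymbol{u}=(u_0,\dots,u_n)\in(L^\infty(\Omega))^{n+1}:\ u_i\ge0,\ \int_\Omega u_i\,dx=m_i\ (i=0,\dots,n),\ \sum_{j=0}^n u_j=1\text{ a.e. in }\Omega,\ u_0\in H^1(\Omega)\Big\}.$$ The convention $0\ln0=0$ is used. *)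

theory Defs
  imports "HOL-Analysis.Analysis"
begin

primrec Ck :: "nat \<Rightarrow> ('a::euclidean_space \<Rightarrow> real) \<Rightarrow> bool" where
  "Ck 0 f \<longleftrightarrow> continuous_on UNIV f"
| "Ck (Suc k) f \<longleftrightarrow> (\<forall>x. f differentiable (at x)) \<and>
     (\<forall>b\<in>Basis. Ck k (\<lambda>x. frechet_derivative f (at x) b))"

definition smooth :: "('a::euclidean_space \<Rightarrow> real) \<Rightarrow> bool" where
  "smooth f \<longleftrightarrow> (\<forall>k. Ck k f)"

text \<open>
  Near each boundary point, \<open>\<Omega>\<close> is the region on one side of the graph of a smooth function,
  after a rotation. The condition \<open>\<gamma> (y + t *\<^sub>R \<nu>) = \<gamma> y\<close> says that \<open>\<gamma>\<close> is a function of the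
  coordinates orthogonal to the vertical direction \<open>\<nu>\<close> only; in dimension 1, \<open>\<gamma>\<close> is a constant.
\<close>

definition smooth_boundary :: "'a::euclidean_space set \<Rightarrow> bool" where
  "smooth_boundary \<Omega> \<longleftrightarrow> (\<forall>x\<in>frontier \<Omega>. \<exists>r>0. \<exists>\<nu> \<gamma>. norm \<nu> = 1 \<and> smooth \<gamma> \<and>
     (\<forall>y t. \<gamma> (y + t *\<^sub>R \<nu>) = \<gamma> y) \<and>
     \<Omega> \<inter> ball x r = {y \<in> ball x r. y \<bullet> \<nu> > \<gamma> y})"

definition smooth_bounded_domain :: "'a::euclidean_space set \<Rightarrow> bool" where
  "smooth_bounded_domain \<Omega> \<longleftrightarrow>
     open \<Omega> \<and> connected \<Omega> \<and> \<Omega> \<noteq> {} \<and> bounded \<Omega> \<and> smooth_boundary \<Omega>"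

text \<open>
  Elements of the function spaces are represented by functions defined everywhere, of which only
  the almost-everywhere class on \<open>\<Omega>\<close> matters.
\<close>

definition Linf :: "'a::euclidean_space set \<Rightarrow> ('a \<Rightarrow> real) set" where
  "Linf \<Omega> = {f \<in> borel_measurable (lebesgue_on \<Omega>).
     \<exists>C. AE x in lebesgue_on \<Omega>. \<bar>f x\<bar> \<le> C}"

definition L2 :: "'a::euclidean_space set \<Rightarrow> ('a \<Rightarrow> 'b::euclidean_space) set" where
  "L2 \<Omega> = {f \<in> borel_measurable (lebesgue_on \<Omega>).
     integrable (lebesgue_on \<Omega>) (\<lambda>x. (norm (f x))\<^sup>2)}"

definition L1_loc :: "'a::euclidean_space set \<Rightarrow> ('a \<Rightarrow> 'b::euclidean_space) set" where
  "L1_loc \<Omega> = {f. \<forall>K. compact K \<and> K \<subseteq> \<Omega> \<longrightarrow> integrable (lebesgue_on K) f}"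

definition test_functions :: "'a::euclidean_space set \<Rightarrow> ('a \<Rightarrow> real) set" where
  "test_functions \<Omega> = {\<phi>. smooth \<phi> \<and>
     compact (closure {x. \<phi> x \<noteq> 0}) \<and> closure {x. \<phi> x \<noteq> 0} \<subseteq> \<Omega>}"

definition has_weak_gradient ::
    "'a::euclidean_space set \<Rightarrow> ('a \<Rightarrow> real) \<Rightarrow> ('a \<Rightarrow> 'a) \<Rightarrow> bool" where
  "has_weak_gradient \<Omega> f g \<longleftrightarrow> f \<in> L1_loc \<Omega> \<and> g \<in> L1_loc \<Omega> \<and>
     (\<forall>\<phi>\<in>test_functions \<Omega>. \<forall>b\<in>Basis.
        (LINT x|lebesgue_on \<Omega>. f x * frechet_derivative \<phi> (at x) b) =
        - (LINT x|lebesgue_on \<Omega>. (g x \<bullet> b) * \<phi> x))"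

definition H1 :: "'a::euclidean_space set \<Rightarrow> ('a \<Rightarrow> real) set" where
  "H1 \<Omega> = {f \<in> L2 \<Omega>. \<exists>g \<in> L2 \<Omega>. has_weak_gradient \<Omega> f g}"

text \<open>A representative of the weak gradient, which is unique up to null sets.\<close>

definition weak_gradient :: "'a::euclidean_space set \<Rightarrow> ('a \<Rightarrow> real) \<Rightarrow> 'a \<Rightarrow> 'a" where
  "weak_gradient \<Omega> f = (SOME g. has_weak_gradient \<Omega> f g)"

text \<open>
  A tuple \<open>(u\<^sub>0, \<dots>, u\<^sub>n)\<close> is represented by a function on \<open>nat\<close> whose values at indices above \<open>n\<close>
  are irrelevant.
\<close>

definition admissible ::
    "nat \<Rightarrow> 'a::euclidean_space set \<Rightarrow> (nat \<Rightarrow> real) \<Rightarrow> (nat \<Rightarrow> 'a \<Rightarrow> real) set" where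
  "admissible n \<Omega> m = {u.
     (\<forall>i\<le>n. u i \<in> Linf \<Omega> \<and> (AE x in lebesgue_on \<Omega>. u i x \<ge> 0) \<and>
            (LINT x|lebesgue_on \<Omega>. u i x) = m i) \<and>
     (AE x in lebesgue_on \<Omega>. (\<Sum>j=0..n. u j x) = 1) \<and>
     u 0 \<in> H1 \<Omega>}"

text \<open>The convention \<open>0 ln 0 = 0\<close> holds because \<open>0 * ln 0 = 0\<close> whatever the value of \<open>ln 0\<close>.\<close>

definition energy ::
    "nat \<Rightarrow> 'a::euclidean_space set \<Rightarrow> real \<Rightarrow> real \<Rightarrow> (nat \<Rightarrow> 'a \<Rightarrow> real) \<Rightarrow> real" where
  "energy n \<Omega> \<epsilon> \<beta> u = (LINT x|lebesgue_on \<Omega>.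
     (\<Sum>i=0..n. u i x * ln (u i x) - u i x + 1)
     + \<epsilon> / 2 * (norm (weak_gradient \<Omega> (u 0) x))\<^sup>2
     + \<beta> * u 0 x * (1 - u 0 x))"

end

theory Submission
  imports Defs "HOL-Complex_Analysis.Great_Picard"
begin

text \<open>
  The direct method, with strong convergence obtained from convexity. Write the integrand as a
  convex part, the entropies \<open>u\<^sub>i ln u\<^sub>i\<close> and \<open>\<epsilon>/2 |\<nabla>u\<^sub>0|\<^sup>2\<close>, plus the concave part
  \<open>\<beta> u\<^sub>0 (1 - u\<^sub>0)\<close>. On \<open>[0,1]\<close> the convex part is strongly convex, so that for admissible \<open>u\<close>, \<open>v\<close>
  the energy of the midpoint \<open>(u + v)/2\<close> lies below the mean of the two energies by a multiple of
  \<open>\<parallel>u - v\<parallel>\<^sup>2 + \<parallel>\<nabla>u\<^sub>0 - \<nabla>v\<^sub>0\<parallel>\<^sup>2\<close> in \<open>L\<^sup>2\<close>, up to the loss \<open>\<beta>/4 \<parallel>u\<^sub>0 - v\<^sub>0\<parallel>\<^sup>2\<close> caused by the concave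
  part (\<open>energy_midpoint\<close>). The midpoint is admissible, so its energy is at least the infimum.
  Therefore, if \<open>u\<^sub>0\<close> is already known to be Cauchy in \<open>L\<^sup>2\<close> along a minimizing sequence, then all
  components and the gradients are Cauchy in \<open>L\<^sup>2\<close> (\<open>minimizing_sequence_fast\<close>). A subsequence
  converges almost everywhere; the constraints and the weak gradient pass to the limit by dominated
  convergence, and Fatou's lemma, applied to the nonnegative integrand, shows that the limit is a
  minimizer (\<open>limit_admissible_energy_le\<close>).

  The Cauchy property of \<open>u\<^sub>0\<close> is a Rellich theorem (\<open>L1_Cauchy_subsequence\<close>). It suffices to work on
  compact subsets \<open>K\<close> of \<open>\<Omega>\<close>, since \<open>0 \<le> u\<^sub>0 \<le> 1\<close> makes the contribution of \<open>\<Omega> - K\<close> as small as the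
  measure of that set. On \<open>K\<close> a translation by \<open>h\<close> moves \<open>u\<^sub>0\<close> by at most \<open>|h| \<parallel>\<nabla>u\<^sub>0\<parallel>\<close> in \<open>L\<^sup>1\<close>
  (\<open>integral_translate_diff_le\<close>), so \<open>u\<^sub>0\<close> is uniformly close to its averages over small balls; these
  averages are equi-Lipschitz, and a diagonal argument makes them converge pointwise.

  The translation estimate is proved by duality. Against a test function \<open>\<phi>\<close>, the translation is
  moved to \<open>\<phi>\<close>, where it can be differentiated and the definition of the weak gradient applies; the
  bound for all \<open>|\<phi>| \<le> 1\<close> gives the \<open>L\<^sup>1\<close> bound (\<open>integral_abs_compact_le\<close>). The same duality shows
  that weak gradients are unique almost everywhere (\<open>weak_gradient_unique\<close>), so that the energy can
  be computed with any of them.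
\<close>

section \<open>Smooth functions and cutoffs\<close>

lemma frechet_derivative_eqI:
  "(f has_derivative D) (at x) \<Longrightarrow> frechet_derivative f (at x) = D"
  using frechet_derivative_at by metis

lemma Ck_SucI:
  fixes f :: "'a::euclidean_space \<Rightarrow> real"
  assumes "\<And>x. (f has_derivative D x) (at x)" "\<And>b. b \<in> Basis \<Longrightarrow> Ck k (\<lambda>x. D x b)"
  shows "Ck (Suc k) f"
proof -
  have "frechet_derivative f (at x) = D x" for x
    using assms(1) by (rule frechet_derivative_eqI)
  then show ?thesis using assms by (auto simp: differentiable_def)
qed

lemma Ck_SucE:
  assumes "Ck (Suc k) f"
  shows "(f has_derivative frechet_derivative f (at x)) (at x)"
    and "b \<in> Basis \<Longrightarrow> Ck k (\<lambda>x. frechet_derivative f (at x) b)"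
  using assms by (auto simp: frechet_derivative_works)

lemma Ck_const: "Ck k (\<lambda>x. c)"
proof (induction k arbitrary: c)
  case (Suc k)
  show ?case by (rule Ck_SucI[of _ "\<lambda>x h. 0"]) (auto simp: Suc)
qed simp

lemma Ck_linear:
  assumes "bounded_linear f" shows "Ck k f"
proof (cases k)
  case (Suc k)
  then show ?thesis
    using Ck_SucI[of f "\<lambda>x. f"] assms bounded_linear_imp_has_derivative Ck_const by metis
qed (simp add: assms linear_continuous_on)

lemma Ck_add:
  assumes "Ck k f" "Ck k g" shows "Ck k (\<lambda>x. f x + g x)"
  using assms
proof (induction k arbitrary: f g)
  case (Suc k)
  show ?case
    by (rule Ck_SucI, rule has_derivative_add; (rule Ck_SucE(1)[OF Suc.prems(1)] Ck_SucE(1)[OF Suc.prems(2)])?)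
       (auto intro!: Suc.IH Ck_SucE(2)[OF Suc.prems(1)] Ck_SucE(2)[OF Suc.prems(2)])
qed (auto intro: continuous_intros)

lemma Ck_SucD: "Ck (Suc k) f \<Longrightarrow> Ck k f"
proof (induction k arbitrary: f)
  case 0
  then show ?case
    by (auto intro!: differentiable_imp_continuous_on simp: differentiable_on_def)
next
  case (Suc k)
  show ?case
    by (rule Ck_SucI[OF Ck_SucE(1)[OF Suc.prems]]) (auto intro!: Suc.IH Ck_SucE(2)[OF Suc.prems])
qed

lemma Ck_mult:
  assumes "Ck k f" "Ck k g" shows "Ck k (\<lambda>x. f x * g x)"
  using assms
proof (induction k arbitrary: f g)
  case (Suc k)
  note 1 = Ck_SucE[OF Suc.prems(1)] and 2 = Ck_SucE[OF Suc.prems(2)]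
  show ?case
    by (rule Ck_SucI, rule has_derivative_mult[OF 1(1) 2(1)])
       (auto intro!: Suc.IH Ck_add 1 2 Ck_SucD[OF Suc.prems(1)] Ck_SucD[OF Suc.prems(2)])
qed (auto intro: continuous_intros)

lemma Ck_translate:
  assumes "Ck k f" shows "Ck k (\<lambda>x. f (x - h))"
  using assms
proof (induction k arbitrary: f)
  case 0
  then show ?case by (auto intro!: continuous_on_compose2[of UNIV f] continuous_intros)
next
  case (Suc k)
  have 1: "((\<lambda>x. x - h) has_derivative (\<lambda>v. v)) (at x)" for x
    by (auto intro!: derivative_eq_intros)
  have "((\<lambda>x. f (x - h)) has_derivative frechet_derivative f (at (x - h))) (at x)" for x
    using has_derivative_compose[OF 1 Ck_SucE(1)[OF Suc.prems]] .
  then show ?case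
    by (rule Ck_SucI) (auto intro!: Suc.IH Ck_SucE(2)[OF Suc.prems])
qed

lemma smooth_const: "smooth (\<lambda>x. c)"
  by (simp add: smooth_def Ck_const)

lemma smooth_add: "smooth f \<Longrightarrow> smooth g \<Longrightarrow> smooth (\<lambda>x. f x + g x)"
  by (simp add: smooth_def Ck_add)

lemma smooth_mult: "smooth f \<Longrightarrow> smooth g \<Longrightarrow> smooth (\<lambda>x. f x * g x)"
  by (simp add: smooth_def Ck_mult)

lemma smooth_diff:
  assumes "smooth f" "smooth g" shows "smooth (\<lambda>x. f x - g x)"
  using smooth_add[OF assms(1) smooth_mult[OF smooth_const[of "-1"] assms(2)]] by simp

lemma smooth_translate: "smooth f \<Longrightarrow> smooth (\<lambda>x. f (x - h))"
  by (simp add: smooth_def Ck_translate)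

lemma smooth_prod:
  "(\<And>i. i \<in> I \<Longrightarrow> smooth (f i)) \<Longrightarrow> smooth (\<lambda>x. \<Prod>i\<in>I. f i x)"
  by (induction I rule: infinite_finite_induct) (auto intro: smooth_mult smooth_const)

lemma smooth_power: "smooth f \<Longrightarrow> smooth (\<lambda>x. f x ^ j)"
  by (induction j) (auto intro: smooth_mult smooth_const)

lemma smooth_polynomial:
  assumes "real_polynomial_function p" shows "smooth p"
  using assms
proof induction
  case (linear f) then show ?case by (simp add: smooth_def Ck_linear)
qed (auto intro: smooth_const smooth_add smooth_mult)

lemma smooth_has_derivative:
  "smooth f \<Longrightarrow> (f has_derivative frechet_derivative f (at x)) (at x)"
  by (metis Ck_SucE(1) smooth_def)

lemma smooth_derivative:
  "smooth f \<Longrightarrow> b \<in> Basis \<Longrightarrow> smooth (\<lambda>x. frechet_derivative f (at x) b)"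
  by (metis Ck_SucE(2) smooth_def)

lemma smooth_continuous_on: "smooth f \<Longrightarrow> continuous_on S f"
  by (metis Ck.simps(1) continuous_on_subset smooth_def subset_UNIV)

text \<open>
  The derivatives of \<open>exp (- 1 / t)\<close>, extended by 0 to \<open>t \<le> 0\<close>,
  are linear combinations of these functions: the index \<open>j\<close> makes the family closed
  under differentiation.
\<close>

definition flat :: "nat \<Rightarrow> real \<Rightarrow> real" where
  "flat j t = (if t \<le> 0 then 0 else (1 / t) ^ j * exp (- (1 / t)))"

text \<open>
  This is the limit of the difference quotients of \<open>flat j\<close> at 0. In terms of
  \<open>y = 1 / t\<close> they are \<open>y ^ (j + 1) / exp y\<close>.
\<close>

lemma flat_over_arg_tendsto_0: "((\<lambda>t. flat j t / t) \<longlongrightarrow> 0) (at 0)"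
proof -
  have "((\<lambda>y::real. y ^ Suc j / exp y) \<longlongrightarrow> 0) at_top"
    by (rule tendsto_power_div_exp_0)
  then have "((\<lambda>t::real. (inverse t) ^ Suc j / exp (inverse t)) \<longlongrightarrow> 0) (at_right 0)"
    by (rule filterlim_compose) (rule filterlim_inverse_at_top_right)
  moreover have "\<forall>\<^sub>F t::real in at_right 0. (inverse t) ^ Suc j / exp (inverse t) = flat j t / t"
    unfolding eventually_at_right_field
    by (intro exI[of _ 1]) (auto simp: flat_def exp_minus field_simps)
  ultimately have r: "((\<lambda>t. flat j t / t) \<longlongrightarrow> 0) (at_right 0)"
    by (rule Lim_transform_eventually)
  have "((\<lambda>t. flat j t / t) \<longlongrightarrow> 0) (at_left 0)"
    by (rule tendsto_eventually)
       (auto simp: eventually_at_left_field flat_def intro!: exI[of _ "-1"])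
  with r show ?thesis by (simp add: filterlim_split_at)
qed

lemma flat_has_derivative:
  "DERIV (flat j) t :> - real j * flat (Suc j) t + flat (Suc (Suc j)) t"
proof -
  consider "t < 0" | "t = 0" | "t > 0" by linarith
  then show ?thesis
  proof cases
    case 1
    have "DERIV (\<lambda>t::real. 0::real) t :> 0" by simp
    then have "DERIV (flat j) t :> 0"
      by (rule has_field_derivative_transform_within_open[where S="{..<0}"])
         (use 1 in \<open>auto simp: flat_def\<close>)
    then show ?thesis using 1 by (simp add: flat_def)
  next
    case 2
    show ?thesis
      using flat_over_arg_tendsto_0[of j] 2
      by (simp add: DERIV_def flat_def)
  next
    case 3
    have "DERIV (\<lambda>t. (1 / t) ^ j * exp (- (1 / t))) t :>
      - real j * flat (Suc j) t + flat (Suc (Suc j)) t"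
    proof (cases j)
      case 0
      then show ?thesis using 3
        by (auto intro!: derivative_eq_intros simp: flat_def field_simps power2_eq_square)
    next
      case (Suc i)
      have s: "DERIV (\<lambda>t. 1 / t) t :> - (1 / t) * (1 / t)"
        using 3 by (auto intro!: derivative_eq_intros simp: power2_eq_square)
      have "DERIV (\<lambda>t. (1 / t) ^ j * exp (- (1 / t))) t :>
          (1 / t) ^ j * (exp (- (1 / t)) * - (- (1 / t) * (1 / t))) +
          (real j * (1 / t) ^ (j - Suc 0) * (- (1 / t) * (1 / t))) * exp (- (1 / t))"
        by (rule derivative_eq_intros refl s)+ simp
      then show ?thesis
        by (rule DERIV_cong) (use 3 in \<open>simp add: flat_def Suc algebra_simps add_divide_distrib diff_divide_distrib\<close>)
    qed
    then show ?thesis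
      by (rule has_field_derivative_transform_within_open[where S="{0<..}"])
         (use 3 in \<open>auto simp: flat_def\<close>)
  qed
qed

text \<open>
  Differentiation raises \<open>j\<close>, so the induction on the order of differentiability
  treats all \<open>j\<close> together.
\<close>

lemma smooth_flat_comp:
  fixes q :: "'a::euclidean_space \<Rightarrow> real"
  assumes q: "smooth q" shows "smooth (\<lambda>x. flat j (q x))"
proof -
  have "Ck k (\<lambda>x. flat j (q x))" for k
  proof (induction k arbitrary: j)
    case 0
    have "continuous_on UNIV (flat j)"
      by (rule DERIV_continuous_on) (use flat_has_derivative has_field_derivative_at_within in blast)
    then have "continuous_on UNIV (\<lambda>x. flat j (q x))"
      by (rule continuous_on_compose2[OF _ smooth_continuous_on[OF q]]) auto
    then show ?case by simp
  next
    case (Suc k)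
    let ?D = "\<lambda>x h. (- real j * flat (Suc j) (q x) + flat (Suc (Suc j)) (q x)) *
      frechet_derivative q (at x) h"
    show ?case
    proof (rule Ck_SucI[of _ ?D])
      show "((\<lambda>x. flat j (q x)) has_derivative ?D x) (at x)" for x
        using has_derivative_compose[OF smooth_has_derivative[OF q]
            flat_has_derivative[unfolded has_field_derivative_def]] by simp
      show "b \<in> Basis \<Longrightarrow> Ck k (\<lambda>x. ?D x b)" for b
        using smooth_derivative[OF q, of b]
        by (intro Ck_mult Ck_add Ck_const Suc) (auto simp: smooth_def)
    qed
  qed
  then show ?thesis by (simp add: smooth_def)
qed

lemma flat_0: "0 \<le> flat 0 t" "flat 0 t \<le> 1" "flat 0 t > 0 \<longleftrightarrow> t > 0"
  by (auto simp: flat_def)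

text \<open>
  Take \<open>exp (- 1 / q)\<close> with the polynomial \<open>q x = r\<^sup>2 - (norm (x -
  c))\<^sup>2\<close>, which is positive exactly on the ball.
\<close>

lemma bump_exists:
  fixes c :: "'a::euclidean_space"
  shows "\<exists>\<rho>. smooth \<rho> \<and> (\<forall>x. 0 \<le> \<rho> x \<and> \<rho> x \<le> (1::real)) \<and> (\<forall>x. \<rho> x \<noteq> 0 \<longleftrightarrow> x \<in> ball c r)"
proof (cases "r > 0")
  case True
  let ?q = "\<lambda>x. r\<^sup>2 - (\<Sum>b\<in>Basis. (x \<bullet> b - c \<bullet> b)\<^sup>2)"
  have "real_polynomial_function ?q"
    by (intro real_polynomial_function_diff real_polynomial_function_sum real_polynomial_function_power
        real_polynomial_function.intros bounded_linear_inner_left) auto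
  then have "smooth (\<lambda>x. flat 0 (?q x))"
    by (intro smooth_flat_comp smooth_polynomial)
  moreover have "?q x > 0 \<longleftrightarrow> x \<in> ball c r" for x :: 'a
  proof -
    have "(\<Sum>b\<in>Basis. (x \<bullet> b - c \<bullet> b)\<^sup>2) = (norm (x - c))\<^sup>2"
      by (subst power2_norm_eq_inner, subst euclidean_inner) (simp add: inner_diff_left power2_eq_square)
    then show ?thesis
      using True power_strict_mono[of "norm (x - c)" r 2] power2_less_imp_less[of "norm (x - c)" r]
      by (simp add: dist_norm norm_minus_commute) linarith
  qed
  moreover have "flat 0 t \<noteq> 0 \<longleftrightarrow> t > 0" for t
    using flat_0[of t] by linarith
  ultimately show ?thesis
    using flat_0(1,2) by (intro exI[of _ "\<lambda>x. flat 0 (?q x)"] conjI allI) simp_all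
next
  case False
  then have "x \<notin> ball c r" for x by (metis ball_empty empty_iff not_le)
  then show ?thesis
    by (intro exI[of _ "\<lambda>x. 0"]) (simp add: smooth_const)
qed

text \<open>
  Any compact set outside of which \<open>\<phi>\<close> vanishes can replace the closure in the
  definition of a test function; this is easier to exhibit and to use.
\<close>

lemma test_functionsI:
  assumes "smooth \<phi>" "compact C" "C \<subseteq> \<Omega>" "\<And>x. x \<notin> C \<Longrightarrow> \<phi> x = 0"
  shows "\<phi> \<in> test_functions \<Omega>"
proof -
  have "closure {x. \<phi> x \<noteq> 0} \<subseteq> C"
    using assms by (intro closure_minimal) (auto simp: compact_imp_closed)
  moreover from this have "compact (closure {x. \<phi> x \<noteq> 0})"
    using assms(2) compact_Int_closed[OF assms(2) closed_closure] by (metis inf.absorb2)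
  ultimately show ?thesis using assms by (auto simp: test_functions_def)
qed

lemma test_functionsE:
  assumes "\<phi> \<in> test_functions \<Omega>"
  obtains C where "smooth \<phi>" "compact C" "C \<subseteq> \<Omega>" "\<And>x. x \<notin> C \<Longrightarrow> \<phi> x = 0"
  using assms closure_subset[of "{x. \<phi> x \<noteq> 0}"]
  by (intro that[of "closure {x. \<phi> x \<noteq> 0}"]) (auto simp: test_functions_def)

text \<open>
  Bumps on finitely many balls that cover \<open>K\<close> are combined to \<open>1 -
  (\<Prod>x\<in>F. 1 - \<rho> x y)\<close>: the product is a number in \<open>[0, 1]\<close>
  that is less than 1 as soon as one bump is positive.
\<close>

lemma cutoff_exists:
  fixes K :: "'a::euclidean_space set"
  assumes "compact K" "open \<Omega>" "K \<subseteq> \<Omega>"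
  obtains \<eta> where "\<eta> \<in> test_functions \<Omega>" "\<And>x. 0 \<le> \<eta> x \<and> \<eta> x \<le> 1" "\<And>x. x \<in> K \<Longrightarrow> \<eta> x > 0"
proof -
  have "\<exists>r>0. cball x r \<subseteq> \<Omega>" if "x \<in> K" for x
    using that assms open_contains_cball by blast
  then obtain r where r: "\<And>x. x \<in> K \<Longrightarrow> r x > 0 \<and> cball x (r x) \<subseteq> \<Omega>" by metis
  have "K \<subseteq> (\<Union>x\<in>K. ball x (r x))" using r by force
  then obtain F where F: "F \<subseteq> K" "finite F" "K \<subseteq> (\<Union>x\<in>F. ball x (r x))"
    using compactE_image[OF assms(1), of K "\<lambda>x. ball x (r x)"] by auto
  have "\<exists>\<rho>. smooth \<rho> \<and> (\<forall>y. 0 \<le> \<rho> y \<and> \<rho> y \<le> (1::real)) \<and> (\<forall>y. \<rho> y \<noteq> 0 \<longleftrightarrow> y \<in> ball x (r x))" for x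
    by (rule bump_exists)
  then obtain \<rho> where \<rho>: "\<And>x. smooth (\<rho> x)" "\<And>x y. 0 \<le> \<rho> x y \<and> \<rho> x y \<le> (1::real)"
    "\<And>x y. \<rho> x y \<noteq> 0 \<longleftrightarrow> y \<in> ball x (r x)" by metis
  let ?\<eta> = "\<lambda>y. 1 - (\<Prod>x\<in>F. 1 - \<rho> x y)"
  show thesis
  proof
    show "?\<eta> \<in> test_functions \<Omega>"
    proof (rule test_functionsI[of _ "\<Union>x\<in>F. cball x (r x)"])
      show "smooth ?\<eta>" by (intro smooth_diff smooth_const smooth_prod \<rho>)
      show "compact (\<Union>x\<in>F. cball x (r x))" using F by auto
      show "(\<Union>x\<in>F. cball x (r x)) \<subseteq> \<Omega>" using r F by blast
      fix y assume "y \<notin> (\<Union>x\<in>F. cball x (r x))"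
      then have "\<rho> x y = 0" if "x \<in> F" for x using \<rho>(3)[of x y] that by force
      then show "?\<eta> y = 0" by simp
    qed
    show "0 \<le> ?\<eta> y \<and> ?\<eta> y \<le> 1" for y
      using prod_le_1[of F "\<lambda>x. 1 - \<rho> x y"] prod_nonneg[of F "\<lambda>x. 1 - \<rho> x y"] \<rho>(2) by auto
    fix y assume "y \<in> K"
    then obtain x where x: "x \<in> F" "y \<in> ball x (r x)" using F by auto
    have "(\<Prod>x\<in>F. 1 - \<rho> x y) = (1 - \<rho> x y) * (\<Prod>x\<in>F - {x}. 1 - \<rho> x y)"
      using F(2) x(1) by (simp add: prod.remove)
    also have "\<dots> \<le> (1 - \<rho> x y) * 1"
      using \<rho>(2) by (intro mult_left_mono prod_le_1) auto
    also have "\<dots> < 1" using \<rho>(3)[of x y] x(2) \<rho>(2)[of x y] by auto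
    finally show "?\<eta> y > 0" by simp
  qed
qed

section \<open>Testing with smooth functions\<close>

lemma L1_locD: "f \<in> L1_loc \<Omega> \<Longrightarrow> compact K \<Longrightarrow> K \<subseteq> \<Omega> \<Longrightarrow> integrable (lebesgue_on K) f"
  by (auto simp: L1_loc_def)

lemma compact_sets_lebesgue: "compact K \<Longrightarrow> K \<in> sets lebesgue" for K :: "'a::euclidean_space set"
  using compact_imp_closed lmeasurable_compact by blast

lemma continuous_compact_support_bounded:
  fixes \<psi> :: "'a::euclidean_space \<Rightarrow> real"
  assumes "continuous_on UNIV \<psi>" "compact C" "\<And>x. x \<notin> C \<Longrightarrow> \<psi> x = 0"
  obtains B where "B > 0" "\<And>x. \<bar>\<psi> x\<bar> \<le> B"
proof -
  have "bounded (\<psi> ` C)"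
    using assms continuous_on_subset by (blast intro: compact_imp_bounded compact_continuous_image)
  then obtain B where B: "B > 0" "\<And>x. x \<in> C \<Longrightarrow> \<bar>\<psi> x\<bar> \<le> B"
    by (auto simp: bounded_pos)
  then have "\<bar>\<psi> x\<bar> \<le> B" for x using assms(3)[of x] by (cases "x \<in> C") auto
  with B show thesis using that by blast
qed

text \<open>
  A locally integrable function need not be integrable on \<open>\<Omega>\<close>; a continuous
  factor with compact support reduces the integral to one over the support, where all
  manipulations are legitimate.
\<close>

lemma integral_cutoff:
  fixes f :: "'a::euclidean_space \<Rightarrow> 'b::euclidean_space" and \<psi> :: "'a \<Rightarrow> real"
  assumes f: "f \<in> L1_loc \<Omega>" and \<Omega>: "\<Omega> \<in> sets lebesgue" and C: "compact C" "C \<subseteq> \<Omega>"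
    and \<psi>: "continuous_on UNIV \<psi>" "\<And>x. x \<notin> C \<Longrightarrow> \<psi> x = 0"
  shows "integrable (lebesgue_on C) (\<lambda>x. \<psi> x *\<^sub>R f x)"
    and "integrable (lebesgue_on \<Omega>) (\<lambda>x. \<psi> x *\<^sub>R f x)"
    and "(LINT x|lebesgue_on \<Omega>. \<psi> x *\<^sub>R f x) = (LINT x|lebesgue_on C. \<psi> x *\<^sub>R f x)"
proof -
  have Cm: "C \<in> sets lebesgue" using C by (simp add: compact_sets_lebesgue)
  have fC: "integrable (lebesgue_on C) f" using L1_locD[OF f C] .
  obtain B where B: "B > 0" "\<And>x. \<bar>\<psi> x\<bar> \<le> B"
    using continuous_compact_support_bounded[OF \<psi>(1) C(1) \<psi>(2)] by metis
  have "\<psi> \<in> borel_measurable (lebesgue_on C)"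
    using \<psi>(1) Cm by (meson continuous_imp_measurable_on_sets_lebesgue continuous_on_subset subset_UNIV)
  then have "(\<lambda>x. \<psi> x *\<^sub>R f x) \<in> borel_measurable (lebesgue_on C)"
    using fC by (intro borel_measurable_scaleR) auto
  moreover have "integrable (lebesgue_on C) (\<lambda>x. B * norm (f x))" using fC by auto
  moreover have "norm (\<psi> x *\<^sub>R f x) \<le> norm (B * norm (f x))" for x
    using B by (auto intro!: mult_right_mono simp: abs_mult)
  ultimately show 1: "integrable (lebesgue_on C) (\<lambda>x. \<psi> x *\<^sub>R f x)"
    using Bochner_Integration.integrable_bound by blast
  have eq: "indicator \<Omega> x *\<^sub>R \<psi> x *\<^sub>R f x = indicator C x *\<^sub>R \<psi> x *\<^sub>R f x" for x
    using C \<psi>(2)[of x] by (auto simp: indicator_def)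
  have sp: "C \<inter> space lebesgue \<in> sets lebesgue" "\<Omega> \<inter> space lebesgue \<in> sets lebesgue"
    using Cm \<Omega> by auto
  show "integrable (lebesgue_on \<Omega>) (\<lambda>x. \<psi> x *\<^sub>R f x)"
    using 1 unfolding integrable_restrict_space[OF sp(1)] integrable_restrict_space[OF sp(2)] eq .
  show "(LINT x|lebesgue_on \<Omega>. \<psi> x *\<^sub>R f x) = (LINT x|lebesgue_on C. \<psi> x *\<^sub>R f x)"
    unfolding integral_restrict_space[OF sp(1)] integral_restrict_space[OF sp(2)] eq ..
qed

text \<open>
  The optimal test function would be \<open>\<eta> * sgn f\<close>. The measurable function
  \<open>sgn f\<close> is a limit almost everywhere of continuous functions with values in
  \<open>[-1, 1]\<close>, these are approximated uniformly on the support of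
  \<open>\<eta>\<close> by polynomials, and a polynomial times \<open>\<eta>\<close> is a test
  function.
\<close>

lemma integral_abs_cutoff_le:
  fixes f :: "'a::euclidean_space \<Rightarrow> real"
  assumes \<Omega>: "open \<Omega>" and f: "f \<in> L1_loc \<Omega>"
    and \<eta>: "\<eta> \<in> test_functions \<Omega>" "\<And>x. 0 \<le> \<eta> x \<and> \<eta> x \<le> 1"
    and M: "\<And>\<phi>. \<phi> \<in> test_functions \<Omega> \<Longrightarrow> (\<And>x. \<bar>\<phi> x\<bar> \<le> 1) \<Longrightarrow>
      \<bar>LINT x|lebesgue_on \<Omega>. f x * \<phi> x\<bar> \<le> M"
  shows "(LINT x|lebesgue_on \<Omega>. \<eta> x * \<bar>f x\<bar>) \<le> M"
proof -
  have \<Omega>m: "\<Omega> \<in> sets lebesgue" using \<Omega> by auto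
  obtain C where C: "smooth \<eta>" "compact C" "C \<subseteq> \<Omega>" "\<And>x. x \<notin> C \<Longrightarrow> \<eta> x = 0"
    using test_functionsE[OF \<eta>(1)] by metis
  have Cm: "C \<in> sets lebesgue" using C by (simp add: compact_sets_lebesgue)
  have fC: "integrable (lebesgue_on C) f" using L1_locD[OF f C(2,3)] .
  then have fm: "f \<in> borel_measurable (lebesgue_on C)" by auto
  have "(\<lambda>x. sgn (f x)) measurable_on C"
    unfolding measurable_on_iff_borel_measurable[OF Cm]
    using fm by measurable
  then obtain N g where N: "negligible N" and g: "\<And>n. continuous_on UNIV (g n)"
    and gl: "\<And>x. x \<notin> N \<Longrightarrow> (\<lambda>n::nat. g n x) \<longlonglongrightarrow> (if x \<in> C then sgn (f x) else 0)"
    unfolding measurable_on_def by metis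
  \<comment> \<open>Truncation keeps the limit, since the values of \<open>sgn f\<close> lie in \<open>[-1, 1]\<close>.\<close>
  define q where "q n x = max (-1) (min 1 (g n x))" for n x
  have qc: "continuous_on UNIV (q n)" for n
    unfolding q_def by (intro continuous_intros g)
  have ql: "(\<lambda>n. q n x) \<longlonglongrightarrow> sgn (f x)" if "x \<notin> N" "x \<in> C" for x
  proof -
    have "(\<lambda>n. q n x) \<longlonglongrightarrow> max (-1) (min 1 (sgn (f x)))"
      unfolding q_def using gl[OF that(1)] that(2) by (intro tendsto_intros) auto
    then show ?thesis by (auto simp: sgn_if split: if_splits)
  qed
  have "\<exists>p. real_polynomial_function p \<and> (\<forall>x\<in>C. \<bar>q n x - p x\<bar> < 1 / real (Suc n))" for n
    using Stone_Weierstrass_real_polynomial_function[OF C(2) continuous_on_subset[OF qc]]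
    by (metis of_nat_0_less_iff subset_UNIV zero_less_Suc zero_less_divide_1_iff)
  then obtain p where p: "\<And>n. real_polynomial_function (p n)"
    "\<And>n x. x \<in> C \<Longrightarrow> \<bar>q n x - p n x\<bar> < 1 / real (Suc n)" by metis
  \<comment> \<open>The polynomials may exceed 1 by the approximation error; the last factor compensates.\<close>
  define \<phi> where "\<phi> n x = \<eta> x * p n x * (1 / (1 + 1 / real (Suc n)))" for n x
  have sm: "smooth (\<phi> n)" for n
    unfolding \<phi>_def by (intro smooth_mult smooth_const C smooth_polynomial p)
  have \<phi>0: "\<phi> n x = 0" if "x \<notin> C" for n x using C(4)[OF that] by (simp add: \<phi>_def)
  have \<phi>1: "\<bar>\<phi> n x\<bar> \<le> 1" for n x
  proof (cases "x \<in> C")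
    case True
    have "\<bar>p n x\<bar> \<le> 1 + 1 / real (Suc n)"
      using p(2)[OF True, of n] unfolding q_def by linarith
    then have "\<bar>\<eta> x\<bar> * \<bar>p n x\<bar> \<le> 1 * (1 + 1 / real (Suc n))"
      using \<eta>(2)[of x] by (intro mult_mono) auto
    moreover have "0 < 1 + 1 / real (Suc n)" by (simp add: add_pos_pos)
    ultimately show ?thesis
      unfolding \<phi>_def by (simp add: abs_mult pos_divide_le_eq)
  qed (simp add: \<phi>0)
  have \<phi>l: "(\<lambda>n. \<phi> n x) \<longlonglongrightarrow> \<eta> x * sgn (f x)" if "x \<notin> N" "x \<in> C" for x
  proof -
    have z: "(\<lambda>n. 1 / real (Suc n)) \<longlonglongrightarrow> 0" using LIMSEQ_inverse_real_of_nat by (simp add: inverse_eq_divide)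
    have "(\<lambda>n. q n x - p n x) \<longlonglongrightarrow> 0"
      by (rule Lim_null_comparison[OF _ z]) (use p(2)[OF that(2)] in \<open>auto intro!: always_eventually less_imp_le simp: \<close>)
    then have "(\<lambda>n. q n x - (q n x - p n x)) \<longlonglongrightarrow> sgn (f x) - 0"
      by (intro tendsto_diff ql that)
    then have "(\<lambda>n. p n x) \<longlonglongrightarrow> sgn (f x)" by simp
    then have "(\<lambda>n. \<phi> n x) \<longlonglongrightarrow> \<eta> x * sgn (f x) * (1 / (1 + 0))"
      unfolding \<phi>_def by (intro tendsto_intros z) auto
    then show ?thesis by simp
  qed
  have le: "(LINT x|lebesgue_on C. \<phi> n x * f x) \<le> M" for n
  proof -
    have "\<phi> n \<in> test_functions \<Omega>"
      by (rule test_functionsI[OF sm C(2,3)]) (simp add: \<phi>0)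
    then have "\<bar>LINT x|lebesgue_on \<Omega>. f x * \<phi> n x\<bar> \<le> M" by (rule M) (rule \<phi>1)
    then show ?thesis
      using integral_cutoff(3)[OF f \<Omega>m C(2,3) smooth_continuous_on[OF sm] \<phi>0, of n]
      by (simp add: mult.commute)
  qed
  have "(\<lambda>n. LINT x|lebesgue_on C. \<phi> n x * f x) \<longlonglongrightarrow> (LINT x|lebesgue_on C. \<eta> x * sgn (f x) * f x)"
  proof (rule integral_dominated_convergence[where w="\<lambda>x. \<bar>f x\<bar>"])
    have 1: "continuous_on C \<eta>" "\<And>n. continuous_on C (\<phi> n)"
      by (rule smooth_continuous_on C sm)+
    have [measurable]: "\<eta> \<in> borel_measurable (lebesgue_on C)" "\<And>n. \<phi> n \<in> borel_measurable (lebesgue_on C)"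
      using 1 Cm by (auto intro: continuous_imp_measurable_on_sets_lebesgue)
    note fm[measurable]
    show "(\<lambda>x. \<eta> x * sgn (f x) * f x) \<in> borel_measurable (lebesgue_on C)"
      "\<And>n. (\<lambda>x. \<phi> n x * f x) \<in> borel_measurable (lebesgue_on C)" by measurable
    show "integrable (lebesgue_on C) (\<lambda>x. \<bar>f x\<bar>)" using fC by auto
    show "AE x in lebesgue_on C. norm (\<phi> n x * f x) \<le> \<bar>f x\<bar>" for n
      using mult_right_mono[OF \<phi>1 abs_ge_zero] by (intro AE_I2) (simp add: abs_mult)
    have "AE x in lebesgue. x \<notin> N"
      using N by (metis AE_not_in negligible_iff_null_sets)
    then have "AE x in lebesgue_on C. x \<notin> N"
      using Cm by (auto simp: AE_restrict_space_iff elim: eventually_mono)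
    then show "AE x in lebesgue_on C. (\<lambda>n. \<phi> n x * f x) \<longlonglongrightarrow> \<eta> x * sgn (f x) * f x"
      using AE_space by eventually_elim (auto intro!: tendsto_mult \<phi>l)
  qed
  then have "(LINT x|lebesgue_on C. \<eta> x * sgn (f x) * f x) \<le> M"
    by (rule LIMSEQ_le_const2) (use le in auto)
  moreover have "\<eta> x * sgn (f x) * f x = \<eta> x * \<bar>f x\<bar>" for x
    by (simp add: abs_sgn mult.commute mult.left_commute)
  moreover have "(\<lambda>x. \<bar>f x\<bar>) \<in> L1_loc \<Omega>" using f by (auto simp: L1_loc_def)
  from integral_cutoff(3)[OF this \<Omega>m C(2,3) smooth_continuous_on[OF C(1)] C(4)]
  have "(LINT x|lebesgue_on \<Omega>. \<eta> x * \<bar>f x\<bar>) = (LINT x|lebesgue_on C. \<eta> x * \<bar>f x\<bar>)"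
    by simp
  ultimately show ?thesis by simp
qed

text \<open>
  The functions \<open>1 - (1 - \<eta>) ^ j\<close> are again cutoffs, and they increase to 1
  wherever \<open>\<eta> > 0\<close>, in particular on \<open>K\<close>. This removes the weight
  of the preceding lemma.
\<close>

lemma integral_abs_compact_le:
  fixes f :: "'a::euclidean_space \<Rightarrow> real"
  assumes \<Omega>: "open \<Omega>" and f: "f \<in> L1_loc \<Omega>" and K: "compact K" "K \<subseteq> \<Omega>"
    and M: "\<And>\<phi>. \<phi> \<in> test_functions \<Omega> \<Longrightarrow> (\<And>x. \<bar>\<phi> x\<bar> \<le> 1) \<Longrightarrow>
      \<bar>LINT x|lebesgue_on \<Omega>. f x * \<phi> x\<bar> \<le> M"
  shows "(LINT x|lebesgue_on K. \<bar>f x\<bar>) \<le> M"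
proof -
  have \<Omega>m: "\<Omega> \<in> sets lebesgue" and Km: "K \<in> sets lebesgue"
    using \<Omega> K by (auto simp: compact_sets_lebesgue)
  obtain \<eta> where \<eta>: "\<eta> \<in> test_functions \<Omega>" "\<And>x. 0 \<le> \<eta> x \<and> \<eta> x \<le> 1" "\<And>x. x \<in> K \<Longrightarrow> \<eta> x > 0"
    using cutoff_exists[OF K(1) \<Omega> K(2)] by metis
  obtain C where C: "smooth \<eta>" "compact C" "C \<subseteq> \<Omega>" "\<And>x. x \<notin> C \<Longrightarrow> \<eta> x = 0"
    using test_functionsE[OF \<eta>(1)] by metis
  have af: "(\<lambda>x. \<bar>f x\<bar>) \<in> L1_loc \<Omega>" using f by (auto simp: L1_loc_def)
  have fK: "integrable (lebesgue_on K) f" using L1_locD[OF f K] .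
  define \<theta> where "\<theta> j x = 1 - (1 - \<eta> x) ^ j" for j x
  have sm: "smooth (\<theta> j)" for j unfolding \<theta>_def by (intro smooth_diff smooth_const smooth_power C)
  have t01: "0 \<le> \<theta> j x \<and> \<theta> j x \<le> 1" for j x
    using \<eta>(2)[of x] power_le_one[of "1 - \<eta> x" j] by (auto simp: \<theta>_def)
  have t0: "\<theta> j x = 0" if "x \<notin> C" for j x using C(4)[OF that] by (simp add: \<theta>_def)
  have le: "(LINT x|lebesgue_on K. \<theta> j x * \<bar>f x\<bar>) \<le> M" for j
  proof -
    have t: "\<theta> j \<in> test_functions \<Omega>" by (rule test_functionsI[OF sm C(2,3)]) (simp add: t0)
    have i: "integrable (lebesgue_on \<Omega>) (\<lambda>x. \<theta> j x * \<bar>f x\<bar>)"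
      using integral_cutoff(2)[OF af \<Omega>m C(2,3) smooth_continuous_on[OF sm] t0] by simp
    then have i2: "integrable lebesgue (\<lambda>x. indicator \<Omega> x *\<^sub>R (\<theta> j x * \<bar>f x\<bar>))"
      using \<Omega>m by (simp add: integrable_restrict_space)
    have "(LINT x|lebesgue_on K. \<theta> j x * \<bar>f x\<bar>) \<le> (LINT x|lebesgue_on \<Omega>. \<theta> j x * \<bar>f x\<bar>)"
      using \<Omega>m Km K(2) i2 t01 by (simp add: integral_restrict_space, intro integral_mono')
        (auto simp: indicator_def)
    also have "\<dots> \<le> M"
      by (rule integral_abs_cutoff_le[OF \<Omega> f t t01]) (rule M)
    finally show ?thesis .
  qed
  have "(\<lambda>j. LINT x|lebesgue_on K. \<theta> j x * \<bar>f x\<bar>) \<longlonglongrightarrow> (LINT x|lebesgue_on K. 1 * \<bar>f x\<bar>)"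
  proof (rule integral_dominated_convergence[where w="\<lambda>x. \<bar>f x\<bar>"])
    have [measurable]: "f \<in> borel_measurable (lebesgue_on K)" using fK by auto
    have [measurable]: "\<theta> j \<in> borel_measurable (lebesgue_on K)" for j
      using smooth_continuous_on[OF sm] Km by (auto intro: continuous_imp_measurable_on_sets_lebesgue)
    show "(\<lambda>x. 1 * \<bar>f x\<bar>) \<in> borel_measurable (lebesgue_on K)"
      "\<And>n. (\<lambda>x. \<theta> n x * \<bar>f x\<bar>) \<in> borel_measurable (lebesgue_on K)" by measurable
    show "integrable (lebesgue_on K) (\<lambda>x. \<bar>f x\<bar>)" using fK by auto
    show "AE x in lebesgue_on K. norm (\<theta> n x * \<bar>f x\<bar>) \<le> \<bar>f x\<bar>" for n
      using t01 by (intro AE_I2) (auto simp: abs_mult mult_left_le_one_le)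
    have "(\<lambda>n. \<theta> n x) \<longlonglongrightarrow> 1 - 0" if "x \<in> K" for x
      unfolding \<theta>_def using \<eta>(2)[of x] \<eta>(3)[OF that]
      by (intro tendsto_intros LIMSEQ_power_zero) auto
    then show "AE x in lebesgue_on K. (\<lambda>n. \<theta> n x * \<bar>f x\<bar>) \<longlonglongrightarrow> 1 * \<bar>f x\<bar>"
      by (intro AE_I2 tendsto_mult tendsto_const) simp
  qed
  then have "(\<lambda>j. LINT x|lebesgue_on K. \<theta> j x * \<bar>f x\<bar>) \<longlonglongrightarrow> (LINT x|lebesgue_on K. \<bar>f x\<bar>)" by simp
  then show ?thesis by (rule LIMSEQ_le_const2) (use le in auto)
qed

text \<open>
  The fundamental lemma of the calculus of variations: duality with bound 0 on the sets of a
  compact exhaustion.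
\<close>

lemma AE_zero_if_test_zero:
  fixes f :: "'a::euclidean_space \<Rightarrow> real"
  assumes \<Omega>: "open \<Omega>" and f: "f \<in> L1_loc \<Omega>"
    and 0: "\<And>\<phi>. \<phi> \<in> test_functions \<Omega> \<Longrightarrow> (LINT x|lebesgue_on \<Omega>. f x * \<phi> x) = 0"
  shows "AE x in lebesgue_on \<Omega>. f x = 0"
proof -
  obtain D where D: "\<And>n::nat. compact (D n)" "\<And>n. D n \<subseteq> \<Omega>" "\<Union>(range D) = \<Omega>"
    using open_Union_compact_subsets[OF \<Omega>] by metis
  have "AE x in lebesgue. x \<in> D n \<longrightarrow> f x = 0" for n
  proof -
    have "(LINT x|lebesgue_on (D n). \<bar>f x\<bar>) \<le> 0"
      by (rule integral_abs_compact_le[OF \<Omega> f D(1,2)]) (simp add: 0)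
    then have "(LINT x|lebesgue_on (D n). \<bar>f x\<bar>) = 0"
      by (intro antisym) simp_all
    moreover have "integrable (lebesgue_on (D n)) (\<lambda>x. \<bar>f x\<bar>)"
      using L1_locD[OF f D(1,2)] by auto
    ultimately have "AE x in lebesgue_on (D n). \<bar>f x\<bar> = 0"
      by (simp add: integral_nonneg_eq_0_iff_AE)
    then show ?thesis
      using compact_sets_lebesgue[OF D(1)] by (simp add: AE_restrict_space_iff)
  qed
  then have "AE x in lebesgue. \<forall>n. x \<in> D n \<longrightarrow> f x = 0"
    by (subst AE_all_countable) blast
  then have "AE x in lebesgue. x \<in> \<Omega> \<longrightarrow> f x = 0"
    by eventually_elim (use D(3) in auto)
  then show ?thesis using \<Omega> by (simp add: AE_restrict_space_iff)
qed

text \<open>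
  The constant \<open>weak_gradient\<close> is an arbitrary choice; by this lemma the choice
  does not influence integrals.
\<close>

lemma weak_gradient_unique:
  fixes g h :: "'a::euclidean_space \<Rightarrow> 'a"
  assumes \<Omega>: "open \<Omega>" and g: "has_weak_gradient \<Omega> f g" and h: "has_weak_gradient \<Omega> f h"
  shows "AE x in lebesgue_on \<Omega>. g x = h x"
proof -
  have \<Omega>m: "\<Omega> \<in> sets lebesgue" using \<Omega> by auto
  have gl: "g \<in> L1_loc \<Omega>" and hl: "h \<in> L1_loc \<Omega>" using g h by (auto simp: has_weak_gradient_def)
  have "AE x in lebesgue_on \<Omega>. g x \<bullet> b - h x \<bullet> b = 0" if b: "b \<in> Basis" for b
  proof (rule AE_zero_if_test_zero[OF \<Omega>])
    have gb: "(\<lambda>x. g x \<bullet> b) \<in> L1_loc \<Omega>" and hb: "(\<lambda>x. h x \<bullet> b) \<in> L1_loc \<Omega>"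
      using gl hl by (auto simp: L1_loc_def)
    then show "(\<lambda>x. g x \<bullet> b - h x \<bullet> b) \<in> L1_loc \<Omega>" by (auto simp: L1_loc_def)
    fix \<phi> assume \<phi>: "\<phi> \<in> test_functions \<Omega>"
    obtain C where C: "smooth \<phi>" "compact C" "C \<subseteq> \<Omega>" "\<And>x. x \<notin> C \<Longrightarrow> \<phi> x = 0"
      using test_functionsE[OF \<phi>] by metis
    have "(LINT x|lebesgue_on \<Omega>. (g x \<bullet> b) * \<phi> x) = (LINT x|lebesgue_on \<Omega>. (h x \<bullet> b) * \<phi> x)"
      using g h \<phi> b by (auto simp: has_weak_gradient_def)
    then show "(LINT x|lebesgue_on \<Omega>. (g x \<bullet> b - h x \<bullet> b) * \<phi> x) = 0"
      using integral_cutoff(2)[OF gb \<Omega>m C(2,3) smooth_continuous_on[OF C(1)] C(4)]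
        integral_cutoff(2)[OF hb \<Omega>m C(2,3) smooth_continuous_on[OF C(1)] C(4)]
      by (simp add: right_diff_distrib mult.commute[of _ "\<phi> _"])
  qed
  then have "AE x in lebesgue_on \<Omega>. \<forall>b\<in>Basis. g x \<bullet> b - h x \<bullet> b = 0"
    by (intro AE_finite_allI) auto
  then show ?thesis
    by eventually_elim (auto intro: euclidean_eqI)
qed

section \<open>Translates of functions with a weak gradient\<close>

lemma integral_lborel_translate:
  fixes f :: "'a::euclidean_space \<Rightarrow> real"
  assumes "f \<in> borel_measurable borel"
  shows "(LINT x|lborel. f (x + h)) = (LINT x|lborel. f x)"
proof -
  have "(LINT x|lborel. f x) = (LINT x|distr lborel borel ((+) h). f x)"
    by (simp add: lborel_distr_plus)
  also have "\<dots> = (LINT x|lborel. f (h + x))"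
    using assms by (subst integral_distr) auto
  finally show ?thesis by (simp add: add.commute)
qed

lemma lborel_integrable_translate:
  fixes f :: "'a::euclidean_space \<Rightarrow> real"
  assumes "integrable lborel f"
  shows "integrable lborel (\<lambda>x. f (x + h))"
proof -
  have "integrable (distr lborel borel ((+) h)) f" using assms by (simp add: lborel_distr_plus)
  then have "integrable lborel (\<lambda>x. f (h + x))"
    using assms by (subst (asm) integrable_distr_eq) auto
  then show ?thesis by (simp add: add.commute)
qed

lemma integral_lebesgue_on_eq_lborel:
  fixes f :: "'a::euclidean_space \<Rightarrow> real"
  assumes "f \<in> borel_measurable borel" "\<Omega> \<in> sets lebesgue" "\<And>x. x \<notin> \<Omega> \<Longrightarrow> f x = 0"
  shows "(LINT x|lebesgue_on \<Omega>. f x) = (LINT x|lborel. f x)"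
proof -
  have eq: "indicator \<Omega> x *\<^sub>R f x = f x" for x using assms(3)[of x] by (auto simp: indicator_def)
  have sp: "\<Omega> \<inter> space lebesgue \<in> sets lebesgue" using assms(2) by auto
  have "(LINT x|lebesgue_on \<Omega>. f x) = (LINT x|lebesgue. f x)"
    unfolding integral_restrict_space[OF sp] eq ..
  also have "\<dots> = (LINT x|lborel. f x)"
    using assms(1) by (intro integral_completion) auto
  finally show ?thesis .
qed

lemma frechet_derivative_0_off_support:
  fixes \<phi> :: "'a::euclidean_space \<Rightarrow> real"
  assumes "compact C" "\<And>x. x \<notin> C \<Longrightarrow> \<phi> x = 0" "x \<notin> C"
  shows "frechet_derivative \<phi> (at x) = (\<lambda>h. 0)"
proof (rule frechet_derivative_eqI)
  have "((\<lambda>x. 0::real) has_derivative (\<lambda>h. 0)) (at x)" by simp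
  then show "(\<phi> has_derivative (\<lambda>h. 0)) (at x)"
    by (rule has_derivative_transform_within_open[where s="- C"])
       (use assms compact_imp_closed in auto)
qed

lemma frechet_derivative_expand:
  fixes \<phi> :: "'a::euclidean_space \<Rightarrow> real"
  assumes "smooth \<phi>"
  shows "frechet_derivative \<phi> (at x) h = (\<Sum>b\<in>Basis. (h \<bullet> b) * frechet_derivative \<phi> (at x) b)"
proof -
  have "linear (frechet_derivative \<phi> (at x))"
    using smooth_has_derivative[OF assms] has_derivative_linear by blast
  then have "frechet_derivative \<phi> (at x) (\<Sum>b\<in>Basis. (h \<bullet> b) *\<^sub>R b) =
      (\<Sum>b\<in>Basis. (h \<bullet> b) * frechet_derivative \<phi> (at x) b)"
    by (simp add: linear_sum linear_cmul)
  then show ?thesis by (simp add: euclidean_representation)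
qed

lemma smooth_directional_derivative:
  fixes \<phi> :: "'a::euclidean_space \<Rightarrow> real"
  assumes "smooth \<phi>" "compact C" "\<And>x. x \<notin> C \<Longrightarrow> \<phi> x = 0"
  obtains L where "continuous_on UNIV (\<lambda>x. frechet_derivative \<phi> (at x) h)"
    "\<And>x. \<bar>frechet_derivative \<phi> (at x) h\<bar> \<le> L"
proof -
  have c: "continuous_on UNIV (\<lambda>x. frechet_derivative \<phi> (at x) h)"
    unfolding frechet_derivative_expand[OF assms(1), of _ h]
    by (intro continuous_intros smooth_continuous_on smooth_derivative assms)
  show thesis
    by (rule continuous_compact_support_bounded[OF c assms(2)])
       (use frechet_derivative_0_off_support[OF assms(2,3)] c that in auto)
qed

text \<open>
  Differentiation under the integral sign: the difference quotients of \<open>\<phi>\<close> are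
  bounded by a Lipschitz constant \<open>L\<close>, so that \<open>L * \<bar>U\<bar>\<close> is
  a dominating function.
\<close>

lemma translated_pairing_has_derivative:
  fixes \<phi> U :: "'a::euclidean_space \<Rightarrow> real"
  assumes \<phi>: "smooth \<phi>" "compact C" "\<And>x. x \<notin> C \<Longrightarrow> \<phi> x = 0"
    and U: "integrable lborel U"
  shows "DERIV (\<lambda>t. LINT x|lborel. U x * \<phi> (x - t *\<^sub>R h)) t :>
    - (LINT x|lborel. U x * frechet_derivative \<phi> (at (x - t *\<^sub>R h)) h)"
proof -
  let ?D = "\<lambda>y. frechet_derivative \<phi> (at y) h"
  obtain L where L: "continuous_on UNIV ?D" "\<And>x. \<bar>?D x\<bar> \<le> L"
    using smooth_directional_derivative[OF \<phi>] by metis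
  obtain B where B: "\<And>x. \<bar>\<phi> x\<bar> \<le> B"
    using continuous_compact_support_bounded[OF smooth_continuous_on[OF \<phi>(1)] \<phi>(2,3)] by metis
  have [measurable]: "\<phi> \<in> borel_measurable borel" "?D \<in> borel_measurable borel"
    using smooth_continuous_on[OF \<phi>(1)] L(1) by (auto intro: borel_measurable_continuous_onI)
  have [measurable]: "U \<in> borel_measurable borel" using U by auto
  have d: "DERIV (\<lambda>s. \<phi> (x - s *\<^sub>R h)) s :> - ?D (x - s *\<^sub>R h)" for x s
  proof -
    have 1: "((\<lambda>s. x - s *\<^sub>R h) has_derivative (\<lambda>s. - (s *\<^sub>R h))) (at s)"
      by (auto intro!: derivative_eq_intros)
    have "linear (frechet_derivative \<phi> (at (x - s *\<^sub>R h)))"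
      using smooth_has_derivative[OF \<phi>(1)] has_derivative_linear by blast
    then have "(\<lambda>r. frechet_derivative \<phi> (at (x - s *\<^sub>R h)) (- (r *\<^sub>R h))) = (*) (- ?D (x - s *\<^sub>R h))"
      by (auto simp: linear_neg linear_cmul)
    then show ?thesis
      using has_derivative_compose[OF 1 smooth_has_derivative[OF \<phi>(1)]]
      by (simp add: has_field_derivative_def)
  qed
  have lip: "\<bar>\<phi> (x - (t + s) *\<^sub>R h) - \<phi> (x - t *\<^sub>R h)\<bar> \<le> L * \<bar>s\<bar>" for x s
    using field_differentiable_bound[of UNIV "\<lambda>s. \<phi> (x - s *\<^sub>R h)" "\<lambda>s. - ?D (x - s *\<^sub>R h)" L "t + s" t]
      d L(2) by auto
  have iU: "integrable lborel (\<lambda>x. U x * \<phi> (x - s *\<^sub>R h))" for s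
  proof (rule Bochner_Integration.integrable_bound)
    show "integrable lborel (\<lambda>x. B * U x)" using U by auto
    show "AE x in lborel. norm (U x * \<phi> (x - s *\<^sub>R h)) \<le> norm (B * U x)"
    proof (intro AE_I2)
      fix x
      have "\<bar>\<phi> (x - s *\<^sub>R h)\<bar> * \<bar>U x\<bar> \<le> \<bar>B\<bar> * \<bar>U x\<bar>"
        by (intro mult_right_mono order_trans[OF B abs_ge_self]) auto
      then show "norm (U x * \<phi> (x - s *\<^sub>R h)) \<le> norm (B * U x)"
        by (simp add: abs_mult mult.commute)
    qed
  qed measurable
  show ?thesis
    unfolding DERIV_def tendsto_at_iff_sequentially comp_def
  proof (intro allI impI)
    fix X :: "nat \<Rightarrow> real" assume X: "\<forall>i. X i \<in> UNIV - {0}" "X \<longlonglongrightarrow> 0"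
    have l: "(\<lambda>i. LINT x|lborel. U x * ((\<phi> (x - (t + X i) *\<^sub>R h) - \<phi> (x - t *\<^sub>R h)) / X i)) \<longlonglongrightarrow>
        (LINT x|lborel. U x * - ?D (x - t *\<^sub>R h))"
    proof (rule integral_dominated_convergence[where w="\<lambda>x. L * \<bar>U x\<bar>"])
      show "integrable lborel (\<lambda>x. L * \<bar>U x\<bar>)" using U by auto
      show "AE x in lborel. norm (U x * ((\<phi> (x - (t + X i) *\<^sub>R h) - \<phi> (x - t *\<^sub>R h)) / X i)) \<le> L * \<bar>U x\<bar>" for i
      proof (intro AE_I2)
        fix x
        have "\<bar>(\<phi> (x - (t + X i) *\<^sub>R h) - \<phi> (x - t *\<^sub>R h)) / X i\<bar> \<le> L"
          using lip[of x "X i"] X(1) by (simp add: abs_divide pos_divide_le_eq)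
        from mult_left_mono[OF this, of "\<bar>U x\<bar>"] show "norm (U x * ((\<phi> (x - (t + X i) *\<^sub>R h) - \<phi> (x - t *\<^sub>R h)) / X i)) \<le> L * \<bar>U x\<bar>"
          by (simp add: abs_mult mult.commute)
      qed
      show "AE x in lborel. (\<lambda>i. U x * ((\<phi> (x - (t + X i) *\<^sub>R h) - \<phi> (x - t *\<^sub>R h)) / X i)) \<longlonglongrightarrow>
          U x * - ?D (x - t *\<^sub>R h)"
      proof (intro AE_I2 tendsto_mult tendsto_const)
        fix x
        show "(\<lambda>i. (\<phi> (x - (t + X i) *\<^sub>R h) - \<phi> (x - t *\<^sub>R h)) / X i) \<longlonglongrightarrow> - ?D (x - t *\<^sub>R h)"
          using d[of x t] X unfolding DERIV_def tendsto_at_iff_sequentially comp_def by blast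
      qed
    qed measurable
    have q: "(LINT x|lborel. U x * ((\<phi> (x - (t + X i) *\<^sub>R h) - \<phi> (x - t *\<^sub>R h)) / X i)) =
        ((LINT x|lborel. U x * \<phi> (x - (t + X i) *\<^sub>R h)) - (LINT x|lborel. U x * \<phi> (x - t *\<^sub>R h))) / X i" for i
      using iU by (subst Bochner_Integration.integral_diff[symmetric]) 
        (auto simp: right_diff_distrib simp flip: integral_divide)
    from l show "(\<lambda>i. ((LINT x|lborel. U x * \<phi> (x - (t + X i) *\<^sub>R h)) -
        (LINT x|lborel. U x * \<phi> (x - t *\<^sub>R h))) / X i)
      \<longlonglongrightarrow> - (LINT x|lborel. U x * ?D (x - t *\<^sub>R h))" unfolding q by simp
  qed
qed

text \<open>
  After a change of variables the left-hand side is \<open>\<psi> 1 - \<psi> 0\<close> for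
  \<open>\<psi> t = (LINT x|lborel. U x * \<phi> (x - t *\<^sub>R h))\<close>. The translates of
  \<open>\<phi>\<close> that occur are test functions on \<open>\<Omega>\<close>, so the
  derivative of \<open>\<psi>\<close> can be expressed by the weak gradient, and the mean value
  theorem applies.
\<close>

lemma translate_pairing_le:
  fixes U :: "'a::euclidean_space \<Rightarrow> real" and g :: "'a \<Rightarrow> 'a"
  assumes \<Omega>: "open \<Omega>" and U: "integrable lborel U" "\<And>x. x \<notin> \<Omega> \<Longrightarrow> U x = 0"
    and g: "has_weak_gradient \<Omega> U g" "integrable (lebesgue_on \<Omega>) g"
    and \<phi>: "\<phi> \<in> test_functions V" "\<And>x. \<bar>\<phi> x\<bar> \<le> 1"
    and V: "\<And>x t. x \<in> V \<Longrightarrow> 0 \<le> t \<Longrightarrow> t \<le> 1 \<Longrightarrow> x + t *\<^sub>R h \<in> \<Omega>"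
  shows "\<bar>LINT x|lborel. (U (x + h) - U x) * \<phi> x\<bar> \<le> norm h * (LINT x|lebesgue_on \<Omega>. norm (g x))"
proof -
  have \<Omega>m: "\<Omega> \<in> sets lebesgue" using \<Omega> by auto
  let ?M = "LINT x|lebesgue_on \<Omega>. norm (g x)"
  obtain C where C: "smooth \<phi>" "compact C" "C \<subseteq> V" "\<And>x. x \<notin> C \<Longrightarrow> \<phi> x = 0"
    using test_functionsE[OF \<phi>(1)] by metis
  let ?\<psi> = "\<lambda>t. LINT x|lborel. U x * \<phi> (x - t *\<^sub>R h)"
  let ?d = "\<lambda>t. - (LINT x|lborel. U x * frechet_derivative \<phi> (at (x - t *\<^sub>R h)) h)"
  have [measurable]: "\<phi> \<in> borel_measurable borel"
    using smooth_continuous_on[OF C(1)] by (auto intro: borel_measurable_continuous_onI)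
  have Um[measurable]: "U \<in> borel_measurable borel" using U by auto
  have bound: "\<bar>?d t\<bar> \<le> norm h * ?M" if t: "0 \<le> t" "t \<le> 1" for t
  proof -
    let ?p = "\<lambda>x. \<phi> (x - t *\<^sub>R h)"
    define C' where "C' = (\<lambda>x. x + t *\<^sub>R h) ` C"
    have C': "compact C'" "C' \<subseteq> \<Omega>" "\<And>x. x \<notin> C' \<Longrightarrow> ?p x = 0"
    proof -
      show "compact C'" unfolding C'_def by (intro compact_continuous_image continuous_intros C)
      show "C' \<subseteq> \<Omega>" using C(3) V t by (auto simp: C'_def)
      show "?p x = 0" if "x \<notin> C'" for x
      proof -
        have "x - t *\<^sub>R h \<notin> C" using that by (force simp: C'_def image_iff)
        then show ?thesis by (rule C(4))
      qed
    qed
    have sp: "smooth ?p" by (rule smooth_translate[OF C(1)])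
    have p: "?p \<in> test_functions \<Omega>" by (rule test_functionsI[OF sp C'(1,2)]) (rule C'(3))
    have dp: "frechet_derivative ?p (at x) = frechet_derivative \<phi> (at (x - t *\<^sub>R h))" for x
    proof -
      have 1: "((\<lambda>x. x - t *\<^sub>R h) has_derivative (\<lambda>v. v)) (at x)"
        by (auto intro!: derivative_eq_intros)
      show ?thesis
        by (rule frechet_derivative_eqI, rule has_derivative_compose[OF 1 smooth_has_derivative[OF C(1)]])
    qed
    have gl: "g \<in> L1_loc \<Omega>" and Ul: "U \<in> L1_loc \<Omega>" using g(1) by (auto simp: has_weak_gradient_def)
    have pb: "(LINT x|lborel. U x * frechet_derivative ?p (at x) b) = - (LINT x|lebesgue_on \<Omega>. (g x \<bullet> b) * ?p x)"
      if b: "b \<in> Basis" for b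
    proof -
      have [measurable]: "(\<lambda>x. frechet_derivative ?p (at x) b) \<in> borel_measurable borel"
        using smooth_continuous_on[OF smooth_derivative[OF sp b]] by (auto intro: borel_measurable_continuous_onI)
      have "(LINT x|lborel. U x * frechet_derivative ?p (at x) b) =
          (LINT x|lebesgue_on \<Omega>. U x * frechet_derivative ?p (at x) b)"
        by (rule integral_lebesgue_on_eq_lborel[symmetric]) (use U(2) \<Omega>m in auto)
      also have "\<dots> = - (LINT x|lebesgue_on \<Omega>. (g x \<bullet> b) * ?p x)"
        using g(1) p b by (auto simp: has_weak_gradient_def)
      finally show ?thesis .
    qed
    have iD: "integrable lborel (\<lambda>x. U x * frechet_derivative ?p (at x) b)" if b: "b \<in> Basis" for b
    proof -
      obtain L where L: "continuous_on UNIV (\<lambda>x. frechet_derivative ?p (at x) b)"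
        "\<And>x. \<bar>frechet_derivative ?p (at x) b\<bar> \<le> L"
        using smooth_directional_derivative[OF sp C'(1,3)] by metis
      have [measurable]: "(\<lambda>x. frechet_derivative ?p (at x) b) \<in> borel_measurable borel"
        using L(1) by (auto intro: borel_measurable_continuous_onI)
      show ?thesis
      proof (rule Bochner_Integration.integrable_bound)
        show "integrable lborel (\<lambda>x. L * U x)" using U by auto
        show "AE x in lborel. norm (U x * frechet_derivative ?p (at x) b) \<le> norm (L * U x)"
        proof (intro AE_I2)
          fix x
          have "\<bar>frechet_derivative ?p (at x) b\<bar> * \<bar>U x\<bar> \<le> \<bar>L\<bar> * \<bar>U x\<bar>"
            by (intro mult_right_mono order_trans[OF L(2) abs_ge_self]) auto
          then show "norm (U x * frechet_derivative ?p (at x) b) \<le> norm (L * U x)"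
            by (simp add: abs_mult mult.commute)
        qed
      qed measurable
    qed
    have gp: "integrable (lebesgue_on \<Omega>) (\<lambda>x. ?p x *\<^sub>R g x)"
      using integral_cutoff(2)[OF gl \<Omega>m C'(1,2) smooth_continuous_on[OF sp] C'(3)] .
    have gpb: "integrable (lebesgue_on \<Omega>) (\<lambda>x. (g x \<bullet> b) * ?p x)" for b
      using integrable_inner_left[OF gp, of b] by (simp add: mult.commute)
    have "?d t = - (LINT x|lborel. (\<Sum>b\<in>Basis. (h \<bullet> b) * (U x * frechet_derivative ?p (at x) b)))"
      unfolding dp[symmetric] frechet_derivative_expand[OF sp, of _ h]
      by (simp add: sum_distrib_left mult_ac)
    also have "\<dots> = - (\<Sum>b\<in>Basis. (h \<bullet> b) * (LINT x|lborel. U x * frechet_derivative ?p (at x) b))"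
      using iD by (subst Bochner_Integration.integral_sum) auto
    also have "\<dots> = (\<Sum>b\<in>Basis. (h \<bullet> b) * (LINT x|lebesgue_on \<Omega>. (g x \<bullet> b) * ?p x))"
      by (simp add: pb sum_negf)
    also have "\<dots> = (LINT x|lebesgue_on \<Omega>. (\<Sum>b\<in>Basis. (h \<bullet> b) * ((g x \<bullet> b) * ?p x)))"
      using gpb by (subst Bochner_Integration.integral_sum) auto
    also have "\<dots> = (LINT x|lebesgue_on \<Omega>. (g x \<bullet> h) * ?p x)"
      by (simp add: euclidean_inner[of _ h] sum_distrib_left mult_ac)
    finally have "\<bar>?d t\<bar> = \<bar>LINT x|lebesgue_on \<Omega>. (g x \<bullet> h) * ?p x\<bar>" by simp
    also have "\<dots> \<le> (LINT x|lebesgue_on \<Omega>. norm h * norm (g x))"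
    proof (rule integral_abs_bound_integral)
      show "integrable (lebesgue_on \<Omega>) (\<lambda>x. (g x \<bullet> h) * ?p x)" by (rule gpb)
      show "integrable (lebesgue_on \<Omega>) (\<lambda>x. norm h * norm (g x))" using g(2) by auto
      fix x
      have "\<bar>g x \<bullet> h\<bar> * \<bar>?p x\<bar> \<le> (norm (g x) * norm h) * 1"
        by (intro mult_mono Cauchy_Schwarz_ineq2 \<phi>) auto
      then show "\<bar>(g x \<bullet> h) * ?p x\<bar> \<le> norm h * norm (g x)" by (simp add: abs_mult mult.commute)
    qed
    finally show ?thesis by simp
  qed
  have "\<bar>?\<psi> 1 - ?\<psi> 0\<bar> \<le> norm h * ?M * \<bar>1 - 0\<bar>"
    using field_differentiable_bound[of "{0..1}" ?\<psi> ?d "norm h * ?M" 1 0]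
      translated_pairing_has_derivative[OF C(1,2,4) U(1), of h] bound
    by (auto intro: has_field_derivative_at_within)
  moreover have "?\<psi> 1 - ?\<psi> 0 = (LINT x|lborel. (U (x + h) - U x) * \<phi> x)"
  proof -
    have i0: "integrable lborel (\<lambda>x. U x * \<phi> (x - s))" for s
    proof (rule Bochner_Integration.integrable_bound[OF U(1)])
      show "AE x in lborel. norm (U x * \<phi> (x - s)) \<le> norm (U x)"
        using mult_left_mono[OF \<phi>(2) abs_ge_zero] by (intro AE_I2) (simp add: abs_mult)
    qed measurable
    have "(LINT x|lborel. U x * \<phi> (x - h)) = (LINT x|lborel. U (x + h) * \<phi> (x + h - h))"
      by (rule integral_lborel_translate[symmetric]) measurable
    moreover have "integrable lborel (\<lambda>x. U (x + h) * \<phi> (x + h - h))"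
      using lborel_integrable_translate[OF i0] .
    ultimately show ?thesis using i0[of 0] by (simp add: left_diff_distrib)
  qed
  ultimately show ?thesis by simp
qed

text \<open>
  The preceding estimate holds for all test functions on a neighbourhood \<open>V\<close> of
  \<open>K\<close> whose translates along \<open>h\<close> stay in \<open>\<Omega>\<close>;
  duality on \<open>V\<close> turns it into an \<open>L\<^sup>1\<close> bound.
\<close>

lemma integral_translate_diff_le:
  fixes U :: "'a::euclidean_space \<Rightarrow> real" and g :: "'a \<Rightarrow> 'a"
  assumes \<Omega>: "open \<Omega>" and U: "integrable lborel U" "\<And>x. x \<notin> \<Omega> \<Longrightarrow> U x = 0"
    and g: "has_weak_gradient \<Omega> U g" "integrable (lebesgue_on \<Omega>) g"
    and K: "compact K" "\<And>x. x \<in> K \<Longrightarrow> ball x r \<subseteq> \<Omega>" and h: "norm h < r / 2"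
  shows "(LINT x|lebesgue_on K. \<bar>U (x + h) - U x\<bar>) \<le> norm h * (LINT x|lebesgue_on \<Omega>. norm (g x))"
proof -
  \<comment> \<open>Half of the radius is spent on \<open>V\<close>, the other half on the translation.\<close>
  define V where "V = (\<Union>x\<in>K. ball x (r / 2))"
  have r: "r > 0" using h norm_ge_zero[of h] by linarith
  have V: "open V" "K \<subseteq> V" using r by (auto simp: V_def)
  have Um[measurable]: "U \<in> borel_measurable borel" using U by auto
  have Vh: "x + t *\<^sub>R h \<in> \<Omega>" if xV: "x \<in> V" and t: "0 \<le> t" "t \<le> 1" for x t
  proof -
    obtain y where y: "y \<in> K" "dist y x < r / 2" using xV by (auto simp: V_def)
    have "norm (t *\<^sub>R h) \<le> 1 * norm h" using t unfolding norm_scaleR by (intro mult_right_mono) auto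
    then have "dist x (x + t *\<^sub>R h) < r / 2" using h by (simp add: dist_norm)
    then have "dist y (x + t *\<^sub>R h) < r" using y(2) dist_triangle[of y "x + t *\<^sub>R h" x] by simp
    then show ?thesis using K(2)[OF y(1)] by auto
  qed
  have i: "integrable lborel (\<lambda>x. U (x + h) - U x)"
    using lborel_integrable_translate[OF U(1)] U(1) by auto
  have "(\<lambda>x. U (x + h) - U x) \<in> L1_loc V"
    unfolding L1_loc_def
  proof (intro CollectI allI impI)
    fix C :: "'a set" assume "compact C \<and> C \<subseteq> V"
    then have Cm: "C \<inter> space lebesgue \<in> sets lebesgue" using compact_sets_lebesgue by auto
    have "integrable lebesgue (\<lambda>x. U (x + h) - U x)" using i by (subst integrable_completion) auto
    then show "integrable (lebesgue_on C) (\<lambda>x. U (x + h) - U x)"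
      unfolding integrable_restrict_space[OF Cm] using Cm by (intro integrable_mult_indicator) auto
  qed
  then show ?thesis
  proof (rule integral_abs_compact_le[OF V(1) _ K(1) V(2)])
    fix \<phi> assume \<phi>: "\<phi> \<in> test_functions V" "\<And>x. \<bar>\<phi> x\<bar> \<le> 1"
    obtain C where C: "smooth \<phi>" "compact C" "C \<subseteq> V" "\<And>x. x \<notin> C \<Longrightarrow> \<phi> x = 0"
      using test_functionsE[OF \<phi>(1)] by metis
    have [measurable]: "\<phi> \<in> borel_measurable borel"
      using smooth_continuous_on[OF C(1)] by (auto intro: borel_measurable_continuous_onI)
    have "(LINT x|lebesgue_on V. (U (x + h) - U x) * \<phi> x) = (LINT x|lborel. (U (x + h) - U x) * \<phi> x)"
      by (rule integral_lebesgue_on_eq_lborel) (use C(3,4) V(1) in auto)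
    then show "\<bar>LINT x|lebesgue_on V. (U (x + h) - U x) * \<phi> x\<bar> \<le>
        norm h * (LINT x|lebesgue_on \<Omega>. norm (g x))"
      using translate_pairing_le[OF \<Omega> U g \<phi> Vh] by simp
  qed
qed

section \<open>Local compactness through averages\<close>

text \<open>
  The averaging kernel. It is Lipschitz, which makes averages Lipschitz uniformly in the
  averaged function; it is not normalized, and its integral is \<open>hat_mass\<close>.
\<close>

definition hat :: "real \<Rightarrow> 'a::euclidean_space \<Rightarrow> real" where
  "hat \<delta> h = max 0 (\<delta> - norm h)"

lemma hat_bounds: "0 \<le> hat \<delta> h" "\<delta> \<ge> 0 \<Longrightarrow> hat \<delta> h \<le> \<delta>"
  by (auto simp: hat_def)

lemma abs_hat [simp]: "\<bar>hat \<delta> h\<bar> = hat \<delta> h"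
  by (simp add: hat_def)

lemma hat_lipschitz: "\<bar>hat \<delta> a - hat \<delta> b\<bar> \<le> norm (a - b)"
  unfolding hat_def using norm_triangle_ineq2[of a b] norm_triangle_ineq2[of b a]
  by (auto simp: norm_minus_commute max_def)

lemma hat_continuous: "continuous_on S (hat \<delta>)"
  unfolding hat_def by (intro continuous_intros)

lemma hat_measurable[measurable]: "hat \<delta> \<in> borel_measurable borel"
  using hat_continuous by (rule borel_measurable_continuous_onI)

lemma hat_zero: "h \<notin> cball 0 \<delta> \<Longrightarrow> hat \<delta> h = 0"
  by (auto simp: hat_def)

lemma hat_integrable: "integrable lborel (hat \<delta> :: 'a::euclidean_space \<Rightarrow> real)"
proof -
  have "(\<lambda>h::'a. indicator (cball 0 \<delta>) h *\<^sub>R hat \<delta> h) = hat \<delta>"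
    using hat_zero[of _ \<delta>] by (fastforce simp: indicator_def)
  then show ?thesis
    using borel_integrable_compact[OF compact_cball[of "0::'a" \<delta>] hat_continuous[of _ \<delta>]] by simp
qed

definition hat_mass :: "'a::euclidean_space itself \<Rightarrow> real \<Rightarrow> real" where
  "hat_mass _ \<delta> = (LINT h|lborel. hat \<delta> (h::'a))"

lemma hat_mass_pos:
  assumes "\<delta> > 0" shows "hat_mass TYPE('a::euclidean_space) \<delta> > 0"
proof -
  have m: "measure lborel (ball (0::'a) (\<delta> / 2)) > 0"
    using content_ball_pos[of "\<delta> / 2" "0::'a"] assms by simp
  have "(LINT h|lborel. indicator (ball (0::'a) (\<delta> / 2)) h * (\<delta> / 2)) \<le> (LINT h|lborel. hat \<delta> (h::'a))"
  proof (rule integral_mono[OF _ hat_integrable])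
    show "integrable lborel (\<lambda>h::'a. indicator (ball 0 (\<delta> / 2)) h * (\<delta> / 2))"
      by (intro integrable_mult_left integrable_real_indicator) (use emeasure_bounded_finite[of "ball (0::'a) (\<delta> / 2)"] in auto)
  qed (auto simp: hat_def indicator_def max_def)
  moreover have "(LINT h|lborel. indicator (ball (0::'a) (\<delta> / 2)) h * (\<delta> / 2)) = measure lborel (ball (0::'a) (\<delta> / 2)) * (\<delta> / 2)"
    by simp
  ultimately show ?thesis using m assms unfolding hat_mass_def
    by (metis half_gt_zero mult_pos_pos order_less_le_trans)
qed

definition average :: "('a::euclidean_space \<Rightarrow> real) \<Rightarrow> real \<Rightarrow> 'a \<Rightarrow> real" where
  "average U \<delta> x = (LINT y|lborel. U y * hat \<delta> (y - x))"

lemma integrable_mult_hat: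
  assumes "integrable lborel U" "\<delta> \<ge> 0"
  shows "integrable lborel (\<lambda>y. U y * hat \<delta> (y - x))"
proof (rule Bochner_Integration.integrable_bound)
  have [measurable]: "U \<in> borel_measurable borel" using assms by auto
  show "(\<lambda>y. U y * hat \<delta> (y - x)) \<in> borel_measurable lborel" by measurable
  show "integrable lborel (\<lambda>y. \<delta> * U y)" using assms by auto
  show "AE y in lborel. norm (U y * hat \<delta> (y - x)) \<le> norm (\<delta> * U y)"
    using mult_left_mono[OF hat_bounds(2)[OF assms(2)] abs_ge_zero] assms(2) hat_bounds(1)[of \<delta>]
    by (intro AE_I2) (simp add: abs_mult mult.commute)
qed

text \<open>
  The Lipschitz constant depends on \<open>U\<close> only through its \<open>L\<^sup>1\<close>
  norm, so averages of a bounded family are equicontinuous.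
\<close>

lemma average_lipschitz:
  assumes U: "integrable lborel U" and "\<delta> \<ge> 0"
  shows "\<bar>average U \<delta> x - average U \<delta> x'\<bar> \<le> norm (x - x') * (LINT y|lborel. \<bar>U y\<bar>)"
proof -
  note i = integrable_mult_hat[OF assms]
  have "\<bar>average U \<delta> x - average U \<delta> x'\<bar> = \<bar>LINT y|lborel. U y * (hat \<delta> (y - x) - hat \<delta> (y - x'))\<bar>"
    unfolding average_def using i by (simp add: right_diff_distrib)
  also have "\<dots> \<le> (LINT y|lborel. norm (x - x') * \<bar>U y\<bar>)"
  proof (rule integral_abs_bound_integral)
    show "integrable lborel (\<lambda>y. U y * (hat \<delta> (y - x) - hat \<delta> (y - x')))"
      using i by (simp add: right_diff_distrib)
    show "integrable lborel (\<lambda>y. norm (x - x') * \<bar>U y\<bar>)" using U by auto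
    fix y
    have "\<bar>hat \<delta> (y - x) - hat \<delta> (y - x')\<bar> \<le> norm (x - x')"
      using hat_lipschitz[of \<delta> "y - x" "y - x'"] by (simp add: norm_minus_commute)
    then show "\<bar>U y * (hat \<delta> (y - x) - hat \<delta> (y - x'))\<bar> \<le> norm (x - x') * \<bar>U y\<bar>"
      by (simp add: abs_mult mult.commute[of "norm _"] mult_left_mono)
  qed
  finally show ?thesis by simp
qed

lemma average_measurable:
  assumes U: "integrable lborel U" and "\<delta> \<ge> 0"
  shows "average U \<delta> \<in> borel_measurable borel"
proof -
  let ?L = "LINT y|lborel. \<bar>U y\<bar>"
  have "?L-lipschitz_on UNIV (average U \<delta>)"
    using average_lipschitz[OF assms]
    by (intro lipschitz_onI) (auto simp: dist_norm mult.commute)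
  then show ?thesis
    using borel_measurable_continuous_onI lipschitz_on_continuous_on by blast
qed

lemma average_bound:
  assumes U: "integrable lborel U" and "\<delta> \<ge> 0"
  shows "\<bar>average U \<delta> x\<bar> \<le> \<delta> * (LINT y|lborel. \<bar>U y\<bar>)"
proof -
  have "\<bar>average U \<delta> x\<bar> \<le> (LINT y|lborel. \<delta> * \<bar>U y\<bar>)"
    unfolding average_def
  proof (rule integral_abs_bound_integral)
    show "\<And>y. \<bar>U y * hat \<delta> (y - x)\<bar> \<le> \<delta> * \<bar>U y\<bar>"
      using mult_left_mono[OF hat_bounds(2)[OF assms(2)] abs_ge_zero] hat_bounds(1)[of \<delta>]
      by (simp add: abs_mult mult.commute)
  qed (use U integrable_mult_hat[OF assms] in auto)
  then show ?thesis by simp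
qed

text \<open>
  By Fubini's theorem, the distance of \<open>U\<close> from its average is at most the average
  over \<open>norm h < \<delta>\<close> of the distances of \<open>U\<close> from its translates
  by \<open>h\<close>, which are at most \<open>\<delta> * M\<close>.
\<close>

lemma integral_diff_average_le:
  fixes U :: "'a::euclidean_space \<Rightarrow> real" and g :: "'a \<Rightarrow> 'a"
  assumes \<Omega>: "open \<Omega>" and U: "integrable lborel U" "\<And>x. \<bar>U x\<bar> \<le> 1" "\<And>x. x \<notin> \<Omega> \<Longrightarrow> U x = 0"
    and g: "has_weak_gradient \<Omega> U g" "integrable (lebesgue_on \<Omega>) g"
    and M: "(LINT x|lebesgue_on \<Omega>. norm (g x)) \<le> M"
    and K: "compact K" "\<And>x. x \<in> K \<Longrightarrow> ball x r \<subseteq> \<Omega>" and \<delta>: "0 < \<delta>" "\<delta> < r / 2"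
  shows "(LINT x|lborel. indicator K x * \<bar>hat_mass TYPE('a) \<delta> * U x - average U \<delta> x\<bar>)
    \<le> hat_mass TYPE('a) \<delta> * (\<delta> * M)"
proof -
  have Um[measurable]: "U \<in> borel_measurable borel" using U by auto
  have Km[measurable]: "K \<in> sets borel" using K(1) by (simp add: borel_compact)
  have M0: "M \<ge> 0" using order_trans[OF Bochner_Integration.integral_nonneg M] by simp
  let ?c = "hat_mass TYPE('a) \<delta>"
  define F :: "'a \<Rightarrow> 'a \<Rightarrow> real" where "F x h = indicator K x * (hat \<delta> h * \<bar>U (x + h) - U x\<bar>)" for x h
  have Fint: "integrable (lborel \<Otimes>\<^sub>M lborel) (case_prod F)"
    unfolding lborel_prod
  proof (rule Bochner_Integration.integrable_bound)
    have "emeasure lborel (K \<times> cball (0::'a) \<delta>) < \<infinity>"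
      by (intro emeasure_compact_finite compact_Times K compact_cball)
    moreover have "K \<times> cball (0::'a) \<delta> \<in> sets borel"
      by (intro borel_compact compact_Times K compact_cball)
    ultimately show "integrable lborel (\<lambda>z. (2 * \<delta>) * indicator (K \<times> cball (0::'a) \<delta>) z)"
      by (intro integrable_mult_right integrable_real_indicator) auto
    show "case_prod F \<in> borel_measurable lborel"
    proof -
      have "case_prod F \<in> borel_measurable (borel \<Otimes>\<^sub>M borel)"
        unfolding F_def by measurable
      then show ?thesis by (simp add: borel_prod)
    qed
    show "AE z in lborel. norm (case_prod F z) \<le> norm (2 * \<delta> * indicator (K \<times> cball (0::'a) \<delta>) z)"
    proof (intro AE_I2)
      fix z :: "'a \<times> 'a"
      obtain x h where z: "z = (x, h)" by (cases z)
      show "norm (case_prod F z) \<le> norm (2 * \<delta> * indicator (K \<times> cball (0::'a) \<delta>) z)"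
      proof (cases "x \<in> K \<and> h \<in> cball 0 \<delta>")
        case True
        have "hat \<delta> h * \<bar>U (x + h) - U x\<bar> \<le> \<delta> * 2"
          using U(2)[of x] U(2)[of "x + h"] hat_bounds[of \<delta> h] \<delta>
          by (intro mult_mono) auto
        then show ?thesis using True hat_bounds(1)[of \<delta> h] \<delta> by (simp add: z F_def abs_mult)
      next
        case False
        then have "F x h = 0" using hat_zero[of h \<delta>] by (auto simp: F_def indicator_def)
        then show ?thesis by (simp add: z)
      qed
    qed
  qed
  have Uh: "integrable lborel (\<lambda>h. U (x + h) * hat \<delta> h)" for x
    using lborel_integrable_translate[OF integrable_mult_hat[OF U(1), of \<delta> x], of x] \<delta>
    by (simp add: add.commute)
  have av: "average U \<delta> x = (LINT h|lborel. U (x + h) * hat \<delta> h)" for x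
    unfolding average_def
    by (subst integral_lborel_translate[symmetric, of _ x]) (auto simp: add.commute)
  have pw: "indicator K x * \<bar>?c * U x - average U \<delta> x\<bar> \<le> (LINT h|lborel. F x h)" for x
  proof -
    have cU: "integrable lborel (\<lambda>h. U x * hat \<delta> (h::'a))" using hat_integrable by auto
    have "?c * U x - average U \<delta> x = (LINT h|lborel. U x * hat \<delta> h - U (x + h) * hat \<delta> h)"
      using Uh cU unfolding av hat_mass_def by (subst Bochner_Integration.integral_diff) auto
    also have "\<bar>\<dots>\<bar> \<le> (LINT h|lborel. \<bar>U x * hat \<delta> h - U (x + h) * hat \<delta> h\<bar>)"
      by (rule integral_abs_bound)
    also have "\<dots> = (LINT h|lborel. hat \<delta> h * \<bar>U (x + h) - U x\<bar>)"
    proof (rule Bochner_Integration.integral_cong[OF refl])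
      fix h
      have "U x * hat \<delta> h - U (x + h) * hat \<delta> h = hat \<delta> h * (U x - U (x + h))"
        by (simp add: algebra_simps)
      then show "\<bar>U x * hat \<delta> h - U (x + h) * hat \<delta> h\<bar> = hat \<delta> h * \<bar>U (x + h) - U x\<bar>"
        using hat_bounds(1)[of \<delta> h] by (simp add: abs_mult abs_minus_commute)
    qed
    finally show ?thesis
      unfolding F_def by (simp add: indicator_def)
  qed
  \<comment> \<open>Translations by \<open>norm h \<ge> \<delta>\<close> do not contribute, as the kernel vanishes there.\<close>
  have slice: "(LINT x|lborel. F x h) \<le> hat \<delta> h * (\<delta> * M)" for h
  proof (cases "norm h < \<delta>")
    case True
    have eq: "(LINT x|lborel. F x h) = hat \<delta> h * (LINT x|lborel. indicator K x * \<bar>U (x + h) - U x\<bar>)"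
      unfolding F_def mult.left_commute[of "indicator K _" "hat \<delta> h"] by simp
    have "(LINT x|lborel. indicator K x * \<bar>U (x + h) - U x\<bar>) = 
      (LINT x|lebesgue_on K. indicator K x * \<bar>U (x + h) - U x\<bar>)"
      by (rule integral_lebesgue_on_eq_lborel[symmetric]) (use K compact_sets_lebesgue in auto)
    also have "\<dots> = (LINT x|lebesgue_on K. \<bar>U (x + h) - U x\<bar>)"
      by (rule Bochner_Integration.integral_cong) auto
    also have "\<dots> \<le> norm h * (LINT x|lebesgue_on \<Omega>. norm (g x))"
      by (rule integral_translate_diff_le[OF \<Omega> U(1,3) g K]) (use True \<delta> in auto)
    also have "\<dots> \<le> \<delta> * M" using True M \<delta> by (intro mult_mono) auto
    finally show ?thesis unfolding eq by (intro mult_left_mono hat_bounds)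
  next
    case False
    then have "hat \<delta> h = 0" by (simp add: hat_def)
    then show ?thesis by (simp add: F_def)
  qed
  have "(LINT x|lborel. indicator K x * \<bar>?c * U x - average U \<delta> x\<bar>) \<le> (LINT x|lborel. LINT h|lborel. F x h)"
  proof (rule integral_mono')
    show "integrable lborel (\<lambda>x. LINT h|lborel. F x h)"
      using lborel_pair.integrable_fst[OF Fint] by simp
    show "0 \<le> (LINT h|lborel. F x h)" for x
      unfolding F_def by (intro Bochner_Integration.integral_nonneg mult_nonneg_nonneg hat_bounds) auto
  qed (rule pw)
  also have "\<dots> = (LINT h|lborel. LINT x|lborel. F x h)"
    by (rule lborel_pair.Fubini_integral[OF Fint, symmetric])
  also have "\<dots> \<le> (LINT h|lborel. hat \<delta> (h::'a) * (\<delta> * M))"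
  proof (rule integral_mono)
    show "integrable lborel (\<lambda>h. LINT x|lborel. F x h)"
      using lborel_pair.integrable_snd[OF Fint] by simp
    show "integrable lborel (\<lambda>h::'a. hat \<delta> h * (\<delta> * M))" using hat_integrable by auto
  qed (rule slice)
  also have "\<dots> = ?c * (\<delta> * M)" by (simp add: hat_mass_def)
  finally show ?thesis .
qed

text \<open>
  A diagonal argument gives convergence for the radii \<open>1 / Suc j\<close> and the centres
  in a countable dense set; equicontinuity extends it to all centres.
\<close>

lemma averages_convergent_subsequence:
  fixes U :: "nat \<Rightarrow> 'a::euclidean_space \<Rightarrow> real"
  assumes U: "\<And>k. integrable lborel (U k)" and B: "\<And>k. (LINT y|lborel. \<bar>U k y\<bar>) \<le> B"
  obtains r :: "nat \<Rightarrow> nat" where "strict_mono r"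
    "\<And>j x. convergent (\<lambda>k. average (U (r k)) (1 / real (Suc j)) x)"
proof -
  obtain D :: "'a set" where D: "countable D" "\<And>X. open X \<Longrightarrow> X \<noteq> {} \<Longrightarrow> \<exists>d\<in>D. d \<in> X"
    using countable_dense_setE by blast
  have B0: "B \<ge> 0" using order_trans[OF Bochner_Integration.integral_nonneg B] by simp
  have "norm (average (U k) (1 / real (Suc (fst p))) (snd p)) \<le> B" for k and p :: "nat \<times> 'a"
  proof -
    have "\<bar>average (U k) (1 / real (Suc (fst p))) (snd p)\<bar> \<le> 1 / real (Suc (fst p)) * (LINT y|lborel. \<bar>U k y\<bar>)"
      by (rule average_bound[OF U]) simp
    also have "\<dots> \<le> 1 * B" using B B0 by (intro mult_mono) auto
    finally show ?thesis by simp
  qed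
  note bound = this
  have cS: "countable ((UNIV :: nat set) \<times> D)" using D(1) by simp
  obtain r :: "nat \<Rightarrow> nat" where r: "strict_mono r"
    "\<And>p. p \<in> UNIV \<times> D \<Longrightarrow> \<exists>l. (\<lambda>k. average (U (r k)) (1 / real (Suc (fst p))) (snd p)) \<longlonglongrightarrow> l"
    by (rule function_convergent_subsequence[OF cS bound]) (rule that)
  have "Cauchy (\<lambda>k. average (U (r k)) (1 / real (Suc j)) x)" for j x
  proof (rule metric_CauchyI)
    let ?a = "\<lambda>k. average (U (r k)) (1 / real (Suc j))"
    fix e :: real assume e: "e > 0"
    obtain d where d: "d \<in> D" "d \<in> ball x (e / (3 * (B + 1)))"
    proof -
      have "0 < e / (3 * (B + 1))" using e B0 by simp
      then have "x \<in> ball x (e / (3 * (B + 1)))" by simp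
      then show thesis using D(2)[OF open_ball] that by blast
    qed
    have near: "\<bar>?a k x - ?a k d\<bar> < e / 3" for k
    proof -
      have "\<bar>?a k x - ?a k d\<bar> \<le> norm (x - d) * (LINT y|lborel. \<bar>U (r k) y\<bar>)"
        by (rule average_lipschitz[OF U]) simp
      also have "\<dots> \<le> norm (x - d) * (B + 1)"
        using B[of "r k"] by (intro mult_left_mono) auto
      also have "\<dots> < e / (3 * (B + 1)) * (B + 1)"
        using d(2) B0 by (intro mult_strict_right_mono) (auto simp: dist_norm)
      also have "\<dots> = e / 3" using B0 by (simp add: field_simps)
      finally show ?thesis .
    qed
    have "Cauchy (\<lambda>k. ?a k d)"
      using r(2)[of "(j, d)"] d(1) LIMSEQ_imp_Cauchy by auto
    then obtain N where N: "\<And>k l. k \<ge> N \<Longrightarrow> l \<ge> N \<Longrightarrow> dist (?a k d) (?a l d) < e / 3"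
      using metric_CauchyD[of "\<lambda>k. ?a k d" "e / 3"] e by auto
    have "dist (?a k x) (?a l x) < e" if "k \<ge> N" "l \<ge> N" for k l
      using near[of k] near[of l] N[OF that] unfolding dist_real_def by linarith
    then show "\<exists>N. \<forall>k\<ge>N. \<forall>l\<ge>N. dist (?a k x) (?a l x) < e" by blast
  qed
  then show thesis using that r(1) Cauchy_convergent by blast
qed

text \<open>
  A form of Rellich's theorem. On a compact set \<open>T\<close> the functions are close in
  \<open>L\<^sup>1\<close> to their averages, uniformly in \<open>k\<close>, and the averages
  converge pointwise and boundedly along a subsequence. On \<open>\<Omega> - T\<close> the
  difference of two of the functions is at most 2.
\<close>

lemma L1_Cauchy_subsequence:
  fixes U :: "nat \<Rightarrow> 'a::euclidean_space \<Rightarrow> real" and g :: "nat \<Rightarrow> 'a \<Rightarrow> 'a"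
  assumes \<Omega>: "open \<Omega>" "bounded \<Omega>"
    and Um: "\<And>k. U k \<in> borel_measurable borel" and U1: "\<And>k x. \<bar>U k x\<bar> \<le> 1" and U0: "\<And>k x. x \<notin> \<Omega> \<Longrightarrow> U k x = 0"
    and g: "\<And>k. has_weak_gradient \<Omega> (U k) (g k)" "\<And>k. integrable (lebesgue_on \<Omega>) (g k)"
    and M: "\<And>k. (LINT x|lebesgue_on \<Omega>. norm (g k x)) \<le> M"
  obtains r :: "nat \<Rightarrow> nat" where "strict_mono r"
    "\<And>e. e > 0 \<Longrightarrow> \<exists>N. \<forall>k\<ge>N. \<forall>l\<ge>N. (LINT x|lborel. \<bar>U (r k) x - U (r l) x\<bar>) < e"
proof -
  have fin: "emeasure lborel \<Omega> < \<infinity>" using \<Omega>(2) by (rule emeasure_bounded_finite)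
  have \<Omega>m[measurable]: "\<Omega> \<in> sets borel" using \<Omega>(1) by auto
  note Um[measurable]
  have M0: "M \<ge> 0" using order_trans[OF Bochner_Integration.integral_nonneg M] by simp
  have ind: "integrable lborel (indicator \<Omega> :: 'a \<Rightarrow> real)"
    using fin by (intro integrable_real_indicator) auto
  have Ui: "integrable lborel (U k)" for k
    by (rule Bochner_Integration.integrable_bound[OF ind])
       (use U1 U0 in \<open>auto simp: indicator_def\<close>)
  have "(LINT y|lborel. \<bar>U k y\<bar>) \<le> (LINT y|lborel. indicator \<Omega> y)" for k
    by (rule integral_mono[OF _ ind]) (use Ui U1 U0 in \<open>auto simp: indicator_def\<close>)
  note B = this
  obtain r :: "nat \<Rightarrow> nat" where r: "strict_mono r"
    "\<And>j x. convergent (\<lambda>k. average (U (r k)) (1 / real (Suc j)) x)"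
    by (rule averages_convergent_subsequence[OF Ui B]) (rule that)
  show thesis
  proof (rule that[OF r(1)])
    fix e :: real assume e: "e > 0"
    have \<Omega>l: "\<Omega> \<in> sets lebesgue" and e8: "e / 8 > 0" using e by auto
    obtain T where T: "closed T" "T \<subseteq> \<Omega>" "\<Omega> - T \<in> lmeasurable" "emeasure lebesgue (\<Omega> - T) < ennreal (e / 8)"
      by (rule sets_lebesgue_inner_closed[OF \<Omega>l e8])
    have Tc: "compact T"
      using T(1,2) \<Omega>(2) bounded_subset compact_eq_bounded_closed by blast
    have Tm[measurable]: "T \<in> sets borel" using T(1) by auto
    have mT: "measure lborel (\<Omega> - T) < e / 8"
    proof -
      have "ennreal (measure lebesgue (\<Omega> - T)) < ennreal (e / 8)"
        using T(4) unfolding emeasure_eq_measure2[OF T(3)] .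
      then show ?thesis by (simp add: ennreal_less_iff measure_completion)
    qed
    obtain R where R: "R > 0" "(\<Union>x\<in>T. cball x R) \<subseteq> \<Omega>"
      by (rule compact_subset_open_imp_cball_epsilon_subset[OF Tc \<Omega>(1) T(2)])
    have Rb: "ball x R \<subseteq> \<Omega>" if "x \<in> T" for x using R(2) that ball_subset_cball by blast
    \<comment> \<open>The radius must be small enough for the averages near \<open>T\<close> to stay inside \<open>\<Omega>\<close>, and for the
      approximation error \<open>\<delta> * M\<close> to be below \<open>e / 8\<close>.\<close>
    obtain j where j: "1 / real (Suc j) < min (R / 2) (e / (8 * (M + 1)))"
      using reals_Archimedean[of "min (R / 2) (e / (8 * (M + 1)))"] R(1) e M0
      by (auto simp: inverse_eq_divide)
    define \<delta> where "\<delta> = 1 / real (Suc j)"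
    have \<delta>: "0 < \<delta>" "\<delta> < R / 2" "\<delta> * M < e / 8"
    proof -
      show "0 < \<delta>" "\<delta> < R / 2" using j by (auto simp: \<delta>_def)
      have "\<delta> * M \<le> \<delta> * (M + 1)" using \<open>0 < \<delta>\<close> by simp
      also have "\<dots> < e / (8 * (M + 1)) * (M + 1)"
        using j M0 by (intro mult_strict_right_mono) (auto simp: \<delta>_def)
      also have "\<dots> = e / 8" using M0 by (simp add: field_simps)
      finally show "\<delta> * M < e / 8" .
    qed
    define c where "c = hat_mass TYPE('a) \<delta>"
    have c: "c > 0" unfolding c_def by (rule hat_mass_pos[OF \<delta>(1)])
    define A where "A k = average (U (r k)) \<delta>" for k
    have Am[measurable]: "A k \<in> borel_measurable borel" for k
      unfolding A_def using average_measurable[OF Ui] \<delta>(1) by simp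
    have Al: "convergent (\<lambda>k. A k x)" for x unfolding A_def \<delta>_def by (rule r(2))
    define a where "a x = lim (\<lambda>k. A k x)" for x
    have Aa: "(\<lambda>k. A k x) \<longlonglongrightarrow> a x" for x
      using Al[of x] unfolding a_def by (simp add: convergent_LIMSEQ_iff)
    have am[measurable]: "a \<in> borel_measurable borel"
      unfolding a_def[abs_def] by measurable
    define L where "L = \<delta> * (LINT y|lborel. indicator \<Omega> y)"
    have AL: "\<bar>A k x\<bar> \<le> L" for k x
    proof -
      have "\<bar>A k x\<bar> \<le> \<delta> * (LINT y|lborel. \<bar>U (r k) y\<bar>)"
        unfolding A_def using average_bound[OF Ui] \<delta>(1) by simp
      also have "\<dots> \<le> L" unfolding L_def using \<delta>(1)
        by (intro mult_left_mono integral_mono[OF _ ind]) (use Ui U1 U0 in \<open>auto simp: indicator_def\<close>)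
      finally show ?thesis .
    qed
    have aL: "\<bar>a x\<bar> \<le> L" for x
      using LIMSEQ_le_const2[OF tendsto_rabs[OF Aa]] AL by blast
    have indT: "integrable lborel (indicator T :: 'a \<Rightarrow> real)"
      using emeasure_compact_finite[OF Tc] by (intro integrable_real_indicator) auto
    have iTb: "integrable lborel (\<lambda>x. indicator T x * f x)"
      if "f \<in> borel_measurable borel" "\<And>x. \<bar>f x\<bar> \<le> C" for f :: "'a \<Rightarrow> real" and C
    proof (rule Bochner_Integration.integrable_bound)
      show "integrable lborel (\<lambda>x. C * indicator T x :: real)" using indT by auto
      show "AE x in lborel. norm (indicator T x * f x) \<le> norm (C * indicator T x)"
        by (intro AE_I2) (auto simp: indicator_def intro: order_trans[OF that(2) abs_ge_self])
    qed (use that in measurable)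
    have "(\<lambda>k. LINT x|lborel. indicator T x * \<bar>A k x - a x\<bar>) \<longlonglongrightarrow> (LINT x|lborel. indicator T x * (0::real))"
    proof (rule integral_dominated_convergence[where w="\<lambda>x. indicator T x * (2 * L)"])
      show "integrable lborel (\<lambda>x. indicator T x * (2 * L))" using indT by auto
      show "AE x in lborel. (\<lambda>k. indicator T x * \<bar>A k x - a x\<bar>) \<longlonglongrightarrow> indicator T x * 0"
      proof (intro AE_I2 tendsto_mult tendsto_const)
        fix x show "(\<lambda>k. \<bar>A k x - a x\<bar>) \<longlonglongrightarrow> 0"
          using tendsto_rabs[OF tendsto_diff[OF Aa[of x] tendsto_const[of "a x"]]] by simp
      qed
      show "AE x in lborel. norm (indicator T x * \<bar>A k x - a x\<bar>) \<le> indicator T x * (2 * L)" for k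
      proof (intro AE_I2)
        fix x
        have "\<bar>A k x - a x\<bar> \<le> 2 * L" using AL[of k x] aL[of x] by linarith
        then show "norm (indicator T x * \<bar>A k x - a x\<bar>) \<le> indicator T x * (2 * L)"
          by (auto simp: indicator_def)
      qed
    qed measurable
    then have lim0: "(\<lambda>k. LINT x|lborel. indicator T x * \<bar>A k x - a x\<bar>) \<longlonglongrightarrow> 0" by simp
    have "c * e / 8 > 0" using c e by simp
    from order_tendstoD(2)[OF lim0 this] obtain N where
      N: "\<And>k. k \<ge> N \<Longrightarrow> (LINT x|lborel. indicator T x * \<bar>A k x - a x\<bar>) < c * e / 8"
      by (auto simp: eventually_sequentially)
    have close: "(LINT x|lborel. indicator T x * \<bar>c * U (r k) x - A k x\<bar>) \<le> c * (\<delta> * M)" for k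
      unfolding c_def A_def
      by (rule integral_diff_average_le[OF \<Omega>(1) Ui U1 U0 g M Tc Rb \<delta>(1,2)]) auto
    have "(LINT x|lborel. \<bar>U (r k) x - U (r l) x\<bar>) < e" if kl: "k \<ge> N" "l \<ge> N" for k l
    proof -
      let ?I = "\<lambda>f. LINT x|lborel. indicator T x * \<bar>f x\<bar> :: real"
      have i1: "integrable lborel (\<lambda>x. indicator T x * \<bar>c * U (r k) x - A k x\<bar>)" for k
      proof (rule iTb[where C="c + L"])
        fix x
        have "\<bar>c * U (r k) x\<bar> \<le> c * 1" using U1 c by (simp add: abs_mult)
        then show "\<bar>\<bar>c * U (r k) x - A k x\<bar>\<bar> \<le> c + L" using AL[of k x] by linarith
      qed measurable
      have i2: "integrable lborel (\<lambda>x. indicator T x * \<bar>A k x - a x\<bar>)" for k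
      proof (rule iTb[where C="2 * L"])
        fix x
        show "\<bar>\<bar>A k x - a x\<bar>\<bar> \<le> 2 * L" using AL[of k x] aL[of x] by linarith
      qed measurable
      have i3: "integrable lborel (\<lambda>x. 2 * indicator (\<Omega> - T) x :: real)"
      proof -
        have "emeasure lborel (\<Omega> - T) < \<infinity>"
          by (rule emeasure_bounded_finite) (use \<Omega>(2) bounded_subset in blast)
        then show ?thesis by (intro integrable_mult_right integrable_real_indicator) auto
      qed
      have "(LINT x|lborel. \<bar>U (r k) x - U (r l) x\<bar>) \<le>
        (LINT x|lborel. 2 * indicator (\<Omega> - T) x + (1 / c) *
          (indicator T x * \<bar>c * U (r k) x - A k x\<bar> + indicator T x * \<bar>c * U (r l) x - A l x\<bar>
           + indicator T x * \<bar>A k x - a x\<bar> + indicator T x * \<bar>A l x - a x\<bar>))"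
      proof (rule integral_mono)
        show "integrable lborel (\<lambda>x. \<bar>U (r k) x - U (r l) x\<bar>)" using Ui by auto
        fix x
        consider "x \<in> T" | "x \<in> \<Omega> - T" | "x \<notin> \<Omega>" by blast
        then show "\<bar>U (r k) x - U (r l) x\<bar> \<le> 2 * indicator (\<Omega> - T) x + (1 / c) *
          (indicator T x * \<bar>c * U (r k) x - A k x\<bar> + indicator T x * \<bar>c * U (r l) x - A l x\<bar>
           + indicator T x * \<bar>A k x - a x\<bar> + indicator T x * \<bar>A l x - a x\<bar>)"
        proof cases
          case 1
          have "c * \<bar>U (r k) x - U (r l) x\<bar> = \<bar>c * U (r k) x - c * U (r l) x\<bar>"
            using c by (simp add: abs_mult flip: right_diff_distrib)
          also have "\<dots> \<le> \<bar>c * U (r k) x - A k x\<bar> + \<bar>c * U (r l) x - A l x\<bar> + \<bar>A k x - a x\<bar> + \<bar>A l x - a x\<bar>"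
            by linarith
          finally have "\<bar>U (r k) x - U (r l) x\<bar> \<le> (1 / c) * (\<bar>c * U (r k) x - A k x\<bar> +
              \<bar>c * U (r l) x - A l x\<bar> + \<bar>A k x - a x\<bar> + \<bar>A l x - a x\<bar>)"
            using c by (simp add: pos_le_divide_eq mult.commute)
          then show ?thesis using 1 by simp
        next
          case 2
          then show ?thesis using U1[of "r k" x] U1[of "r l" x] by (auto simp: indicator_def)
        next
          case 3
          then show ?thesis using U0 T(2) by (auto simp: indicator_def)
        qed
      qed (use i1 i2 i3 in auto)
      also have "\<dots> = 2 * measure lborel (\<Omega> - T) + (1 / c) *
          ((LINT x|lborel. indicator T x * \<bar>c * U (r k) x - A k x\<bar>) +
           (LINT x|lborel. indicator T x * \<bar>c * U (r l) x - A l x\<bar>)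
           + (LINT x|lborel. indicator T x * \<bar>A k x - a x\<bar>) + (LINT x|lborel. indicator T x * \<bar>A l x - a x\<bar>))"
        using i1 i2 i3 by simp
      also have "\<dots> \<le> 2 * (e / 8) + (1 / c) * (c * (\<delta> * M) + c * (\<delta> * M) + c * e / 8 + c * e / 8)"
        using mT close[of k] close[of l] N[OF kl(1)] N[OF kl(2)] c
        by (intro add_mono mult_left_mono) auto
      also have "\<dots> = e / 2 + 2 * (\<delta> * M)" using c by (simp add: field_simps)
      also have "\<dots> < e" using \<delta>(3) e by linarith
      finally show ?thesis .
    qed
    then show "\<exists>N. \<forall>k\<ge>N. \<forall>l\<ge>N. (LINT x|lborel. \<bar>U (r k) x - U (r l) x\<bar>) < e" by blast
  qed
qed

section \<open>Square-integrable functions on a bounded open set\<close>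

lemma finite_measure_lebesgue_on:
  assumes "bounded \<Omega>" "\<Omega> \<in> sets lebesgue" shows "finite_measure (lebesgue_on \<Omega>)"
proof -
  have "\<Omega> \<in> lmeasurable" using assms by (rule bounded_set_imp_lmeasurable)
  then show ?thesis
    by (intro finite_measureI) (auto simp: emeasure_restrict_space fmeasurable_def)
qed

text \<open>
  Completeness of Lebesgue measure, restricted to \<open>\<Omega>\<close>.
\<close>

lemma borel_measurable_AE_lebesgue_on:
  fixes f g :: "'a::euclidean_space \<Rightarrow> 'b::euclidean_space"
  assumes "\<Omega> \<in> sets lebesgue" "f \<in> borel_measurable (lebesgue_on \<Omega>)" "AE x in lebesgue_on \<Omega>. f x = g x"
  shows "g \<in> borel_measurable (lebesgue_on \<Omega>)"
proof -
  have sp: "\<Omega> \<inter> space lebesgue \<in> sets lebesgue" using assms(1) by auto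
  have "AE x in lebesgue. x \<in> \<Omega> \<longrightarrow> f x = g x" using assms(3) by (simp add: AE_restrict_space_iff[OF sp])
  then have "AE x in lebesgue. indicator \<Omega> x *\<^sub>R f x = indicator \<Omega> x *\<^sub>R g x"
    by eventually_elim (auto simp: indicator_def)
  then show ?thesis
    using assms(2) unfolding borel_measurable_restrict_space_iff[OF sp] by (rule borel_measurable_AE[rotated])
qed

text \<open>
  If the squares \<open>s\<^sup>2\<close> have integrals at most \<open>(1 / 4) ^ k\<close>,
  then this bounds the integral of \<open>s\<close> by a multiple of \<open>(1 / 2) ^ k\<close>
  on a finite measure space.
\<close>

lemma le_two_power_square_plus: "0 \<le> s \<Longrightarrow> s \<le> 2 ^ k * s\<^sup>2 + (1 / 2) ^ k" for s :: real
proof -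
  assume s: "0 \<le> s"
  show ?thesis
  proof (cases "s \<le> (1 / 2) ^ k")
    case True
    then show ?thesis by (simp add: add_increasing)
  next
    case False
    then have "1 \<le> 2 ^ k * s" by (simp add: power_one_over field_simps)
    then have "s * 1 \<le> s * (2 ^ k * s)" using s by (rule mult_left_mono)
    then show ?thesis by (simp add: power2_eq_square mult_ac add_increasing2)
  qed
qed

text \<open>
  The increments have summable \<open>L\<^sup>1\<close> norms, so almost everywhere the
  increments are absolutely summable. The sum of their norms also provides the dominating
  function \<open>W\<close>.
\<close>

lemma (in finite_measure) fast_L2_Cauchy_converges:
  fixes F :: "nat \<Rightarrow> 'a \<Rightarrow> 'b::euclidean_space"
  assumes Fm[measurable]: "\<And>k. F k \<in> borel_measurable M" and F0: "integrable M (F 0)"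
    and sq: "\<And>k. integrable M (\<lambda>x. (norm (F k x - F (Suc k) x))\<^sup>2)"
    and fast: "\<And>k. (LINT x|M. (norm (F k x - F (Suc k) x))\<^sup>2) \<le> (1 / 4) ^ k"
  obtains W where "integrable M W" "AE x in M. convergent (\<lambda>k. F k x) \<and> (\<forall>k. norm (F k x) \<le> W x)"
proof -
  define P where "P k x = norm (F k x - F (Suc k) x)" for k x
  have Pm[measurable]: "P k \<in> borel_measurable M" for k unfolding P_def by measurable
  have Pb: "P k x \<le> 2 ^ k * (P k x)\<^sup>2 + (1 / 2) ^ k" for k x
    by (rule le_two_power_square_plus) (simp add: P_def)
  have Ri: "integrable M (\<lambda>x. 2 ^ k * (P k x)\<^sup>2 + (1 / 2) ^ k)" for k
    using sq[of k] by (simp add: P_def)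
  have Pi: "integrable M (P k)" for k
    by (rule Bochner_Integration.integrable_bound[OF Ri]) (use Pb in \<open>auto simp: P_def\<close>)
  have PI: "(LINT x|M. P k x) \<le> (1 + measure M (space M)) * (1 / 2) ^ k" for k
  proof -
    have "(LINT x|M. P k x) \<le> (LINT x|M. 2 ^ k * (P k x)\<^sup>2 + (1 / 2) ^ k)"
      by (rule integral_mono[OF Pi Ri Pb])
    also have "\<dots> = 2 ^ k * (LINT x|M. (P k x)\<^sup>2) + measure M (space M) * (1 / 2) ^ k"
      using sq[of k] by (simp add: P_def)
    also have "\<dots> \<le> 2 ^ k * (1 / 4) ^ k + measure M (space M) * (1 / 2) ^ k"
      using fast[of k] by (simp add: P_def)
    also have "(2::real) ^ k * (1 / 4) ^ k = (1 / 2) ^ k"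
      by (simp flip: power_mult_distrib)
    finally show ?thesis by (simp add: algebra_simps)
  qed
  have smI: "summable (\<lambda>k. (1 + measure M (space M)) * (1 / 2) ^ k)"
    by (intro summable_mult summable_geometric) simp
  have nn: "(\<integral>\<^sup>+x. ennreal (P k x) \<partial>M) = ennreal (LINT x|M. P k x)" for k
    by (rule nn_integral_eq_integral[OF Pi]) (simp add: P_def)
  have smP: "summable (\<lambda>k. LINT x|M. P k x)"
    by (rule summable_comparison_test'[OF smI, of 0])
       (use PI in \<open>simp add: P_def Bochner_Integration.integral_nonneg\<close>)
  have "(\<integral>\<^sup>+x. (\<Sum>k. ennreal (P k x)) \<partial>M) = (\<Sum>k. ennreal (LINT x|M. P k x))"
    by (subst nn_integral_suminf) (auto simp: nn)
  also have "\<dots> \<noteq> \<infinity>"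
    using smP by (simp add: suminf_ennreal2 P_def Bochner_Integration.integral_nonneg)
  finally have "AE x in M. (\<Sum>k. ennreal (P k x)) \<noteq> \<infinity>"
    by (intro nn_integral_PInf_AE) auto
  then have sum: "AE x in M. summable (\<lambda>k. P k x)"
    by eventually_elim (auto intro!: summable_suminf_not_top simp: P_def)
  define W where "W x = norm (F 0 x) + (\<Sum>k. P k x)" for x
  have "integrable M (\<lambda>x. \<Sum>k. P k x)"
    by (rule integrable_suminf[OF Pi]) (use sum smP in \<open>auto simp: P_def\<close>)
  then have Wi: "integrable M W" unfolding W_def using F0 by auto
  have "AE x in M. convergent (\<lambda>k. F k x) \<and> (\<forall>k. norm (F k x) \<le> W x)"
    using sum
  proof eventually_elim
    fix x assume s: "summable (\<lambda>k. P k x)"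
    have tel: "F k x = F 0 x + (\<Sum>j<k. F (Suc j) x - F j x)" for k
      using sum_lessThan_telescope[of "\<lambda>j. F j x" k] by simp
    have Pd: "norm (F (Suc j) x - F j x) = P j x" for j by (simp add: P_def norm_minus_commute)
    have "summable (\<lambda>j. F (Suc j) x - F j x)"
      by (rule summable_norm_cancel) (simp add: Pd s)
    then have "(\<lambda>k. F 0 x + (\<Sum>j<k. F (Suc j) x - F j x)) \<longlonglongrightarrow> F 0 x + (\<Sum>j. F (Suc j) x - F j x)"
      by (intro tendsto_add tendsto_const summable_LIMSEQ)
    then have "(\<lambda>k. F k x) \<longlonglongrightarrow> F 0 x + (\<Sum>j. F (Suc j) x - F j x)" by (simp only: tel[symmetric])
    then have "convergent (\<lambda>k. F k x)" by (rule convergentI)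
    moreover have "norm (F k x) \<le> W x" for k
    proof -
      have "norm (F k x) \<le> norm (F 0 x) + norm (\<Sum>j<k. F (Suc j) x - F j x)"
        by (subst tel) (rule norm_triangle_ineq)
      also have "norm (\<Sum>j<k. F (Suc j) x - F j x) \<le> (\<Sum>j<k. P j x)"
        using norm_sum[of "\<lambda>j. F (Suc j) x - F j x" "{..<k}"] by (simp only: Pd)
      also have "\<dots> \<le> (\<Sum>j. P j x)" by (rule sum_le_suminf[OF s]) (auto simp: P_def)
      finally show ?thesis by (simp add: W_def)
    qed
    ultimately show "convergent (\<lambda>k. F k x) \<and> (\<forall>k. norm (F k x) \<le> W x)" by blast
  qed
  then show thesis using that Wi by blast
qed

lemma fatou_real:
  fixes f :: "nat \<Rightarrow> 'a \<Rightarrow> real"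
  assumes f: "\<And>k. integrable M (f k)" "\<And>k. AE x in M. 0 \<le> f k x"
    and h[measurable]: "h \<in> borel_measurable M" and lim: "AE x in M. (\<lambda>k. f k x) \<longlonglongrightarrow> h x"
    and a: "\<And>k. (LINT x|M. f k x) \<le> a k" "a \<longlonglongrightarrow> l"
  shows "integrable M h" "(LINT x|M. h x) \<le> l"
proof -
  have fm[measurable]: "f k \<in> borel_measurable M" for k using f(1) by auto
  have a0: "0 \<le> a k" for k using order_trans[OF integral_nonneg_AE[OF f(2)] a(1)] .
  have l0: "0 \<le> l" using a(2) a0 by (intro LIMSEQ_le_const) auto
  have "AE x in M. \<forall>k. 0 \<le> f k x" using f(2) by (simp add: AE_all_countable)
  then have h0: "AE x in M. 0 \<le> h x"
    using lim by eventually_elim (auto intro: LIMSEQ_le_const)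
  have "(\<integral>\<^sup>+x. ennreal (h x) \<partial>M) = (\<integral>\<^sup>+x. liminf (\<lambda>k. ennreal (f k x)) \<partial>M)"
  proof (rule nn_integral_cong_AE)
    show "AE x in M. ennreal (h x) = liminf (\<lambda>k. ennreal (f k x))"
      using lim
    proof eventually_elim
      fix x assume "(\<lambda>k. f k x) \<longlonglongrightarrow> h x"
      then have "(\<lambda>k. ennreal (f k x)) \<longlonglongrightarrow> ennreal (h x)" by (rule tendsto_ennrealI)
      then show "ennreal (h x) = liminf (\<lambda>k. ennreal (f k x))"
        by (rule lim_imp_Liminf[symmetric, rotated]) simp
    qed
  qed
  also have "\<dots> \<le> liminf (\<lambda>k. \<integral>\<^sup>+x. ennreal (f k x) \<partial>M)"
    by (rule nn_integral_liminf) measurable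
  also have "\<dots> \<le> liminf (\<lambda>k. ennreal (a k))"
  proof (rule Liminf_mono, rule always_eventually, rule allI)
    fix k
    show "(\<integral>\<^sup>+x. ennreal (f k x) \<partial>M) \<le> ennreal (a k)"
      using nn_integral_eq_integral[OF f(1,2)[of k]] a(1)[of k] by (simp add: ennreal_leI)
  qed
  also have "\<dots> = ennreal l"
    by (rule lim_imp_Liminf) (use a(2) in \<open>auto intro: tendsto_ennrealI\<close>)
  finally have le: "(\<integral>\<^sup>+x. ennreal (h x) \<partial>M) \<le> ennreal l" .
  show i: "integrable M h"
    by (rule integrableI_nonneg[OF h h0]) (rule order_le_less_trans[OF le], simp)
  show "(LINT x|M. h x) \<le> l"
    using le nn_integral_eq_integral[OF i h0] l0 by (simp add: ennreal_le_iff)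
qed

lemma L2_imp_integrable:
  fixes f :: "'a::euclidean_space \<Rightarrow> 'b::euclidean_space"
  assumes \<Omega>: "bounded \<Omega>" "\<Omega> \<in> sets lebesgue" and f: "f \<in> L2 \<Omega>"
  shows "integrable (lebesgue_on \<Omega>) f"
    and "(LINT x|lebesgue_on \<Omega>. norm (f x)) \<le> measure lebesgue \<Omega> + (LINT x|lebesgue_on \<Omega>. (norm (f x))\<^sup>2)"
proof -
  interpret finite_measure "lebesgue_on \<Omega>" by (rule finite_measure_lebesgue_on[OF \<Omega>])
  have fm: "f \<in> borel_measurable (lebesgue_on \<Omega>)" and f2: "integrable (lebesgue_on \<Omega>) (\<lambda>x. (norm (f x))\<^sup>2)"
    using f by (auto simp: L2_def)
  have i: "integrable (lebesgue_on \<Omega>) (\<lambda>x. 1 + (norm (f x))\<^sup>2)" using f2 by auto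
  have le: "norm (f x) \<le> 1 + (norm (f x))\<^sup>2" for x
    using le_two_power_square_plus[of "norm (f x)" 0] by simp
  show fi: "integrable (lebesgue_on \<Omega>) f"
    by (rule Bochner_Integration.integrable_bound[OF i fm]) (use le in auto)
  have "(LINT x|lebesgue_on \<Omega>. norm (f x)) \<le> (LINT x|lebesgue_on \<Omega>. 1 + (norm (f x))\<^sup>2)"
    by (rule integral_mono[OF integrable_norm[OF fi] i le])
  also have "\<dots> = measure lebesgue \<Omega> + (LINT x|lebesgue_on \<Omega>. (norm (f x))\<^sup>2)"
    using f2 \<Omega>(2) by (simp add: measure_restrict_space)
  finally show "(LINT x|lebesgue_on \<Omega>. norm (f x)) \<le> measure lebesgue \<Omega> + (LINT x|lebesgue_on \<Omega>. (norm (f x))\<^sup>2)" .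
qed

lemma integrable_imp_L1_loc:
  fixes f :: "'a::euclidean_space \<Rightarrow> 'b::euclidean_space"
  assumes \<Omega>: "\<Omega> \<in> sets lebesgue" and f: "integrable (lebesgue_on \<Omega>) f"
  shows "f \<in> L1_loc \<Omega>"
  unfolding L1_loc_def
proof (intro CollectI allI impI)
  fix K assume K: "compact K \<and> K \<subseteq> \<Omega>"
  then have sp: "K \<inter> space lebesgue \<in> sets lebesgue" "\<Omega> \<inter> space lebesgue \<in> sets lebesgue"
    using compact_sets_lebesgue \<Omega> by auto
  have eq: "indicator K x *\<^sub>R f x = indicator K x *\<^sub>R (indicator \<Omega> x *\<^sub>R f x)" for x
    using K by (auto simp: indicator_def)
  have "K \<in> sets lebesgue" using sp(1) by simp
  then have "integrable lebesgue (\<lambda>x. indicator K x *\<^sub>R (indicator \<Omega> x *\<^sub>R f x))"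
    using f unfolding integrable_restrict_space[OF sp(2)] by (rule integrable_mult_indicator)
  then show "integrable (lebesgue_on K) f"
    unfolding integrable_restrict_space[OF sp(1)] eq[symmetric] .
qed

lemma has_weak_gradient_AE_cong:
  fixes f f' :: "'a::euclidean_space \<Rightarrow> real"
  assumes \<Omega>: "\<Omega> \<in> sets lebesgue" and f: "integrable (lebesgue_on \<Omega>) f" and g: "integrable (lebesgue_on \<Omega>) g"
    and ae: "AE x in lebesgue_on \<Omega>. f x = f' x" "AE x in lebesgue_on \<Omega>. g x = g' x"
    and fg: "has_weak_gradient \<Omega> f g"
  shows "has_weak_gradient \<Omega> f' g'"
proof -
  have f'm: "f' \<in> borel_measurable (lebesgue_on \<Omega>)" and g'm: "g' \<in> borel_measurable (lebesgue_on \<Omega>)"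
    using borel_measurable_AE_lebesgue_on[OF \<Omega> borel_measurable_integrable[OF f] ae(1)]
      borel_measurable_AE_lebesgue_on[OF \<Omega> borel_measurable_integrable[OF g] ae(2)] by auto
  have f': "integrable (lebesgue_on \<Omega>) f'"
    using f f'm ae(1) by (rule integrable_cong_AE_imp) 
  have g': "integrable (lebesgue_on \<Omega>) g'"
    using g g'm ae(2) by (rule integrable_cong_AE_imp)
  have "(LINT x|lebesgue_on \<Omega>. f' x * frechet_derivative \<phi> (at x) b) =
      - (LINT x|lebesgue_on \<Omega>. (g' x \<bullet> b) * \<phi> x)" if \<phi>: "\<phi> \<in> test_functions \<Omega>" and b: "b \<in> Basis" for \<phi> b
  proof -
    obtain C where C: "smooth \<phi>" using test_functionsE[OF \<phi>] by metis
    have [measurable]: "\<phi> \<in> borel_measurable (lebesgue_on \<Omega>)"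
      "(\<lambda>x. frechet_derivative \<phi> (at x) b) \<in> borel_measurable (lebesgue_on \<Omega>)"
      using smooth_continuous_on[OF C] smooth_continuous_on[OF smooth_derivative[OF C b]] \<Omega>
      by (auto intro: continuous_imp_measurable_on_sets_lebesgue)
    note f'm[measurable] g'm[measurable]
    have [measurable]: "f \<in> borel_measurable (lebesgue_on \<Omega>)" "g \<in> borel_measurable (lebesgue_on \<Omega>)"
      using f g by auto
    have "(LINT x|lebesgue_on \<Omega>. f' x * frechet_derivative \<phi> (at x) b) =
       (LINT x|lebesgue_on \<Omega>. f x * frechet_derivative \<phi> (at x) b)"
      by (rule integral_cong_AE) (use ae(1) in \<open>auto elim: eventually_mono\<close>)
    also have "\<dots> = - (LINT x|lebesgue_on \<Omega>. (g x \<bullet> b) * \<phi> x)"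
      using fg \<phi> b by (auto simp: has_weak_gradient_def)
    also have "(LINT x|lebesgue_on \<Omega>. (g x \<bullet> b) * \<phi> x) = (LINT x|lebesgue_on \<Omega>. (g' x \<bullet> b) * \<phi> x)"
      by (rule integral_cong_AE) (use ae(2) in \<open>auto elim: eventually_mono\<close>)
    finally show ?thesis .
  qed
  then show ?thesis
    using integrable_imp_L1_loc[OF \<Omega> f'] integrable_imp_L1_loc[OF \<Omega> g'] by (auto simp: has_weak_gradient_def)
qed

text \<open>
  Membership in \<open>H1\<close> provides some square-integrable weak gradient; by uniqueness
  the chosen one agrees with it almost everywhere.
\<close>

lemma H1_weak_gradient:
  fixes f :: "'a::euclidean_space \<Rightarrow> real"
  assumes \<Omega>: "open \<Omega>" "bounded \<Omega>" and f: "f \<in> H1 \<Omega>"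
  shows "has_weak_gradient \<Omega> f (weak_gradient \<Omega> f)" "weak_gradient \<Omega> f \<in> L2 \<Omega>"
proof -
  have \<Omega>m: "\<Omega> \<in> sets lebesgue" using \<Omega> by auto
  obtain g where g: "g \<in> L2 \<Omega>" "has_weak_gradient \<Omega> f g" using f by (auto simp: H1_def)
  show w: "has_weak_gradient \<Omega> f (weak_gradient \<Omega> f)"
    unfolding weak_gradient_def by (rule someI[of "has_weak_gradient \<Omega> f"]) (rule g(2))
  have ae: "AE x in lebesgue_on \<Omega>. g x = weak_gradient \<Omega> f x"
    by (rule weak_gradient_unique[OF \<Omega>(1) g(2) w])
  have gm: "g \<in> borel_measurable (lebesgue_on \<Omega>)" "integrable (lebesgue_on \<Omega>) (\<lambda>x. (norm (g x))\<^sup>2)"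
    using g(1) by (auto simp: L2_def)
  have wm[measurable]: "weak_gradient \<Omega> f \<in> borel_measurable (lebesgue_on \<Omega>)"
    using borel_measurable_AE_lebesgue_on[OF \<Omega>m gm(1) ae] .
  have "integrable (lebesgue_on \<Omega>) (\<lambda>x. (norm (weak_gradient \<Omega> f x))\<^sup>2)"
    by (rule integrable_cong_AE_imp[OF gm(2)]) (use ae in \<open>auto elim: eventually_mono\<close>)
  then show "weak_gradient \<Omega> f \<in> L2 \<Omega>" using wm by (simp add: L2_def)
qed

text \<open>
  The integral of \<open>\<phi> (x - t *\<^sub>R b)\<close> over \<open>x\<close> is constant in
  \<open>t\<close>, and its derivative at 0 is minus the integral in question. The constant
  function 1 is replaced by the indicator of a large ball in order to have an integrable factor.
\<close>

lemma integral_test_derivative_zero: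
  fixes \<phi> :: "'a::euclidean_space \<Rightarrow> real"
  assumes \<Omega>: "open \<Omega>" "bounded \<Omega>" and \<phi>: "\<phi> \<in> test_functions \<Omega>" and b: "b \<in> Basis"
  shows "(LINT x|lebesgue_on \<Omega>. frechet_derivative \<phi> (at x) b) = 0"
proof -
  obtain C where C: "smooth \<phi>" "compact C" "C \<subseteq> \<Omega>" "\<And>x. x \<notin> C \<Longrightarrow> \<phi> x = 0"
    using test_functionsE[OF \<phi>] by metis
  obtain R where R: "\<And>x. x \<in> \<Omega> \<Longrightarrow> norm x < R" using \<Omega>(2) bounded_pos_less by metis
  let ?U = "indicator (ball 0 (R + 1)) :: 'a \<Rightarrow> real"
  have Ui: "integrable lborel ?U"
    using emeasure_bounded_finite[of "ball (0::'a) (R + 1)"] by (intro integrable_real_indicator) auto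
  have [measurable]: "\<phi> \<in> borel_measurable borel"
    using smooth_continuous_on[OF C(1)] by (auto intro: borel_measurable_continuous_onI)
  have d: "DERIV (\<lambda>t. LINT x|lborel. ?U x * \<phi> (x - t *\<^sub>R b)) 0 :>
    - (LINT x|lborel. ?U x * frechet_derivative \<phi> (at x) b)"
    using translated_pairing_has_derivative[OF C(1,2,4) Ui, of b 0] by simp
  have const: "(LINT x|lborel. ?U x * \<phi> (x - t *\<^sub>R b)) = (LINT x|lborel. \<phi> x)" if t: "t \<in> {-1<..<1}" for t
  proof -
    have "?U x * \<phi> (x - t *\<^sub>R b) = \<phi> (x + - (t *\<^sub>R b))" for x
    proof (cases "x - t *\<^sub>R b \<in> C")
      case True
      then have "norm (x - t *\<^sub>R b) < R" using C(3) R by auto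
      moreover have "norm (t *\<^sub>R b) < 1" using t b by (auto simp: abs_if)
      ultimately have "norm x < R + 1" using norm_triangle_ineq[of "x - t *\<^sub>R b" "t *\<^sub>R b"] by simp
      then show ?thesis by (simp add: indicator_def)
    qed (simp add: C(4))
    then show ?thesis by (simp only:) (rule integral_lborel_translate, measurable)
  qed
  have "DERIV (\<lambda>t. LINT x|lborel. \<phi> x) 0 :> - (LINT x|lborel. ?U x * frechet_derivative \<phi> (at x) b)"
    by (rule has_field_derivative_transform_within_open[OF d, of "{-1<..<1}"]) (auto simp: const)
  then have z: "(LINT x|lborel. ?U x * frechet_derivative \<phi> (at x) b) = 0"
    using DERIV_unique[OF DERIV_const] by fastforce
  have off: "frechet_derivative \<phi> (at x) b = 0" if "x \<notin> C" for x
    using frechet_derivative_0_off_support[OF C(2,4) that] by simp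
  have eq: "?U x * frechet_derivative \<phi> (at x) b = frechet_derivative \<phi> (at x) b" for x
  proof (cases "x \<in> C")
    case True
    then have "norm x < R" using C(3) R by auto
    then show ?thesis by (simp add: indicator_def)
  qed (simp add: off)
  have "(LINT x|lebesgue_on \<Omega>. frechet_derivative \<phi> (at x) b) = (LINT x|lborel. frechet_derivative \<phi> (at x) b)"
  proof (rule integral_lebesgue_on_eq_lborel)
    show "(\<lambda>x. frechet_derivative \<phi> (at x) b) \<in> borel_measurable borel"
      using smooth_continuous_on[OF smooth_derivative[OF C(1) b]] by (auto intro: borel_measurable_continuous_onI)
    show "\<Omega> \<in> sets lebesgue" using \<Omega>(1) by auto
  qed (use off C(3) in blast)
  then show ?thesis using z unfolding eq by simp
qed

lemma const_in_H1:
  fixes \<Omega> :: "'a::euclidean_space set"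
  assumes \<Omega>: "open \<Omega>" "bounded \<Omega>"
  shows "(\<lambda>x. c) \<in> H1 \<Omega>"
proof -
  have \<Omega>m: "\<Omega> \<in> sets lebesgue" using \<Omega> by auto
  interpret finite_measure "lebesgue_on \<Omega>" by (rule finite_measure_lebesgue_on[OF \<Omega>(2) \<Omega>m])
  have "has_weak_gradient \<Omega> (\<lambda>x. c) (\<lambda>x. 0)"
    using integral_test_derivative_zero[OF \<Omega>]
    by (auto simp: has_weak_gradient_def intro!: integrable_imp_L1_loc[OF \<Omega>m])
  moreover have "(\<lambda>x. 0) \<in> (L2 \<Omega> :: ('a \<Rightarrow> 'a) set)" "(\<lambda>x. c) \<in> L2 \<Omega>" by (simp_all add: L2_def)
  ultimately show ?thesis unfolding H1_def by blast
qed

text \<open>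
  Representatives that are Borel measurable, have values in \<open>[0, 1]\<close> and vanish off
  \<open>\<Omega>\<close> reduce this to the \<open>L\<^sup>1\<close> statement, since
  \<open>s\<^sup>2 \<le> \<bar>s\<bar>\<close> for \<open>\<bar>s\<bar> \<le> 1\<close>.
\<close>

lemma L2_Cauchy_subsequence:
  fixes u :: "nat \<Rightarrow> 'a::euclidean_space \<Rightarrow> real" and g :: "nat \<Rightarrow> 'a \<Rightarrow> 'a"
  assumes \<Omega>: "open \<Omega>" "bounded \<Omega>"
    and um: "\<And>k. u k \<in> borel_measurable (lebesgue_on \<Omega>)"
    and u01: "\<And>k. AE x in lebesgue_on \<Omega>. 0 \<le> u k x \<and> u k x \<le> 1"
    and g: "\<And>k. has_weak_gradient \<Omega> (u k) (g k)" "\<And>k. g k \<in> L2 \<Omega>"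
    and M: "\<And>k. (LINT x|lebesgue_on \<Omega>. (norm (g k x))\<^sup>2) \<le> M"
  obtains r :: "nat \<Rightarrow> nat" where "strict_mono r"
    "\<And>e. e > 0 \<Longrightarrow> \<exists>N. \<forall>k\<ge>N. \<forall>l\<ge>N. (LINT x|lebesgue_on \<Omega>. (u (r k) x - u (r l) x)\<^sup>2) < e"
proof -
  have \<Omega>m: "\<Omega> \<in> sets lebesgue" and \<Omega>b[measurable]: "\<Omega> \<in> sets borel" using \<Omega> by auto
  have sp: "\<Omega> \<inter> space lebesgue \<in> sets lebesgue" using \<Omega>m by auto
  interpret finite_measure "lebesgue_on \<Omega>" by (rule finite_measure_lebesgue_on[OF \<Omega>(2) \<Omega>m])
  have gi: "integrable (lebesgue_on \<Omega>) (g k)"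
    and gM: "(LINT x|lebesgue_on \<Omega>. norm (g k x)) \<le> measure lebesgue \<Omega> + M" for k
    using L2_imp_integrable[OF \<Omega>(2) \<Omega>m g(2)[of k]] M[of k] by auto
  have ui: "integrable (lebesgue_on \<Omega>) (u k)" for k
    by (rule integrable_const_bound[OF _ um, of _ 1]) (use u01[of k] in \<open>auto elim: eventually_mono\<close>)
  have "\<exists>U. U \<in> borel_measurable borel \<and> (\<forall>x. \<bar>U x\<bar> \<le> 1) \<and> (\<forall>x. x \<notin> \<Omega> \<longrightarrow> U x = 0) \<and>
      (AE x in lebesgue_on \<Omega>. u k x = U x)" for k
  proof -
    have "(\<lambda>x. indicator \<Omega> x *\<^sub>R u k x) \<in> borel_measurable (completion lborel)"
      using um[of k] unfolding borel_measurable_restrict_space_iff[OF sp] .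
    from completion_ex_borel_measurable_real[OF this]
    obtain f' where f': "f' \<in> borel_measurable lborel" "AE x in lborel. indicator \<Omega> x *\<^sub>R u k x = f' x" by blast
    note [measurable] = f'(1)[unfolded measurable_lborel1]
    \<comment> \<open>The Borel representative may leave \<open>[0, 1]\<close> on a null set, hence the truncation.\<close>
    let ?U = "\<lambda>x. indicator \<Omega> x * max 0 (min 1 (f' x)) :: real"
    have "?U \<in> borel_measurable borel" by measurable
    moreover have "\<forall>x. \<bar>?U x\<bar> \<le> 1" by (auto simp: indicator_def)
    moreover have "AE x in lebesgue. indicator \<Omega> x *\<^sub>R u k x = f' x" using f'(2) by (rule AE_completion)
    then have "AE x in lebesgue_on \<Omega>. indicator \<Omega> x *\<^sub>R u k x = f' x"
      by (auto simp: AE_restrict_space_iff[OF sp])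
    then have "AE x in lebesgue_on \<Omega>. u k x = ?U x"
      using u01[of k] AE_space by eventually_elim auto
    ultimately show ?thesis by (intro exI[of _ ?U]) auto
  qed
  then obtain U where U: "\<And>k. U k \<in> borel_measurable borel" "\<And>k x. \<bar>U k x\<bar> \<le> 1" "\<And>k x. x \<notin> \<Omega> \<Longrightarrow> U k x = 0"
      "\<And>k. AE x in lebesgue_on \<Omega>. u k x = U k x" by metis
  note [measurable] = U(1) um
  have Ug: "has_weak_gradient \<Omega> (U k) (g k)" for k
    by (rule has_weak_gradient_AE_cong[OF \<Omega>m ui gi U(4) _ g(1)]) auto
  obtain r :: "nat \<Rightarrow> nat" where r: "strict_mono r"
    "\<And>e. e > 0 \<Longrightarrow> \<exists>N. \<forall>k\<ge>N. \<forall>l\<ge>N. (LINT x|lborel. \<bar>U (r k) x - U (r l) x\<bar>) < e"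
    by (rule L1_Cauchy_subsequence[where U = U and g = g, OF \<Omega> U(1) U(2) U(3) Ug gi gM])
       (assumption, rule that)
  have "(LINT x|lebesgue_on \<Omega>. (u k x - u l x)\<^sup>2) \<le> (LINT x|lborel. \<bar>U k x - U l x\<bar>)" for k l
  proof -
    have "(LINT x|lebesgue_on \<Omega>. (u k x - u l x)\<^sup>2) \<le> (LINT x|lebesgue_on \<Omega>. \<bar>u k x - u l x\<bar>)"
    proof (rule integral_mono_AE)
      show "integrable (lebesgue_on \<Omega>) (\<lambda>x. \<bar>u k x - u l x\<bar>)" using ui by auto
      have le: "AE x in lebesgue_on \<Omega>. (u k x - u l x)\<^sup>2 \<le> \<bar>u k x - u l x\<bar>"
        using u01[of k] u01[of l]
      proof eventually_elim
        fix x assume "0 \<le> u k x \<and> u k x \<le> 1" "0 \<le> u l x \<and> u l x \<le> 1"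
        then have "\<bar>u k x - u l x\<bar> \<le> 1" by auto
        then have "\<bar>u k x - u l x\<bar> * \<bar>u k x - u l x\<bar> \<le> 1 * \<bar>u k x - u l x\<bar>"
          by (intro mult_right_mono) auto
        then show "(u k x - u l x)\<^sup>2 \<le> \<bar>u k x - u l x\<bar>" by (simp add: power2_eq_square)
      qed
      then show "AE x in lebesgue_on \<Omega>. (u k x - u l x)\<^sup>2 \<le> \<bar>u k x - u l x\<bar>" .
      show "integrable (lebesgue_on \<Omega>) (\<lambda>x. (u k x - u l x)\<^sup>2)"
        by (rule Bochner_Integration.integrable_bound[of _ "\<lambda>x. \<bar>u k x - u l x\<bar>"])
           (use le ui in auto)
    qed
    also have "\<dots> = (LINT x|lebesgue_on \<Omega>. \<bar>U k x - U l x\<bar>)"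
    proof (rule integral_cong_AE)
      have [measurable]: "U k \<in> borel_measurable (lebesgue_on \<Omega>)" for k
        using borel_measurable_AE_lebesgue_on[OF \<Omega>m um U(4)] .
      show "(\<lambda>x. \<bar>U k x - U l x\<bar>) \<in> borel_measurable (lebesgue_on \<Omega>)" by measurable
      show "(\<lambda>x. \<bar>u k x - u l x\<bar>) \<in> borel_measurable (lebesgue_on \<Omega>)" by measurable
      show "AE x in lebesgue_on \<Omega>. \<bar>u k x - u l x\<bar> = \<bar>U k x - U l x\<bar>"
        using U(4)[of k] U(4)[of l] by eventually_elim simp
    qed
    also have "\<dots> = (LINT x|lborel. \<bar>U k x - U l x\<bar>)"
      by (rule integral_lebesgue_on_eq_lborel[OF _ \<Omega>m]) (auto simp: U(3))
    finally show ?thesis .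
  qed
  note le = this
  show thesis
  proof (rule that[OF r(1)])
    fix e :: real assume "e > 0"
    from r(2)[OF this] obtain N where "\<forall>k\<ge>N. \<forall>l\<ge>N. (LINT x|lborel. \<bar>U (r k) x - U (r l) x\<bar>) < e" ..
    then show "\<exists>N. \<forall>k\<ge>N. \<forall>l\<ge>N. (LINT x|lebesgue_on \<Omega>. (u (r k) x - u (r l) x)\<^sup>2) < e"
      using le order_le_less_trans by (intro exI[of _ N]) blast
  qed
qed

section \<open>Strong convexity of the energy density\<close>

lemma entropy_bounds:
  fixes s :: real
  assumes "0 \<le> s" "s \<le> 1"
  shows "0 \<le> s * ln s - s + 1" "s * ln s - s + 1 \<le> 1"
proof -
  show "0 \<le> s * ln s - s + 1"
  proof (cases "s = 0")
    case False
    then have "ln (1 / s) \<le> 1 / s - 1" using assms by (intro ln_le_minus_one) simp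
    then have "s * (1 - 1 / s) \<le> s * ln s" using assms False by (intro mult_left_mono) (auto simp: ln_div)
    then show ?thesis using False by (simp add: algebra_simps)
  qed simp
  have "s * ln s \<le> 0" using assms by (cases "s = 0") (auto intro: mult_nonneg_nonpos)
  then show "s * ln s - s + 1 \<le> 1" using assms by simp
qed

text \<open>
  From \<open>ln t \<le> t - 1\<close> at \<open>t = 1 / sqrt s\<close>. This gives the
  continuity of \<open>s * ln s\<close> at 0.
\<close>

lemma abs_mult_ln_le_sqrt:
  fixes s :: real
  assumes "0 \<le> s" "s \<le> 1" shows "\<bar>s * ln s\<bar> \<le> 2 * sqrt s"
proof (cases "s = 0")
  case False
  then have s: "s > 0" using assms by simp
  have "ln (1 / sqrt s) \<le> 1 / sqrt s - 1" using s by (intro ln_le_minus_one) simp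
  then have "- ln s \<le> 2 / sqrt s" using s by (simp add: ln_div ln_sqrt)
  then have "s * (- ln s) \<le> s * (2 / sqrt s)" using s by (intro mult_left_mono) auto
  also have "\<dots> = 2 * sqrt s" using s by (simp add: field_simps real_sqrt_mult_self flip: real_sqrt_mult)
  finally have "- (s * ln s) \<le> 2 * sqrt s" by simp
  moreover have "s * ln s \<le> 0" using s assms by (intro mult_nonneg_nonpos) auto
  ultimately show ?thesis by simp
qed simp

lemma tendsto_mult_ln:
  fixes X :: "nat \<Rightarrow> real"
  assumes X: "X \<longlonglongrightarrow> s" "\<And>k. 0 \<le> X k \<and> X k \<le> 1"
  shows "(\<lambda>k. X k * ln (X k)) \<longlonglongrightarrow> s * ln s"
proof (cases "s = 0")
  case False
  then show ?thesis by (intro tendsto_mult tendsto_ln X)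
next
  case True
  have "(\<lambda>k. 2 * sqrt (X k)) \<longlonglongrightarrow> 2 * sqrt s" by (intro tendsto_intros X)
  then have "(\<lambda>k. 2 * sqrt (X k)) \<longlonglongrightarrow> 0" using True by simp
  then have "(\<lambda>k. X k * ln (X k)) \<longlonglongrightarrow> 0"
    by (rule Lim_null_comparison[rotated]) (use abs_mult_ln_le_sqrt X(2) in auto)
  then show ?thesis using True by simp
qed

text \<open>
  Strong convexity of \<open>s * ln s\<close> on \<open>[0, 1]\<close>: it lies above its
  tangent at \<open>m\<close> with a quadratic gain. The inequality \<open>ln t \<le> t -
  1\<close> at \<open>t = sqrt (m / a)\<close> gives the gain \<open>(sqrt a - sqrt
  m)\<^sup>2\<close>, and \<open>sqrt a + sqrt m \<le> 2\<close>.
\<close>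

lemma entropy_tangent:
  fixes a m :: real
  assumes a: "0 \<le> a" "a \<le> 1" and m: "0 < m" "m \<le> 1"
  shows "m * ln m + (1 + ln m) * (a - m) + (a - m)\<^sup>2 / 4 \<le> a * ln a"
proof -
  have key: "a * ln m + a - m + (sqrt a - sqrt m)\<^sup>2 \<le> a * ln a"
  proof (cases "a = 0")
    case True
    then show ?thesis using m by simp
  next
    case False
    then have a0: "a > 0" using a by simp
    have "ln (sqrt m / sqrt a) \<le> sqrt m / sqrt a - 1" using m a0 by (intro ln_le_minus_one) simp
    then have "ln m - ln a \<le> 2 * (sqrt m / sqrt a) - 2" using m a0 by (simp add: ln_div ln_sqrt)
    then have "a * (ln m - ln a) \<le> a * (2 * (sqrt m / sqrt a) - 2)" using a0 by (intro mult_left_mono) auto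
    also have "\<dots> = 2 * (a / sqrt a) * sqrt m - 2 * a" by (simp add: algebra_simps)
    also have "a / sqrt a = sqrt a" using a0 by (simp add: real_div_sqrt)
    finally have "a * ln m - a * ln a \<le> 2 * sqrt a * sqrt m - 2 * a" by (simp add: algebra_simps)
    moreover have "(sqrt a - sqrt m)\<^sup>2 = a + m - 2 * sqrt a * sqrt m"
      using a0 m by (simp add: power2_diff)
    ultimately show ?thesis by simp
  qed
  have s1: "sqrt a \<le> 1" "sqrt m \<le> 1" using a m by auto
  have "(a - m)\<^sup>2 = ((sqrt a - sqrt m) * (sqrt a + sqrt m))\<^sup>2"
    using a m by (simp add: algebra_simps flip: power2_eq_square)
  also have "\<dots> = (sqrt a - sqrt m)\<^sup>2 * (sqrt a + sqrt m)\<^sup>2" by (rule power_mult_distrib)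
  also have "\<dots> \<le> (sqrt a - sqrt m)\<^sup>2 * 2\<^sup>2"
    using a m s1 by (intro mult_left_mono power_mono add_nonneg_nonneg real_sqrt_ge_zero; linarith?) simp
  finally have "(a - m)\<^sup>2 / 4 \<le> (sqrt a - sqrt m)\<^sup>2" by simp
  moreover have "m * ln m + (1 + ln m) * (a - m) = a * ln m + a - m" by (simp add: algebra_simps)
  ultimately show ?thesis using key by linarith
qed

text \<open>
  The sum of the tangent inequalities for \<open>a\<close> and \<open>b\<close> at their
  midpoint, in which the linear terms cancel.
\<close>

lemma entropy_midpoint:
  fixes a b :: real
  assumes a: "0 \<le> a" "a \<le> 1" and b: "0 \<le> b" "b \<le> 1"
  shows "((a + b) / 2) * ln ((a + b) / 2) + (a - b)\<^sup>2 / 16 \<le> (a * ln a + b * ln b) / 2"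
proof (cases "a + b = 0")
  case True
  then have "a = 0" "b = 0" using a b by auto
  then show ?thesis by simp
next
  case False
  define m where "m = (a + b) / 2"
  have m: "0 < m" "m \<le> 1" using False a b by (auto simp: m_def)
  have sq: "(a - m)\<^sup>2 = (a - b)\<^sup>2 / 4" "(b - m)\<^sup>2 = (a - b)\<^sup>2 / 4"
    by (simp_all add: m_def power2_eq_square field_simps)
  have lin: "(1 + ln m) * (a - m) + (1 + ln m) * (b - m) = 0"
    by (simp add: m_def flip: distrib_left) 
  show ?thesis
    using entropy_tangent[OF a m] entropy_tangent[OF b m] lin sq unfolding m_def[symmetric]
    by (simp add: field_simps)
qed

text \<open>
  The integrand of the energy with the gradient as an argument, so that any weak gradient can be
  inserted.
\<close>

definition energy_density ::
  "nat \<Rightarrow> real \<Rightarrow> real \<Rightarrow> (nat \<Rightarrow> 'a::euclidean_space \<Rightarrow> real) \<Rightarrow> ('a \<Rightarrow> 'a) \<Rightarrow> 'a \<Rightarrow> real" where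
  "energy_density n \<epsilon> \<beta> u g x = (\<Sum>i=0..n. u i x * ln (u i x) - u i x + 1)
     + \<epsilon> / 2 * (norm (g x))\<^sup>2 + \<beta> * u 0 x * (1 - u 0 x)"

lemma energy_density_ge:
  assumes u: "\<And>i. i \<le> n \<Longrightarrow> 0 \<le> u i x \<and> u i x \<le> 1" and "\<beta> \<ge> 0"
  shows "\<epsilon> / 2 * (norm (g x))\<^sup>2 \<le> energy_density n \<epsilon> \<beta> u g x"
    and "energy_density n \<epsilon> \<beta> u g x \<le> real (Suc n) + \<epsilon> / 2 * (norm (g x))\<^sup>2 + \<beta>"
proof -
  have 1: "0 \<le> (\<Sum>i=0..n. u i x * ln (u i x) - u i x + 1)"
    using u entropy_bounds(1) by (intro sum_nonneg) auto
  have "(\<Sum>i=0..n. u i x * ln (u i x) - u i x + 1) \<le> (\<Sum>i=0..n. 1)"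
    using u entropy_bounds(2) by (intro sum_mono) auto
  then have 2: "(\<Sum>i=0..n. u i x * ln (u i x) - u i x + 1) \<le> real (Suc n)" by simp
  have 3: "0 \<le> \<beta> * (u 0 x * (1 - u 0 x))" using u[of 0] assms(2) by (intro mult_nonneg_nonneg) auto
  have "\<beta> * (u 0 x * (1 - u 0 x)) \<le> \<beta> * (1 * 1)"
    using u[of 0] assms(2) by (intro mult_left_mono mult_mono) auto
  then have 4: "\<beta> * (u 0 x * (1 - u 0 x)) \<le> \<beta>" by simp
  show "\<epsilon> / 2 * (norm (g x))\<^sup>2 \<le> energy_density n \<epsilon> \<beta> u g x"
    unfolding energy_density_def mult.assoc[of \<beta>] using 1 3 by linarith
  show "energy_density n \<epsilon> \<beta> u g x \<le> real (Suc n) + \<epsilon> / 2 * (norm (g x))\<^sup>2 + \<beta>"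
    unfolding energy_density_def mult.assoc[of \<beta>] using 2 4 by linarith
qed

lemma parallelogram_halves:
  fixes p q :: "'a::real_inner"
  shows "(norm ((1 / 2) *\<^sub>R (p + q)))\<^sup>2 + (norm (p - q))\<^sup>2 / 4 = ((norm p)\<^sup>2 + (norm q)\<^sup>2) / 2"
  unfolding power2_norm_eq_inner by (simp add: inner_simps inner_commute add_divide_distrib diff_divide_distrib)

lemma logistic_midpoint:
  fixes a b \<beta> :: real
  shows "\<beta> * ((a + b) / 2) * (1 - (a + b) / 2) = (\<beta> * a * (1 - a) + \<beta> * b * (1 - b)) / 2 + \<beta> / 4 * (a - b)\<^sup>2"
  by (simp add: power2_eq_square field_simps)

lemma combine_midpoint_bounds:
  fixes s c b1 b2 r q d s1 g1 s2 g2 :: real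
  assumes "s + q \<le> (s1 + s2) / 2" "c + d = (g1 + g2) / 2"
  shows "(s + c + ((b1 + b2) / 2 + r)) + q + d \<le> ((s1 + g1 + b1) + (s2 + g2 + b2)) / 2 + r"
  using assms by (simp add: field_simps)

text \<open>
  The entropies and the gradient term gain a quadratic amount at the midpoint. The concave term
  loses exactly \<open>\<beta> / 4 * (u 0 x - v 0 x)\<^sup>2\<close>; this loss involves only
  \<open>u 0\<close> and \<open>v 0\<close>, the components for which compactness is available.
\<close>

lemma energy_density_midpoint:
  assumes u: "\<And>i. i \<le> n \<Longrightarrow> 0 \<le> u i x \<and> u i x \<le> 1" and v: "\<And>i. i \<le> n \<Longrightarrow> 0 \<le> v i x \<and> v i x \<le> 1"
  shows "energy_density n \<epsilon> \<beta> (\<lambda>i x. (u i x + v i x) / 2) (\<lambda>x. (1 / 2) *\<^sub>R (g x + h x)) x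
     + (\<Sum>i=0..n. (u i x - v i x)\<^sup>2) / 16 + \<epsilon> / 8 * (norm (g x - h x))\<^sup>2
    \<le> (energy_density n \<epsilon> \<beta> u g x + energy_density n \<epsilon> \<beta> v h x) / 2 + \<beta> / 4 * (u 0 x - v 0 x)\<^sup>2"
proof -
  have "(\<Sum>i=0..n. ((u i x + v i x) / 2 * ln ((u i x + v i x) / 2) - (u i x + v i x) / 2 + 1) + (u i x - v i x)\<^sup>2 / 16)
     \<le> (\<Sum>i=0..n. ((u i x * ln (u i x) - u i x + 1) + (v i x * ln (v i x) - v i x + 1)) / 2)"
  proof (rule sum_mono)
    fix i assume "i \<in> {0..n}"
    then show "((u i x + v i x) / 2 * ln ((u i x + v i x) / 2) - (u i x + v i x) / 2 + 1) + (u i x - v i x)\<^sup>2 / 16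
       \<le> ((u i x * ln (u i x) - u i x + 1) + (v i x * ln (v i x) - v i x + 1)) / 2"
      using entropy_midpoint[of "u i x" "v i x"] u[of i] v[of i] by (simp add: field_simps)
  qed
  then have S: "(\<Sum>i=0..n. (u i x + v i x) / 2 * ln ((u i x + v i x) / 2) - (u i x + v i x) / 2 + 1)
      + (\<Sum>i=0..n. (u i x - v i x)\<^sup>2) / 16
     \<le> ((\<Sum>i=0..n. u i x * ln (u i x) - u i x + 1) + (\<Sum>i=0..n. v i x * ln (v i x) - v i x + 1)) / 2"
    by (simp only: sum.distrib sum_divide_distrib[symmetric])
  have P: "(norm ((1 / 2) *\<^sub>R (g x + h x)))\<^sup>2 + (norm (g x - h x))\<^sup>2 / 4 = ((norm (g x))\<^sup>2 + (norm (h x))\<^sup>2) / 2"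
    using parallelogram_halves .
  have "\<epsilon> / 2 * (norm ((1 / 2) *\<^sub>R (g x + h x)))\<^sup>2 + \<epsilon> / 8 * (norm (g x - h x))\<^sup>2
      = \<epsilon> / 2 * ((norm ((1 / 2) *\<^sub>R (g x + h x)))\<^sup>2 + (norm (g x - h x))\<^sup>2 / 4)"
    by (simp add: distrib_left)
  then have G: "\<epsilon> / 2 * (norm ((1 / 2) *\<^sub>R (g x + h x)))\<^sup>2 + \<epsilon> / 8 * (norm (g x - h x))\<^sup>2
      = (\<epsilon> / 2 * (norm (g x))\<^sup>2 + \<epsilon> / 2 * (norm (h x))\<^sup>2) / 2"
    unfolding P by (simp add: distrib_left)
  have B: "\<beta> * ((u 0 x + v 0 x) / 2) * (1 - (u 0 x + v 0 x) / 2)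
     = (\<beta> * u 0 x * (1 - u 0 x) + \<beta> * v 0 x * (1 - v 0 x)) / 2 + \<beta> / 4 * (u 0 x - v 0 x)\<^sup>2"
    by (rule logistic_midpoint)
  show ?thesis
    unfolding energy_density_def B by (rule combine_midpoint_bounds[OF S G])
qed

lemma admissibleD:
  assumes "u \<in> admissible n \<Omega> m"
  shows "i \<le> n \<Longrightarrow> u i \<in> borel_measurable (lebesgue_on \<Omega>)"
    and "AE x in lebesgue_on \<Omega>. \<forall>i\<le>n. 0 \<le> u i x \<and> u i x \<le> 1"
    and "AE x in lebesgue_on \<Omega>. (\<Sum>j=0..n. u j x) = 1"
    and "i \<le> n \<Longrightarrow> (LINT x|lebesgue_on \<Omega>. u i x) = m i"
    and "u 0 \<in> H1 \<Omega>"
proof -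
  show "i \<le> n \<Longrightarrow> u i \<in> borel_measurable (lebesgue_on \<Omega>)" "i \<le> n \<Longrightarrow> (LINT x|lebesgue_on \<Omega>. u i x) = m i"
    "u 0 \<in> H1 \<Omega>"
    using assms by (auto simp: admissible_def Linf_def)
  show s: "AE x in lebesgue_on \<Omega>. (\<Sum>j=0..n. u j x) = 1" using assms by (auto simp: admissible_def)
  have "AE x in lebesgue_on \<Omega>. \<forall>i\<in>{..n}. 0 \<le> u i x"
    using assms by (intro AE_finite_allI) (auto simp: admissible_def)
  then show "AE x in lebesgue_on \<Omega>. \<forall>i\<le>n. 0 \<le> u i x \<and> u i x \<le> 1"
    using s
  proof eventually_elim
    fix x assume p: "\<forall>i\<in>{..n}. 0 \<le> u i x" and s: "(\<Sum>j=0..n. u j x) = 1"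
    have "u i x \<le> 1" if "i \<le> n" for i
      using member_le_sum[of i "{0..n}" "\<lambda>j. u j x"] p s that by auto
    with p show "\<forall>i\<le>n. 0 \<le> u i x \<and> u i x \<le> 1" by auto
  qed
qed

lemma admissibleI:
  assumes \<Omega>: "open \<Omega>" "bounded \<Omega>"
    and um: "\<And>i. i \<le> n \<Longrightarrow> u i \<in> borel_measurable (lebesgue_on \<Omega>)"
    and u01: "AE x in lebesgue_on \<Omega>. \<forall>i\<le>n. 0 \<le> u i x \<and> u i x \<le> 1"
    and "AE x in lebesgue_on \<Omega>. (\<Sum>j=0..n. u j x) = 1"
    and "\<And>i. i \<le> n \<Longrightarrow> (LINT x|lebesgue_on \<Omega>. u i x) = m i"
    and g: "g \<in> L2 \<Omega>" "has_weak_gradient \<Omega> (u 0) g"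
  shows "u \<in> admissible n \<Omega> m"
proof -
  have \<Omega>m: "\<Omega> \<in> sets lebesgue" using \<Omega> by auto
  interpret finite_measure "lebesgue_on \<Omega>" by (rule finite_measure_lebesgue_on[OF \<Omega>(2) \<Omega>m])
  have "AE x in lebesgue_on \<Omega>. norm ((norm (u 0 x))\<^sup>2) \<le> 1"
    using u01 by eventually_elim (auto simp: power_le_one)
  then have "integrable (lebesgue_on \<Omega>) (\<lambda>x. (norm (u 0 x))\<^sup>2)"
    by (rule integrable_const_bound) (use um[of 0] in measurable)
  then have "u 0 \<in> L2 \<Omega>" using um[of 0] by (simp add: L2_def)
  then have "u 0 \<in> H1 \<Omega>" using g by (auto simp: H1_def)
  moreover have "AE x in lebesgue_on \<Omega>. \<bar>u i x\<bar> \<le> 1" "AE x in lebesgue_on \<Omega>. 0 \<le> u i x" if "i \<le> n" for i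
    using u01 that by (auto elim!: eventually_mono)
  ultimately show ?thesis
    using assms by (auto simp: admissible_def Linf_def)
qed

lemma energy_density_measurable:
  assumes "\<And>i. i \<le> n \<Longrightarrow> u i \<in> borel_measurable M" "g \<in> borel_measurable M"
  shows "energy_density n \<epsilon> \<beta> u g \<in> borel_measurable M"
proof -
  note [measurable] = assms(2) assms(1)[of 0, simplified]
  have "(\<lambda>x. \<Sum>i=0..n. u i x * ln (u i x) - u i x + 1) \<in> borel_measurable M"
  proof (rule borel_measurable_sum)
    fix i assume "i \<in> {0..n}"
    then have [measurable]: "u i \<in> borel_measurable M" using assms(1) by auto
    show "(\<lambda>x. u i x * ln (u i x) - u i x + 1) \<in> borel_measurable M" by measurable
  qed
  note [measurable] = this
  show ?thesis unfolding energy_density_def[abs_def] by measurable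
qed

lemma energy_density_integrable:
  assumes \<Omega>: "open \<Omega>" "bounded \<Omega>" and \<epsilon>: "\<epsilon> > 0" "\<beta> > 0"
    and um: "\<And>i. i \<le> n \<Longrightarrow> u i \<in> borel_measurable (lebesgue_on \<Omega>)"
    and u01: "AE x in lebesgue_on \<Omega>. \<forall>i\<le>n. 0 \<le> u i x \<and> u i x \<le> 1" and g: "g \<in> L2 \<Omega>"
  shows "integrable (lebesgue_on \<Omega>) (energy_density n \<epsilon> \<beta> u g)"
proof -
  have \<Omega>m: "\<Omega> \<in> sets lebesgue" using \<Omega> by auto
  interpret finite_measure "lebesgue_on \<Omega>" by (rule finite_measure_lebesgue_on[OF \<Omega>(2) \<Omega>m])
  have g2: "g \<in> borel_measurable (lebesgue_on \<Omega>)" "integrable (lebesgue_on \<Omega>) (\<lambda>x. (norm (g x))\<^sup>2)"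
    using g by (auto simp: L2_def)
  show ?thesis
  proof (rule Bochner_Integration.integrable_bound)
    show "integrable (lebesgue_on \<Omega>) (\<lambda>x. real (Suc n) + \<epsilon> / 2 * (norm (g x))\<^sup>2 + \<beta>)"
      using g2 by auto
    show "energy_density n \<epsilon> \<beta> u g \<in> borel_measurable (lebesgue_on \<Omega>)"
      by (rule energy_density_measurable[OF um g2(1)])
    show "AE x in lebesgue_on \<Omega>. norm (energy_density n \<epsilon> \<beta> u g x)
        \<le> norm (real (Suc n) + \<epsilon> / 2 * (norm (g x))\<^sup>2 + \<beta>)"
      using u01
    proof eventually_elim
      fix x assume a: "\<forall>i\<le>n. 0 \<le> u i x \<and> u i x \<le> 1"
      have "0 \<le> \<epsilon> / 2 * (norm (g x))\<^sup>2" using \<epsilon> by simp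
      then show "norm (energy_density n \<epsilon> \<beta> u g x) \<le> norm (real (Suc n) + \<epsilon> / 2 * (norm (g x))\<^sup>2 + \<beta>)"
        using energy_density_ge[of n u x \<beta> \<epsilon> g, OF a[rule_format]] \<epsilon>(2)
        unfolding real_norm_def by linarith
    qed
  qed
qed

lemma energy_eq:
  assumes \<Omega>: "open \<Omega>" "bounded \<Omega>" and um: "\<And>i. i \<le> n \<Longrightarrow> u i \<in> borel_measurable (lebesgue_on \<Omega>)"
    and u0: "u 0 \<in> H1 \<Omega>" and g: "g \<in> L2 \<Omega>" "has_weak_gradient \<Omega> (u 0) g"
  shows "energy n \<Omega> \<epsilon> \<beta> u = (LINT x|lebesgue_on \<Omega>. energy_density n \<epsilon> \<beta> u g x)"
proof -
  note w = H1_weak_gradient[OF \<Omega> u0]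
  have "energy n \<Omega> \<epsilon> \<beta> u = (LINT x|lebesgue_on \<Omega>. energy_density n \<epsilon> \<beta> u (weak_gradient \<Omega> (u 0)) x)"
    by (simp add: energy_def energy_density_def)
  also have "\<dots> = (LINT x|lebesgue_on \<Omega>. energy_density n \<epsilon> \<beta> u g x)"
  proof (rule integral_cong_AE)
    show "energy_density n \<epsilon> \<beta> u (weak_gradient \<Omega> (u 0)) \<in> borel_measurable (lebesgue_on \<Omega>)"
      "energy_density n \<epsilon> \<beta> u g \<in> borel_measurable (lebesgue_on \<Omega>)"
      using w(2) g(1) by (auto intro!: energy_density_measurable um simp: L2_def)
    show "AE x in lebesgue_on \<Omega>. energy_density n \<epsilon> \<beta> u (weak_gradient \<Omega> (u 0)) x = energy_density n \<epsilon> \<beta> u g x"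
      using weak_gradient_unique[OF \<Omega>(1) w(1) g(2)]
      by eventually_elim (simp add: energy_density_def)
  qed
  finally show ?thesis .
qed

lemma L2_add:
  fixes g h :: "'a::euclidean_space \<Rightarrow> 'b::euclidean_space"
  assumes g: "g \<in> L2 \<Omega>" and h: "h \<in> L2 \<Omega>"
  shows "(\<lambda>x. g x + h x) \<in> L2 \<Omega>"
proof -
  have [measurable]: "g \<in> borel_measurable (lebesgue_on \<Omega>)" "h \<in> borel_measurable (lebesgue_on \<Omega>)"
    using g h by (auto simp: L2_def)
  have "integrable (lebesgue_on \<Omega>) (\<lambda>x. (norm (g x + h x))\<^sup>2)"
  proof (rule Bochner_Integration.integrable_bound)
    show "integrable (lebesgue_on \<Omega>) (\<lambda>x. 2 * (norm (g x))\<^sup>2 + 2 * (norm (h x))\<^sup>2)"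
      using g h by (auto simp: L2_def)
    have "(norm (g x + h x))\<^sup>2 \<le> 2 * (norm (g x))\<^sup>2 + 2 * (norm (h x))\<^sup>2" for x
    proof -
      have "0 \<le> (norm (g x - h x))\<^sup>2" by simp
      then show ?thesis unfolding power2_norm_eq_inner by (simp add: inner_simps inner_commute)
    qed
    then show "AE x in lebesgue_on \<Omega>. norm ((norm (g x + h x))\<^sup>2) \<le> norm (2 * (norm (g x))\<^sup>2 + 2 * (norm (h x))\<^sup>2)"
      by (intro AE_I2) auto
  qed measurable
  then show ?thesis by (simp add: L2_def)
qed

lemma L2_scaleR: "g \<in> L2 \<Omega> \<Longrightarrow> (\<lambda>x. c *\<^sub>R g x) \<in> L2 \<Omega>"
  for g :: "'a::euclidean_space \<Rightarrow> 'b::euclidean_space"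
  by (auto simp: L2_def power_mult_distrib)

lemma L2_diff:
  fixes g h :: "'a::euclidean_space \<Rightarrow> 'b::euclidean_space"
  assumes "g \<in> L2 \<Omega>" "h \<in> L2 \<Omega>"
  shows "(\<lambda>x. g x - h x) \<in> L2 \<Omega>"
  using L2_add[OF assms(1) L2_scaleR[OF assms(2), of "-1"]] by simp

lemma has_weak_gradient_midpoint:
  fixes f f' :: "'a::euclidean_space \<Rightarrow> real"
  assumes \<Omega>: "open \<Omega>" and f: "has_weak_gradient \<Omega> f g" "has_weak_gradient \<Omega> f' g'"
  shows "has_weak_gradient \<Omega> (\<lambda>x. (f x + f' x) / 2) (\<lambda>x. (1 / 2) *\<^sub>R (g x + g' x))"
  unfolding has_weak_gradient_def
proof (intro conjI ballI)
  have \<Omega>m: "\<Omega> \<in> sets lebesgue" using \<Omega> by auto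
  have l: "f \<in> L1_loc \<Omega>" "f' \<in> L1_loc \<Omega>" "g \<in> L1_loc \<Omega>" "g' \<in> L1_loc \<Omega>"
    using f by (auto simp: has_weak_gradient_def)
  then show "(\<lambda>x. (f x + f' x) / 2) \<in> L1_loc \<Omega>" "(\<lambda>x. (1 / 2) *\<^sub>R (g x + g' x)) \<in> L1_loc \<Omega>"
    by (auto simp: L1_loc_def)
  fix \<phi> and b :: 'a assume \<phi>: "\<phi> \<in> test_functions \<Omega>" and b: "b \<in> Basis"
  obtain C where C: "smooth \<phi>" "compact C" "C \<subseteq> \<Omega>" "\<And>x. x \<notin> C \<Longrightarrow> \<phi> x = 0"
    using test_functionsE[OF \<phi>] by metis
  have off: "frechet_derivative \<phi> (at x) b = 0" if "x \<notin> C" for x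
    using frechet_derivative_0_off_support[OF C(2,4) that] by simp
  note c = smooth_continuous_on[OF C(1)] smooth_continuous_on[OF smooth_derivative[OF C(1) b]]
  have fi: "integrable (lebesgue_on \<Omega>) (\<lambda>x. F x * frechet_derivative \<phi> (at x) b)" if "F \<in> L1_loc \<Omega>" for F
    using integral_cutoff(2)[OF that \<Omega>m C(2,3) c(2) off] by (simp add: mult.commute)
  have gi: "integrable (lebesgue_on \<Omega>) (\<lambda>x. (G x \<bullet> b) * \<phi> x)" if "G \<in> L1_loc \<Omega>" for G :: "'a \<Rightarrow> 'a"
    using integrable_inner_left[OF integral_cutoff(2)[OF that \<Omega>m C(2,3) c(1) C(4)], of b]
    by (simp add: mult.commute)
  have "(LINT x|lebesgue_on \<Omega>. (f x + f' x) / 2 * frechet_derivative \<phi> (at x) b) =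
    (LINT x|lebesgue_on \<Omega>. (f x * frechet_derivative \<phi> (at x) b + f' x * frechet_derivative \<phi> (at x) b) / 2)"
    by (simp add: algebra_simps)
  also have "\<dots> = ((LINT x|lebesgue_on \<Omega>. f x * frechet_derivative \<phi> (at x) b) +
      (LINT x|lebesgue_on \<Omega>. f' x * frechet_derivative \<phi> (at x) b)) / 2"
    using fi l by simp
  also have "\<dots> = (- (LINT x|lebesgue_on \<Omega>. (g x \<bullet> b) * \<phi> x) + - (LINT x|lebesgue_on \<Omega>. (g' x \<bullet> b) * \<phi> x)) / 2"
    using f \<phi> b by (simp add: has_weak_gradient_def)
  also have "\<dots> = - (LINT x|lebesgue_on \<Omega>. ((g x \<bullet> b) * \<phi> x + (g' x \<bullet> b) * \<phi> x) / 2)"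
    using gi[OF l(3)] gi[OF l(4)] by (simp add: add_divide_distrib)
  also have "\<dots> = - (LINT x|lebesgue_on \<Omega>. ((1 / 2) *\<^sub>R (g x + g' x) \<bullet> b) * \<phi> x)"
    by (simp add: distrib_right inner_add_left)
  finally show "(LINT x|lebesgue_on \<Omega>. (f x + f' x) / 2 * frechet_derivative \<phi> (at x) b) =
    - (LINT x|lebesgue_on \<Omega>. ((1 / 2) *\<^sub>R (g x + g' x) \<bullet> b) * \<phi> x)" .
qed

section \<open>Existence of a minimizer\<close>

lemma square_diff_integrable:
  fixes u v :: "nat \<Rightarrow> 'a::euclidean_space \<Rightarrow> real"
  assumes \<Omega>: "open \<Omega>" "bounded \<Omega>" and u: "u \<in> admissible n \<Omega> m" and v: "v \<in> admissible n \<Omega> m" and i: "i \<le> n"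
  shows "integrable (lebesgue_on \<Omega>) (\<lambda>x. (u i x - v i x)\<^sup>2)"
proof -
  have \<Omega>m: "\<Omega> \<in> sets lebesgue" using \<Omega> by auto
  interpret finite_measure "lebesgue_on \<Omega>" by (rule finite_measure_lebesgue_on[OF \<Omega>(2) \<Omega>m])
  note [measurable] = admissibleD(1)[OF u i] admissibleD(1)[OF v i]
  have "AE x in lebesgue_on \<Omega>. norm ((u i x - v i x)\<^sup>2) \<le> 1"
    using admissibleD(2)[OF u] admissibleD(2)[OF v]
  proof eventually_elim
    fix x assume "\<forall>i\<le>n. 0 \<le> u i x \<and> u i x \<le> 1" "\<forall>i\<le>n. 0 \<le> v i x \<and> v i x \<le> 1"
    then have "0 \<le> u i x \<and> u i x \<le> 1" "0 \<le> v i x \<and> v i x \<le> 1" using i by auto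
    then have "\<bar>u i x - v i x\<bar> \<le> 1" by auto
    then show "norm ((u i x - v i x)\<^sup>2) \<le> 1" by (simp add: abs_square_le_1)
  qed
  then show ?thesis by (rule integrable_const_bound) measurable
qed

text \<open>
  All other terms of the density are nonnegative. Besides the gradient bound for minimizing
  sequences, this shows that the energy is nonnegative.
\<close>

lemma energy_gradient_bound:
  assumes \<Omega>: "open \<Omega>" "bounded \<Omega>" and \<epsilon>: "\<epsilon> > 0" "\<beta> > 0" and u: "u \<in> admissible n \<Omega> m"
    and g: "g \<in> L2 \<Omega>" "has_weak_gradient \<Omega> (u 0) g"
  shows "\<epsilon> / 2 * (LINT x|lebesgue_on \<Omega>. (norm (g x))\<^sup>2) \<le> energy n \<Omega> \<epsilon> \<beta> u"
proof -
  have g2: "integrable (lebesgue_on \<Omega>) (\<lambda>x. (norm (g x))\<^sup>2)" using g by (auto simp: L2_def)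
  have "(LINT x|lebesgue_on \<Omega>. \<epsilon> / 2 * (norm (g x))\<^sup>2) \<le> (LINT x|lebesgue_on \<Omega>. energy_density n \<epsilon> \<beta> u g x)"
  proof (rule integral_mono_AE)
    show "integrable (lebesgue_on \<Omega>) (\<lambda>x. energy_density n \<epsilon> \<beta> u g x)"
      by (rule energy_density_integrable[OF \<Omega> \<epsilon> admissibleD(1,2)[OF u] g(1)])
    show "AE x in lebesgue_on \<Omega>. \<epsilon> / 2 * (norm (g x))\<^sup>2 \<le> energy_density n \<epsilon> \<beta> u g x"
      using admissibleD(2)[OF u]
    proof eventually_elim
      fix x assume a: "\<forall>i\<le>n. 0 \<le> u i x \<and> u i x \<le> 1"
      show "\<epsilon> / 2 * (norm (g x))\<^sup>2 \<le> energy_density n \<epsilon> \<beta> u g x"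
        by (rule energy_density_ge(1)) (use a \<epsilon> in auto)
    qed
  qed (use g2 in auto)
  then show ?thesis
    using energy_eq[where u = u, OF \<Omega> admissibleD(1)[OF u] admissibleD(5)[OF u] g] by simp
qed

lemma midpoint_admissible:
  fixes u v :: "nat \<Rightarrow> 'a::euclidean_space \<Rightarrow> real"
  assumes \<Omega>: "open \<Omega>" "bounded \<Omega>" and u: "u \<in> admissible n \<Omega> m" and v: "v \<in> admissible n \<Omega> m"
    and g: "g \<in> L2 \<Omega>" "has_weak_gradient \<Omega> (u 0) g" and h: "h \<in> L2 \<Omega>" "has_weak_gradient \<Omega> (v 0) h"
  shows "(\<lambda>i x. (u i x + v i x) / 2) \<in> admissible n \<Omega> m"
proof (rule admissibleI[OF \<Omega>, where g = "\<lambda>x. (1 / 2) *\<^sub>R (g x + h x)"])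
  have \<Omega>m: "\<Omega> \<in> sets lebesgue" using \<Omega> by auto
  interpret finite_measure "lebesgue_on \<Omega>" by (rule finite_measure_lebesgue_on[OF \<Omega>(2) \<Omega>m])
  show "(\<lambda>x. (u i x + v i x) / 2) \<in> borel_measurable (lebesgue_on \<Omega>)" if "i \<le> n" for i
    using admissibleD(1)[OF u that] admissibleD(1)[OF v that] by measurable
  show "AE x in lebesgue_on \<Omega>. \<forall>i\<le>n. 0 \<le> (u i x + v i x) / 2 \<and> (u i x + v i x) / 2 \<le> 1"
    using admissibleD(2)[OF u] admissibleD(2)[OF v] by eventually_elim force
  show "AE x in lebesgue_on \<Omega>. (\<Sum>j=0..n. (u j x + v j x) / 2) = 1"
    using admissibleD(3)[OF u] admissibleD(3)[OF v]
    by eventually_elim (simp add: sum.distrib flip: sum_divide_distrib)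
  show "(LINT x|lebesgue_on \<Omega>. (u i x + v i x) / 2) = m i" if i: "i \<le> n" for i
  proof -
    have "integrable (lebesgue_on \<Omega>) (w i)" if w: "w \<in> admissible n \<Omega> m" for w
      by (rule integrable_const_bound[OF _ admissibleD(1)[OF w i], of 1])
        (use admissibleD(2)[OF w] i in \<open>auto elim!: eventually_mono\<close>)
    then show ?thesis using u v admissibleD(4)[OF u i] admissibleD(4)[OF v i] by simp
  qed
  show "(\<lambda>x. (1 / 2) *\<^sub>R (g x + h x)) \<in> L2 \<Omega>" by (intro L2_scaleR L2_add g h)
  show "has_weak_gradient \<Omega> (\<lambda>x. (u 0 x + v 0 x) / 2) (\<lambda>x. (1 / 2) *\<^sub>R (g x + h x))"
    by (rule has_weak_gradient_midpoint[OF \<Omega>(1) g(2) h(2)])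
qed

lemma energy_midpoint:
  fixes u v :: "nat \<Rightarrow> 'a::euclidean_space \<Rightarrow> real"
  assumes \<Omega>: "open \<Omega>" "bounded \<Omega>" and \<epsilon>: "\<epsilon> > 0" "\<beta> > 0"
    and u: "u \<in> admissible n \<Omega> m" and v: "v \<in> admissible n \<Omega> m"
    and g: "g \<in> L2 \<Omega>" "has_weak_gradient \<Omega> (u 0) g" and h: "h \<in> L2 \<Omega>" "has_weak_gradient \<Omega> (v 0) h"
  shows "energy n \<Omega> \<epsilon> \<beta> (\<lambda>i x. (u i x + v i x) / 2)
      + (\<Sum>i=0..n. LINT x|lebesgue_on \<Omega>. (u i x - v i x)\<^sup>2) / 16
      + \<epsilon> / 8 * (LINT x|lebesgue_on \<Omega>. (norm (g x - h x))\<^sup>2)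
    \<le> (energy n \<Omega> \<epsilon> \<beta> u + energy n \<Omega> \<epsilon> \<beta> v) / 2 + \<beta> / 4 * (LINT x|lebesgue_on \<Omega>. (u 0 x - v 0 x)\<^sup>2)"
proof -
  let ?w = "\<lambda>i x. (u i x + v i x) / 2" and ?k = "\<lambda>x. (1 / 2) *\<^sub>R (g x + h x)"
  have w: "?w \<in> admissible n \<Omega> m" by (rule midpoint_admissible[OF \<Omega> u v g h])
  have k: "?k \<in> L2 \<Omega>" by (intro L2_scaleR L2_add g h)
  have kw: "has_weak_gradient \<Omega> (?w 0) ?k" by (rule has_weak_gradient_midpoint[OF \<Omega>(1) g(2) h(2)])
  note iw = energy_density_integrable[OF \<Omega> \<epsilon> admissibleD(1,2)[OF w] k]
  note iu = energy_density_integrable[OF \<Omega> \<epsilon> admissibleD(1,2)[OF u] g(1)]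
  note iv = energy_density_integrable[OF \<Omega> \<epsilon> admissibleD(1,2)[OF v] h(1)]
  have sq: "integrable (lebesgue_on \<Omega>) (\<lambda>x. (u i x - v i x)\<^sup>2)" if "i \<le> n" for i
    by (rule square_diff_integrable[OF \<Omega> u v that])
  have sq': "integrable (lebesgue_on \<Omega>) (\<lambda>x. \<Sum>i=0..n. (u i x - v i x)\<^sup>2)"
    by (intro Bochner_Integration.integrable_sum sq) auto
  have ig: "integrable (lebesgue_on \<Omega>) (\<lambda>x. (norm (g x - h x))\<^sup>2)"
    using L2_diff[OF g(1) h(1)] by (auto simp: L2_def)
  have "(LINT x|lebesgue_on \<Omega>. energy_density n \<epsilon> \<beta> ?w ?k x
     + (\<Sum>i=0..n. (u i x - v i x)\<^sup>2) / 16 + \<epsilon> / 8 * (norm (g x - h x))\<^sup>2)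
    \<le> (LINT x|lebesgue_on \<Omega>. (energy_density n \<epsilon> \<beta> u g x + energy_density n \<epsilon> \<beta> v h x) / 2 + \<beta> / 4 * (u 0 x - v 0 x)\<^sup>2)"
  proof (rule integral_mono_AE)
    show "AE x in lebesgue_on \<Omega>. energy_density n \<epsilon> \<beta> ?w ?k x
     + (\<Sum>i=0..n. (u i x - v i x)\<^sup>2) / 16 + \<epsilon> / 8 * (norm (g x - h x))\<^sup>2
     \<le> (energy_density n \<epsilon> \<beta> u g x + energy_density n \<epsilon> \<beta> v h x) / 2 + \<beta> / 4 * (u 0 x - v 0 x)\<^sup>2"
      using admissibleD(2)[OF u] admissibleD(2)[OF v]
      by eventually_elim (rule energy_density_midpoint, auto)
  qed (use iw iu iv sq' sq[of 0] ig in auto)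
  also have "(LINT x|lebesgue_on \<Omega>. energy_density n \<epsilon> \<beta> ?w ?k x
     + (\<Sum>i=0..n. (u i x - v i x)\<^sup>2) / 16 + \<epsilon> / 8 * (norm (g x - h x))\<^sup>2)
     = energy n \<Omega> \<epsilon> \<beta> ?w + (\<Sum>i=0..n. LINT x|lebesgue_on \<Omega>. (u i x - v i x)\<^sup>2) / 16
      + \<epsilon> / 8 * (LINT x|lebesgue_on \<Omega>. (norm (g x - h x))\<^sup>2)"
  proof -
    have "(LINT x|lebesgue_on \<Omega>. (\<Sum>i=0..n. (u i x - v i x)\<^sup>2)) = (\<Sum>i=0..n. LINT x|lebesgue_on \<Omega>. (u i x - v i x)\<^sup>2)"
      using sq by (intro Bochner_Integration.integral_sum) auto
    then show ?thesis
      using iw sq' ig energy_eq[where u = ?w, OF \<Omega> admissibleD(1)[OF w] admissibleD(5)[OF w] k kw] by simp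
  qed
  also have "(LINT x|lebesgue_on \<Omega>. (energy_density n \<epsilon> \<beta> u g x + energy_density n \<epsilon> \<beta> v h x) / 2 + \<beta> / 4 * (u 0 x - v 0 x)\<^sup>2)
     = (energy n \<Omega> \<epsilon> \<beta> u + energy n \<Omega> \<epsilon> \<beta> v) / 2 + \<beta> / 4 * (LINT x|lebesgue_on \<Omega>. (u 0 x - v 0 x)\<^sup>2)"
    using iu iv sq[of 0] energy_eq[where u = u, OF \<Omega> admissibleD(1)[OF u] admissibleD(5)[OF u] g]
      energy_eq[where u = v, OF \<Omega> admissibleD(1)[OF v] admissibleD(5)[OF v] h] by simp
  finally show ?thesis .
qed

text \<open>
  Partial sums of the thresholds dominate each of them, so consecutive indices both lie beyond
  the required threshold.
\<close>

lemma fast_subsequence: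
  fixes d :: "nat \<Rightarrow> nat \<Rightarrow> real"
  assumes "\<And>e. e > 0 \<Longrightarrow> \<exists>N. \<forall>k\<ge>N. \<forall>l\<ge>N. d k l \<le> e"
  obtains s :: "nat \<Rightarrow> nat" where "\<And>k. k \<le> s k" "\<And>k. d (s k) (s (Suc k)) \<le> (1 / 4) ^ k"
proof -
  have "\<exists>N. \<forall>k\<ge>N. \<forall>l\<ge>N. d k l \<le> (1 / 4) ^ j" for j :: nat by (rule assms) simp
  then obtain N where N: "\<And>j k l. k \<ge> N j \<Longrightarrow> l \<ge> N j \<Longrightarrow> d k l \<le> (1 / 4) ^ j" by metis
  define s where "s k = (\<Sum>j\<le>k. N j) + k" for k
  have "N k \<le> s k" "N k \<le> s (Suc k)" for k
    using member_le_sum[of k "{..k}" N] by (auto simp: s_def)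
  then have "d (s k) (s (Suc k)) \<le> (1 / 4) ^ k" for k by (intro N)
  moreover have "k \<le> s k" for k by (simp add: s_def)
  ultimately show thesis using that by blast
qed

lemma combine_energy_bounds:
  fixes cs s cg \<gamma>' J E1 E2 E3 p q b :: real
  assumes "cs \<le> 1 / 16 * s" "cg \<le> \<gamma>'" "J \<le> E1" "E1 + s / 16 + \<gamma>' \<le> (E2 + E3) / 2 + b"
    "E2 \<le> J + p" "E3 \<le> J + q"
  shows "cs + cg \<le> (p + q) / 2 + b"
  using assms by (simp add: field_simps)

text \<open>
  Let \<open>u k\<close> have energy at most \<open>I + 1 / Suc k\<close>. The midpoint of two
  members has energy at least \<open>I\<close>, so the gain in \<open>energy_midpoint\<close> is
  at most the mean excess energy plus the loss, a multiple of the squared distance of the zeroth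
  components. The latter is small along a subsequence by compactness, hence so is the full
  squared distance \<open>d\<close> of components and gradients.
\<close>

lemma minimizing_sequence_fast:
  fixes \<Omega> :: "'a::euclidean_space set"
  assumes \<Omega>: "open \<Omega>" "bounded \<Omega>" and \<epsilon>: "\<epsilon> > 0" "\<beta> > 0"
    and I: "\<And>v. v \<in> admissible n \<Omega> m \<Longrightarrow> I \<le> energy n \<Omega> \<epsilon> \<beta> v"
      "\<And>e. e > 0 \<Longrightarrow> \<exists>v\<in>admissible n \<Omega> m. energy n \<Omega> \<epsilon> \<beta> v \<le> I + e"
  obtains v g where "\<And>k::nat. v k \<in> admissible n \<Omega> m" "\<And>k. g k \<in> L2 \<Omega>" "\<And>k. has_weak_gradient \<Omega> (v k 0) (g k)"
    "\<And>k. energy n \<Omega> \<epsilon> \<beta> (v k) \<le> I + 1 / real (Suc k)"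
    "\<And>k i. i \<le> n \<Longrightarrow> (LINT x|lebesgue_on \<Omega>. (v k i x - v (Suc k) i x)\<^sup>2) \<le> (1 / 4) ^ k"
    "\<And>k. (LINT x|lebesgue_on \<Omega>. (norm (g k x - g (Suc k) x))\<^sup>2) \<le> (1 / 4) ^ k"
proof -
  let ?E = "energy n \<Omega> \<epsilon> \<beta>"
  have "\<exists>v\<in>admissible n \<Omega> m. ?E v \<le> I + 1 / real (Suc k)" for k by (rule I(2)) simp
  then obtain u where u: "\<And>k. u k \<in> admissible n \<Omega> m" "\<And>k. ?E (u k) \<le> I + 1 / real (Suc k)" by metis
  define h where "h k = weak_gradient \<Omega> (u k 0)" for k
  have h: "has_weak_gradient \<Omega> (u k 0) (h k)" "h k \<in> L2 \<Omega>" for k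
    unfolding h_def using H1_weak_gradient[OF \<Omega> admissibleD(5)[OF u(1)]] by auto
  have M: "(LINT x|lebesgue_on \<Omega>. (norm (h k x))\<^sup>2) \<le> 2 / \<epsilon> * (I + 1)" for k
  proof -
    have "\<epsilon> / 2 * (LINT x|lebesgue_on \<Omega>. (norm (h k x))\<^sup>2) \<le> ?E (u k)"
      by (rule energy_gradient_bound[OF \<Omega> \<epsilon> u(1) h(2,1)])
    also have "\<dots> \<le> I + 1" using u(2)[of k] by (rule order_trans) simp
    finally show ?thesis using \<epsilon>(1) by (simp add: field_simps)
  qed
  have u01: "AE x in lebesgue_on \<Omega>. 0 \<le> u k 0 x \<and> u k 0 x \<le> 1" for k
    using admissibleD(2)[OF u(1)[of k]] by (auto elim: eventually_mono)
  obtain r :: "nat \<Rightarrow> nat" where r: "strict_mono r"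
    "\<And>e. e > 0 \<Longrightarrow> \<exists>N. \<forall>k\<ge>N. \<forall>l\<ge>N. (LINT x|lebesgue_on \<Omega>. (u (r k) 0 x - u (r l) 0 x)\<^sup>2) < e"
    by (rule L2_Cauchy_subsequence[where u = "\<lambda>k. u k 0" and g = h, OF \<Omega> admissibleD(1)[OF u(1)] u01 h M])
       (auto intro: that)
  \<comment> \<open>The smaller of the convexity constants of the entropy and of the gradient term.\<close>
  define c where "c = min (1 / 16) (\<epsilon> / 8)"
  have c: "c > 0" "c \<le> 1 / 16" "c \<le> \<epsilon> / 8" using \<epsilon> by (auto simp: c_def)
  define d where "d k l = (\<Sum>i=0..n. LINT x|lebesgue_on \<Omega>. (u (r k) i x - u (r l) i x)\<^sup>2)
      + (LINT x|lebesgue_on \<Omega>. (norm (h (r k) x - h (r l) x))\<^sup>2)" for k l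
  have dle: "c * d k l \<le> (1 / real (Suc k) + 1 / real (Suc l)) / 2
      + \<beta> / 4 * (LINT x|lebesgue_on \<Omega>. (u (r k) 0 x - u (r l) 0 x)\<^sup>2)" for k l
  proof -
    have small: "?E (u (r k)) \<le> I + 1 / real (Suc k)" for k
      using u(2)[of "r k"] strict_mono_imp_increasing[OF r(1), of k]
      by (smt (verit) frac_le of_nat_0_less_iff of_nat_mono Suc_le_mono zero_less_Suc)
    let ?S = "\<Sum>i=0..n. LINT x|lebesgue_on \<Omega>. (u (r k) i x - u (r l) i x)\<^sup>2"
    let ?G = "LINT x|lebesgue_on \<Omega>. (norm (h (r k) x - h (r l) x))\<^sup>2"
    have "c * ?S \<le> 1 / 16 * ?S" by (rule mult_right_mono[OF c(2)]) (simp add: sum_nonneg)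
    moreover have "c * ?G \<le> \<epsilon> / 8 * ?G" by (rule mult_right_mono[OF c(3)]) simp
    moreover have "I \<le> ?E (\<lambda>i x. (u (r k) i x + u (r l) i x) / 2)"
      by (rule I(1), rule midpoint_admissible[OF \<Omega> u(1) u(1) h(2,1) h(2,1)])
    moreover note energy_midpoint[OF \<Omega> \<epsilon> u(1)[of "r k"] u(1)[of "r l"] h(2,1) h(2,1)] small[of k] small[of l]
    ultimately show ?thesis unfolding d_def distrib_left by (rule combine_energy_bounds)
  qed
  have "\<exists>N. \<forall>k\<ge>N. \<forall>l\<ge>N. d k l \<le> e" if e: "e > 0" for e
  proof -
    have "c * e / \<beta> > 0" using c e \<epsilon> by simp
    from r(2)[OF this] obtain N1 where
      N1: "\<And>k l. k \<ge> N1 \<Longrightarrow> l \<ge> N1 \<Longrightarrow> (LINT x|lebesgue_on \<Omega>. (u (r k) 0 x - u (r l) 0 x)\<^sup>2) < c * e / \<beta>" by blast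
    obtain N2 where N2: "inverse (real (Suc N2)) < c * e / 2"
      using reals_Archimedean[of "c * e / 2"] c e by auto
    have "d k l \<le> e" if "k \<ge> max N1 N2" "l \<ge> max N1 N2" for k l
    proof -
      have inv: "1 / real (Suc j) \<le> c * e / 2" if "j \<ge> N2" for j
      proof -
        have "1 / real (Suc j) \<le> 1 / real (Suc N2)" using that by (intro divide_left_mono) auto
        then show ?thesis using N2 by (simp add: inverse_eq_divide)
      qed
      have "\<beta> / 4 * (LINT x|lebesgue_on \<Omega>. (u (r k) 0 x - u (r l) 0 x)\<^sup>2) \<le> \<beta> / 4 * (c * e / \<beta>)"
        using N1[of k l] that \<epsilon> by (intro mult_left_mono) auto
      also have "\<dots> = c * e / 4" using \<epsilon> by simp
      finally have lower: "\<beta> / 4 * (LINT x|lebesgue_on \<Omega>. (u (r k) 0 x - u (r l) 0 x)\<^sup>2) \<le> c * e / 4" .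
      have "1 / real (Suc k) + 1 / real (Suc l) \<le> c * e / 2 + c * e / 2"
        using that by (intro add_mono inv) auto
      then have "(1 / real (Suc k) + 1 / real (Suc l)) / 2 \<le> c * e / 2" by simp
      from order_trans[OF dle add_mono[OF this lower]]
      have "c * d k l \<le> c * e / 2 + c * e / 4" .
      moreover have "0 < c * e" using c e by simp
      ultimately have "c * d k l \<le> c * e" by simp
      then show ?thesis using c by simp
    qed
    then show ?thesis by blast
  qed
  then obtain s :: "nat \<Rightarrow> nat" where s: "\<And>k. k \<le> s k" "\<And>k. d (s k) (s (Suc k)) \<le> (1 / 4) ^ k"
    using fast_subsequence by metis
  show thesis
  proof (rule that[of "\<lambda>k. u (r (s k))" "\<lambda>k. h (r (s k))"])
    show "u (r (s k)) \<in> admissible n \<Omega> m" "h (r (s k)) \<in> L2 \<Omega>" "has_weak_gradient \<Omega> (u (r (s k)) 0) (h (r (s k)))" for k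
      by (rule u h)+
    show "?E (u (r (s k))) \<le> I + 1 / real (Suc k)" for k
    proof -
      have "k \<le> r (s k)" using s(1)[of k] strict_mono_imp_increasing[OF r(1), of "s k"] by simp
      then have "1 / real (Suc (r (s k))) \<le> 1 / real (Suc k)" by (intro divide_left_mono) auto
      then show ?thesis using u(2)[of "r (s k)"] by simp
    qed
    have G0: "0 \<le> (LINT x|lebesgue_on \<Omega>. (norm (h (r k) x - h (r l) x))\<^sup>2)" for k l by simp
    show "(LINT x|lebesgue_on \<Omega>. (u (r (s k)) i x - u (r (s (Suc k))) i x)\<^sup>2) \<le> (1 / 4) ^ k" if "i \<le> n" for k i
    proof -
      have "(LINT x|lebesgue_on \<Omega>. (u (r (s k)) i x - u (r (s (Suc k))) i x)\<^sup>2) \<le> d (s k) (s (Suc k))"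
        unfolding d_def
        using member_le_sum[of i "{0..n}" "\<lambda>i. LINT x|lebesgue_on \<Omega>. (u (r (s k)) i x - u (r (s (Suc k))) i x)\<^sup>2"] that
        by (intro add_increasing2[OF G0]) simp
      then show ?thesis using s(2)[of k] by simp
    qed
    show "(LINT x|lebesgue_on \<Omega>. (norm (h (r (s k)) x - h (r (s (Suc k))) x))\<^sup>2) \<le> (1 / 4) ^ k" for k
    proof -
      have "0 \<le> (\<Sum>i=0..n. LINT x|lebesgue_on \<Omega>. (u (r (s k)) i x - u (r (s (Suc k))) i x)\<^sup>2)"
        by (intro sum_nonneg) simp
      then show ?thesis using s(2)[of k] unfolding d_def by linarith
    qed
  qed
qed

text \<open>
  The components and the gradients converge almost everywhere. The components are bounded by 1
  and the gradients by an integrable function \<open>W\<close>, so dominated convergence yields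
  the constraints and the weak gradient of the limit; Fatou's lemma yields the square
  integrability of the gradient and the energy bound.
\<close>

lemma limit_admissible_energy_le:
  fixes v :: "nat \<Rightarrow> nat \<Rightarrow> 'a::euclidean_space \<Rightarrow> real"
  assumes \<Omega>: "open \<Omega>" "bounded \<Omega>" and \<epsilon>: "\<epsilon> > 0" "\<beta> > 0"
    and v: "\<And>k. v k \<in> admissible n \<Omega> m" and g: "\<And>k. g k \<in> L2 \<Omega>" "\<And>k. has_weak_gradient \<Omega> (v k 0) (g k)"
    and E: "\<And>k. energy n \<Omega> \<epsilon> \<beta> (v k) \<le> I + 1 / real (Suc k)"
    and vfast: "\<And>k i. i \<le> n \<Longrightarrow> (LINT x|lebesgue_on \<Omega>. (v k i x - v (Suc k) i x)\<^sup>2) \<le> (1 / 4) ^ k"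
    and gfast: "\<And>k. (LINT x|lebesgue_on \<Omega>. (norm (g k x - g (Suc k) x))\<^sup>2) \<le> (1 / 4) ^ k"
  shows "\<exists>u\<in>admissible n \<Omega> m. energy n \<Omega> \<epsilon> \<beta> u \<le> I"
proof -
  have \<Omega>m: "\<Omega> \<in> sets lebesgue" using \<Omega> by auto
  interpret finite_measure "lebesgue_on \<Omega>" by (rule finite_measure_lebesgue_on[OF \<Omega>(2) \<Omega>m])
  have vm: "v k i \<in> borel_measurable (lebesgue_on \<Omega>)" if "i \<le> n" for k i by (rule admissibleD(1)[OF v that])
  have gm[measurable]: "g k \<in> borel_measurable (lebesgue_on \<Omega>)" for k using g by (auto simp: L2_def)
  have v01: "AE x in lebesgue_on \<Omega>. \<forall>k. \<forall>i\<le>n. 0 \<le> v k i x \<and> v k i x \<le> 1"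
    using admissibleD(2)[OF v] by (subst AE_all_countable) blast
  have vi: "integrable (lebesgue_on \<Omega>) (v k i)" if "i \<le> n" for k i
    by (rule integrable_const_bound[where B = 1])
       (use v01 vm that in \<open>auto elim!: eventually_mono\<close>)
  have vconv: "AE x in lebesgue_on \<Omega>. \<forall>i\<in>{..n}. convergent (\<lambda>k. v k i x)"
  proof (rule AE_finite_allI)
    fix i assume "i \<in> {..n}"
    then have i: "i \<le> n" by simp
    show "AE x in lebesgue_on \<Omega>. convergent (\<lambda>k. v k i x)"
    proof (rule fast_L2_Cauchy_converges[of "\<lambda>k. v k i"])
      show "v k i \<in> borel_measurable (lebesgue_on \<Omega>)" for k by (rule vm[OF i])
      show "integrable (lebesgue_on \<Omega>) (v 0 i)" by (rule vi[OF i])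
      show "integrable (lebesgue_on \<Omega>) (\<lambda>x. (norm (v k i x - v (Suc k) i x))\<^sup>2)" for k
        using square_diff_integrable[OF \<Omega> v v i] by simp
      show "(LINT x|lebesgue_on \<Omega>. (norm (v k i x - v (Suc k) i x))\<^sup>2) \<le> (1 / 4) ^ k" for k
        using vfast[OF i] by simp
    qed (auto elim: eventually_mono)
  qed simp
  obtain W where W: "integrable (lebesgue_on \<Omega>) W"
    "AE x in lebesgue_on \<Omega>. convergent (\<lambda>k. g k x) \<and> (\<forall>k. norm (g k x) \<le> W x)"
  proof (rule fast_L2_Cauchy_converges[of g])
    show "g k \<in> borel_measurable (lebesgue_on \<Omega>)" for k by (rule gm)
    show "integrable (lebesgue_on \<Omega>) (g 0)" by (rule L2_imp_integrable(1)[OF \<Omega>(2) \<Omega>m g(1)])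
    show "integrable (lebesgue_on \<Omega>) (\<lambda>x. (norm (g k x - g (Suc k) x))\<^sup>2)" for k
      using L2_diff[OF g(1)[of k] g(1)[of "Suc k"]] by (simp add: L2_def)
  qed (use gfast in auto)
  define u where "u i x = lim (\<lambda>k. v k i x)" for i x
  define h where "h x = lim (\<lambda>k. g k x)" for x
  have um: "u i \<in> borel_measurable (lebesgue_on \<Omega>)" if "i \<le> n" for i
    unfolding u_def[abs_def] using vm[OF that] by measurable
  have hm[measurable]: "h \<in> borel_measurable (lebesgue_on \<Omega>)" unfolding h_def[abs_def] by measurable
  have ulim: "AE x in lebesgue_on \<Omega>. \<forall>i\<le>n. (\<lambda>k. v k i x) \<longlonglongrightarrow> u i x"
    using vconv by eventually_elim (auto simp: u_def convergent_LIMSEQ_iff)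
  have hlim: "AE x in lebesgue_on \<Omega>. (\<lambda>k. g k x) \<longlonglongrightarrow> h x"
    using W(2) by eventually_elim (auto simp: h_def convergent_LIMSEQ_iff)
  have u01: "AE x in lebesgue_on \<Omega>. \<forall>i\<le>n. 0 \<le> u i x \<and> u i x \<le> 1"
    using ulim v01
  proof eventually_elim
    fix x assume l: "\<forall>i\<le>n. (\<lambda>k. v k i x) \<longlonglongrightarrow> u i x" and b: "\<forall>k. \<forall>i\<le>n. 0 \<le> v k i x \<and> v k i x \<le> 1"
    have "0 \<le> u i x \<and> u i x \<le> 1" if "i \<le> n" for i
      using l b that LIMSEQ_le_const[of "\<lambda>k. v k i x" "u i x" 0] LIMSEQ_le_const2[of "\<lambda>k. v k i x" "u i x" 1] by blast
    then show "\<forall>i\<le>n. 0 \<le> u i x \<and> u i x \<le> 1" by blast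
  qed
  have vsum: "AE x in lebesgue_on \<Omega>. \<forall>k. (\<Sum>j=0..n. v k j x) = 1"
    using admissibleD(3)[OF v] by (subst AE_all_countable) blast
  have usum: "AE x in lebesgue_on \<Omega>. (\<Sum>j=0..n. u j x) = 1"
    using ulim vsum
  proof eventually_elim
    fix x assume l: "\<forall>i\<le>n. (\<lambda>k. v k i x) \<longlonglongrightarrow> u i x" and s: "\<forall>k. (\<Sum>j=0..n. v k j x) = 1"
    have "(\<lambda>k. \<Sum>j=0..n. v k j x) \<longlonglongrightarrow> (\<Sum>j=0..n. u j x)" using l by (intro tendsto_sum) auto
    then show "(\<Sum>j=0..n. u j x) = 1" using s LIMSEQ_unique[OF _ tendsto_const[of 1]] by simp
  qed
  have uint: "(LINT x|lebesgue_on \<Omega>. u i x) = m i" if i: "i \<le> n" for i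
  proof -
    have "(\<lambda>k. LINT x|lebesgue_on \<Omega>. v k i x) \<longlonglongrightarrow> (LINT x|lebesgue_on \<Omega>. u i x)"
    proof (rule integral_dominated_convergence[where w = "\<lambda>x. 1"])
      show "AE x in lebesgue_on \<Omega>. (\<lambda>k. v k i x) \<longlonglongrightarrow> u i x" using ulim i by (auto elim: eventually_mono)
      show "AE x in lebesgue_on \<Omega>. norm (v k i x) \<le> 1" for k using v01 i by (auto elim!: eventually_mono)
    qed (use um vm i in auto)
    then show ?thesis using admissibleD(4)[OF v i] LIMSEQ_unique[OF _ tendsto_const[of "m i"]] by simp
  qed
  have "integrable (lebesgue_on \<Omega>) (\<lambda>x. (norm (h x))\<^sup>2)"
  proof (rule fatou_real(1)[where f = "\<lambda>k x. (norm (g k x))\<^sup>2" and a = "\<lambda>k. 2 / \<epsilon> * (I + 1)"])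
    show "integrable (lebesgue_on \<Omega>) (\<lambda>x. (norm (g k x))\<^sup>2)" for k using g by (auto simp: L2_def)
    show "AE x in lebesgue_on \<Omega>. (\<lambda>k. (norm (g k x))\<^sup>2) \<longlonglongrightarrow> (norm (h x))\<^sup>2"
      using hlim by eventually_elim (intro tendsto_intros)
    show "(LINT x|lebesgue_on \<Omega>. (norm (g k x))\<^sup>2) \<le> 2 / \<epsilon> * (I + 1)" for k
    proof -
      have "\<epsilon> / 2 * (LINT x|lebesgue_on \<Omega>. (norm (g k x))\<^sup>2) \<le> energy n \<Omega> \<epsilon> \<beta> (v k)"
        by (rule energy_gradient_bound[OF \<Omega> \<epsilon> v g])
      also have "\<dots> \<le> I + 1" using E[of k] by (rule order_trans) simp
      finally show ?thesis using \<epsilon>(1) by (simp add: field_simps)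
    qed
  qed auto
  then have hL2: "h \<in> L2 \<Omega>" by (simp add: L2_def)
  have ui: "integrable (lebesgue_on \<Omega>) (u 0)"
    by (rule integrable_const_bound[where B = 1]) (use u01 um in \<open>auto elim!: eventually_mono\<close>)
  have hw: "has_weak_gradient \<Omega> (u 0) h"
    unfolding has_weak_gradient_def
  proof (intro conjI ballI)
    show "u 0 \<in> L1_loc \<Omega>" by (rule integrable_imp_L1_loc[OF \<Omega>m ui])
    show "h \<in> L1_loc \<Omega>" by (rule integrable_imp_L1_loc[OF \<Omega>m L2_imp_integrable(1)[OF \<Omega>(2) \<Omega>m hL2]])
    fix \<phi> and b :: 'a assume \<phi>: "\<phi> \<in> test_functions \<Omega>" and b: "b \<in> Basis"
    obtain C where C: "smooth \<phi>" "compact C" "C \<subseteq> \<Omega>" "\<And>x. x \<notin> C \<Longrightarrow> \<phi> x = 0"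
      using test_functionsE[OF \<phi>] by metis
    let ?D = "\<lambda>x. frechet_derivative \<phi> (at x) b"
    obtain L where L: "continuous_on UNIV ?D" "\<And>x. \<bar>?D x\<bar> \<le> L"
      by (rule smooth_directional_derivative[where h = b, OF C(1,2,4)]) (assumption, rule that)
    obtain B where B: "B > 0" "\<And>x. \<bar>\<phi> x\<bar> \<le> B"
      by (rule continuous_compact_support_bounded[OF smooth_continuous_on[OF C(1)] C(2,4)]) (assumption, rule that)
    have [measurable]: "\<phi> \<in> borel_measurable (lebesgue_on \<Omega>)" "?D \<in> borel_measurable (lebesgue_on \<Omega>)"
      using smooth_continuous_on[OF C(1)] smooth_continuous_on[OF smooth_derivative[OF C(1) b]] \<Omega>m
      by (auto intro: continuous_imp_measurable_on_sets_lebesgue)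
    note [measurable] = vm[of 0, simplified] um[of 0, simplified]
    have 1: "(\<lambda>k. LINT x|lebesgue_on \<Omega>. v k 0 x * ?D x) \<longlonglongrightarrow> (LINT x|lebesgue_on \<Omega>. u 0 x * ?D x)"
    proof (rule integral_dominated_convergence[where w = "\<lambda>x. L"])
      show "AE x in lebesgue_on \<Omega>. (\<lambda>k. v k 0 x * ?D x) \<longlonglongrightarrow> u 0 x * ?D x"
        using ulim by eventually_elim (intro tendsto_intros, simp)
      show "AE x in lebesgue_on \<Omega>. norm (v k 0 x * ?D x) \<le> L" for k
        using v01
      proof eventually_elim
        fix x assume "\<forall>k. \<forall>i\<le>n. 0 \<le> v k i x \<and> v k i x \<le> 1"
        then have "\<bar>v k 0 x\<bar> * \<bar>?D x\<bar> \<le> 1 * L" by (intro mult_mono L) auto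
        then show "norm (v k 0 x * ?D x) \<le> L" by (simp add: abs_mult)
      qed
    qed simp_all
    have 2: "(\<lambda>k. LINT x|lebesgue_on \<Omega>. (g k x \<bullet> b) * \<phi> x) \<longlonglongrightarrow> (LINT x|lebesgue_on \<Omega>. (h x \<bullet> b) * \<phi> x)"
    proof (rule integral_dominated_convergence[where w = "\<lambda>x. W x * B"])
      show "AE x in lebesgue_on \<Omega>. (\<lambda>k. (g k x \<bullet> b) * \<phi> x) \<longlonglongrightarrow> (h x \<bullet> b) * \<phi> x"
        using hlim by eventually_elim (intro tendsto_intros)
      show "AE x in lebesgue_on \<Omega>. norm ((g k x \<bullet> b) * \<phi> x) \<le> W x * B" for k
        using W(2)
      proof eventually_elim
        fix x assume a: "convergent (\<lambda>k. g k x) \<and> (\<forall>k. norm (g k x) \<le> W x)"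
        have "\<bar>g k x \<bullet> b\<bar> \<le> norm (g k x)" using Basis_le_norm[OF b] .
        also have "\<dots> \<le> W x" using a by blast
        finally have "\<bar>g k x \<bullet> b\<bar> * \<bar>\<phi> x\<bar> \<le> W x * B" by (intro mult_mono B) auto
        then show "norm ((g k x \<bullet> b) * \<phi> x) \<le> W x * B" by (simp add: abs_mult)
      qed
    qed (use W(1) in simp_all)
    have "(LINT x|lebesgue_on \<Omega>. v k 0 x * ?D x) = - (LINT x|lebesgue_on \<Omega>. (g k x \<bullet> b) * \<phi> x)" for k
      using g(2)[of k] \<phi> b by (simp add: has_weak_gradient_def)
    then have "(\<lambda>k. - (LINT x|lebesgue_on \<Omega>. (g k x \<bullet> b) * \<phi> x)) \<longlonglongrightarrow> (LINT x|lebesgue_on \<Omega>. u 0 x * ?D x)"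
      using 1 by simp
    then show "(LINT x|lebesgue_on \<Omega>. u 0 x * ?D x) = - (LINT x|lebesgue_on \<Omega>. (h x \<bullet> b) * \<phi> x)"
      using LIMSEQ_unique tendsto_minus[OF 2] by blast
  qed
  have uadm: "u \<in> admissible n \<Omega> m"
    by (rule admissibleI[OF \<Omega> um u01 usum uint hL2 hw])
  have "(LINT x|lebesgue_on \<Omega>. energy_density n \<epsilon> \<beta> u h x) \<le> I"
  proof (rule fatou_real(2)[where f = "\<lambda>k. energy_density n \<epsilon> \<beta> (v k) (g k)" and a = "\<lambda>k. I + 1 / real (Suc k)"])
    show "integrable (lebesgue_on \<Omega>) (energy_density n \<epsilon> \<beta> (v k) (g k))" for k
      by (rule energy_density_integrable[OF \<Omega> \<epsilon> admissibleD(1,2)[OF v] g(1)])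
    show "AE x in lebesgue_on \<Omega>. 0 \<le> energy_density n \<epsilon> \<beta> (v k) (g k) x" for k
      using v01
    proof eventually_elim
      fix x assume a: "\<forall>k. \<forall>i\<le>n. 0 \<le> v k i x \<and> v k i x \<le> 1"
      have "0 \<le> \<epsilon> / 2 * (norm (g k x))\<^sup>2" using \<epsilon> by simp
      also have "\<dots> \<le> energy_density n \<epsilon> \<beta> (v k) (g k) x"
        by (rule energy_density_ge(1)) (use a \<epsilon> in auto)
      finally show "0 \<le> energy_density n \<epsilon> \<beta> (v k) (g k) x" .
    qed
    show "energy_density n \<epsilon> \<beta> u h \<in> borel_measurable (lebesgue_on \<Omega>)"
      by (rule energy_density_measurable[OF um hm])
    show "AE x in lebesgue_on \<Omega>. (\<lambda>k. energy_density n \<epsilon> \<beta> (v k) (g k) x) \<longlonglongrightarrow> energy_density n \<epsilon> \<beta> u h x"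
      using ulim v01 hlim
    proof eventually_elim
      fix x assume l: "\<forall>i\<le>n. (\<lambda>k. v k i x) \<longlonglongrightarrow> u i x" and b: "\<forall>k. \<forall>i\<le>n. 0 \<le> v k i x \<and> v k i x \<le> 1"
        and hl: "(\<lambda>k. g k x) \<longlonglongrightarrow> h x"
      have l0: "(\<lambda>k. v k 0 x) \<longlonglongrightarrow> u 0 x" using l by simp
      have S: "(\<lambda>k. \<Sum>i=0..n. v k i x * ln (v k i x) - v k i x + 1) \<longlonglongrightarrow>
          (\<Sum>i=0..n. u i x * ln (u i x) - u i x + 1)"
      proof (rule tendsto_sum)
        fix i assume "i \<in> {0..n}"
        then have i: "i \<le> n" by simp
        have "(\<lambda>k. v k i x * ln (v k i x)) \<longlonglongrightarrow> u i x * ln (u i x)"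
          by (rule tendsto_mult_ln) (use l b i in auto)
        moreover have "(\<lambda>k. v k i x) \<longlonglongrightarrow> u i x" using l i by simp
        ultimately show "(\<lambda>k. v k i x * ln (v k i x) - v k i x + 1) \<longlonglongrightarrow> u i x * ln (u i x) - u i x + 1"
          by (intro tendsto_add tendsto_diff tendsto_const)
      qed
      show "(\<lambda>k. energy_density n \<epsilon> \<beta> (v k) (g k) x) \<longlonglongrightarrow> energy_density n \<epsilon> \<beta> u h x"
        unfolding energy_density_def by (intro tendsto_add S tendsto_intros hl l0)
    qed
    show "(LINT x|lebesgue_on \<Omega>. energy_density n \<epsilon> \<beta> (v k) (g k) x) \<le> I + 1 / real (Suc k)" for k
      using E[of k] energy_eq[where u = "v k", OF \<Omega> admissibleD(1)[OF v] admissibleD(5)[OF v] g] by simp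
    have "(\<lambda>k. I + 1 / real (Suc k)) \<longlonglongrightarrow> I + 0"
      using LIMSEQ_inverse_real_of_nat by (intro tendsto_add tendsto_const) (simp add: inverse_eq_divide)
    then show "(\<lambda>k. I + 1 / real (Suc k)) \<longlonglongrightarrow> I" by simp
  qed
  then have "energy n \<Omega> \<epsilon> \<beta> u \<le> I"
    using energy_eq[where u = u, OF \<Omega> admissibleD(1)[OF uadm] admissibleD(5)[OF uadm] hL2 hw] by simp
  with uadm show ?thesis by blast
qed

text \<open>
  The admissible set is nonempty, as the prescribed masses add up to the volume.
\<close>

lemma constants_admissible:
  fixes \<Omega> :: "'a::euclidean_space set"
  assumes \<Omega>: "open \<Omega>" "bounded \<Omega>" and m: "\<And>i. i \<le> n \<Longrightarrow> m i > 0"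
    and sum: "(\<Sum>j=0..n. m j) = measure lebesgue \<Omega>"
  shows "(\<lambda>i x. m i / measure lebesgue \<Omega>) \<in> admissible n \<Omega> m"
proof -
  have \<Omega>m: "\<Omega> \<in> sets lebesgue" using \<Omega> by auto
  interpret finite_measure "lebesgue_on \<Omega>" by (rule finite_measure_lebesgue_on[OF \<Omega>(2) \<Omega>m])
  have pos: "measure lebesgue \<Omega> > 0"
    unfolding sum[symmetric] by (rule sum_pos) (use m in auto)
  have mu: "measure (lebesgue_on \<Omega>) (space (lebesgue_on \<Omega>)) = measure lebesgue \<Omega>"
    using \<Omega>m by (simp add: measure_restrict_space)
  show ?thesis
    unfolding admissible_def
  proof (intro CollectI conjI allI impI)
    show "(\<lambda>x. m 0 / measure lebesgue \<Omega>) \<in> H1 \<Omega>" by (rule const_in_H1[OF \<Omega>])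
    show "AE x in lebesgue_on \<Omega>. (\<Sum>j=0..n. m j / measure lebesgue \<Omega>) = 1"
      using pos by (simp add: sum flip: sum_divide_distrib)
    fix i assume "i \<le> n"
    show "(\<lambda>x. m i / measure lebesgue \<Omega>) \<in> Linf \<Omega>" by (auto simp: Linf_def)
    show "AE x in lebesgue_on \<Omega>. 0 \<le> m i / measure lebesgue \<Omega>" using m[OF \<open>i \<le> n\<close>] by simp
    show "(LINT x|lebesgue_on \<Omega>. m i / measure lebesgue \<Omega>) = m i" using pos mu by simp
  qed
qed

theorem lemma2p1:
  fixes n :: nat
    and \<Omega> :: "(real ^ 'd) set"
    and \<epsilon> \<beta> :: real
    and m :: "nat \<Rightarrow> real"
  assumes "n \<ge> 1"
    and "CARD('d) \<in> {1, 2, 3}"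
    and "smooth_bounded_domain \<Omega>"
    and "\<epsilon> > 0" and "\<beta> > 0"
    and "\<And>i. i \<le> n \<Longrightarrow> m i > 0"
    and "(\<Sum>j=0..n. m j) = measure lebesgue \<Omega>"
  shows "\<exists>u \<in> admissible n \<Omega> m. \<forall>v \<in> admissible n \<Omega> m. energy n \<Omega> \<epsilon> \<beta> u \<le> energy n \<Omega> \<epsilon> \<beta> v"
proof -
  have \<Omega>: "open \<Omega>" "bounded \<Omega>" using assms(3) by (auto simp: smooth_bounded_domain_def)
  let ?A = "admissible n \<Omega> m" and ?E = "energy n \<Omega> \<epsilon> \<beta>"
  have ne: "?E ` ?A \<noteq> {}" using constants_admissible[OF \<Omega> assms(6,7)] by blast
  have "0 \<le> ?E v" if v: "v \<in> ?A" for v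
  proof -
    note w = H1_weak_gradient[OF \<Omega> admissibleD(5)[OF v]]
    have "0 \<le> \<epsilon> / 2 * (LINT x|lebesgue_on \<Omega>. (norm (weak_gradient \<Omega> (v 0) x))\<^sup>2)" using assms(4) by simp
    then show ?thesis using energy_gradient_bound[OF \<Omega> assms(4,5) v w(2,1)] by linarith
  qed
  then have bdd: "bdd_below (?E ` ?A)" by (intro bdd_belowI[of _ 0]) auto
  define I where "I = Inf (?E ` ?A)"
  have I: "I \<le> ?E v" if "v \<in> ?A" for v unfolding I_def using that bdd by (intro cInf_lower) auto
  have I2: "\<exists>v\<in>?A. ?E v \<le> I + e" if "e > 0" for e
  proof -
    have "Inf (?E ` ?A) < I + e" using that by (simp add: I_def)
    from cInf_lessD[OF ne this] show ?thesis by force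
  qed
  obtain v g where "\<And>k::nat. v k \<in> ?A" "\<And>k. g k \<in> L2 \<Omega>" "\<And>k. has_weak_gradient \<Omega> (v k 0) (g k)"
    "\<And>k. ?E (v k) \<le> I + 1 / real (Suc k)"
    "\<And>k i. i \<le> n \<Longrightarrow> (LINT x|lebesgue_on \<Omega>. (v k i x - v (Suc k) i x)\<^sup>2) \<le> (1 / 4) ^ k"
    "\<And>k. (LINT x|lebesgue_on \<Omega>. (norm (g k x - g (Suc k) x))\<^sup>2) \<le> (1 / 4) ^ k"
    by (rule minimizing_sequence_fast[OF \<Omega> assms(4,5) I I2]) (assumption, assumption, rule that)
  then have "\<exists>u\<in>?A. ?E u \<le> I"
    by (rule limit_admissible_energy_le[OF \<Omega> assms(4,5)])
  then show ?thesis using I order_trans by blast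
qed

end
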